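(* Let $(\mathcal X,\mathcal X^\Omega)$ be a standard quasi-universal space and $(\mathcal Z,\mathcal Z^\Omega)$ another quasi-universal space. Write $(\mathcal X_{\mathbb N},\mathcal X_{\mathbb N}^\Omega):=\prod_{n\in\mathbb N}(\mathcal X,\mathcal X^\Omega)$ for the countable power in $\mathbf{QUS}$. For a Markov kernel $Q(X_{\mathbb N}|Z)\in\mathsf P(\mathcal X_{\mathbb N})^{\mathcal Z}$ the following are equivalent: 1. $Q(X_{\mathbb N}|Z)$ is exchangeable, i.e. invariant under all finite permutations $\sigma:\mathbb N\to\mathbb N$. 2. There exist a quasi-universal space $\mathcal S$ and Markov kernels $Q(X|S)\in\mathsf P(\mathcal X)^{\mathcal S}$ and $P(S|Z)\in\mathsf P(\mathcal S)^{\mathcal Z}$ such that $$Q(X_{\mathbb N}|Z)=\Bigl(\bigotimes_{n\in\mathbb N}Q(X_n|S)\Bigr)\circ P(S|Z).$$ If this is the case, one can without loss of generality choose $\mathcal S=\mathsf P(\mathcal X)$ and $Q(X|S)=\mathrm{id}_{\mathsf P(\mathcal X)}:\mathsf P(\mathcal X)\to\mathsf P(\mathcal X)$, i.e. $Q(X\in A|S=P):=P(A)$.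
   Context: Fix the sample space: $\Omega=[0,1]^{\mathbb N}$, $\mathcal B_\Omega$ the $\sigma$-algebra of all universally measurable subsets of $\Omega$, $\Omega^\Omega$ the set of all measurable maps $(\Omega,\mathcal B_\Omega)\to(\Omega,\mathcal B_\Omega)$. A quasi-universal space (object of $\mathbf{QUS}$) is a pair $(\mathcal X,\mathcal X^\Omega)$ of a set and a set $\mathcal X^\Omega$ of maps $\Omega\to\mathcal X$ (admissible random variables) containing all constants and closed under $X\mapsto X\circ\Phi$, $\Phi\in\Omega^\Omega$; $g:\mathcal X\to\mathcal Y$ is quasi-measurable if $g\circ\mathcal X^\Omega\subseteq\mathcal Y^\Omega$; products carry the componentwise structure $\prod_i\mathcal X_i^\Omega$. $\mathcal X^{\mathcal Z}$ is the set of quasi-measurable maps $\mathcal Z\to\mathcal X$, and $(\mathcal X^\Omega)^\Omega$ is the set of maps $X:\Omega\to\mathcal X^\Omega$ with $(\omega,\omega')\mapsto X(\omega)(\omega')$ quasi-measurable $\Omega\times\Omega\to\mathcal X$. The induced $\sigma$-algebra is $\mathcal B_{\mathcal X}=\{A\subseteq\mathcal X\mid X^{-1}(A)\in\mathcal B_\Omega\ \forall X\in\mathcal X^\Omega\}$. A space is standard if it is empty or a retract of $(\Omega,\Omega^\Omega)$, i.e. there are quasi-measurable $i:\mathcal X\to\Omega$, $r:\Omega\to\mathcal X$ with $r\circ i=\mathrm{id}$. $\mathsf P(\mathcal X)$ is the quasi-universal space of push-forward measures $X_*P$ on $\mathcal B_{\mathcal X}$, with $X\in\mathcal X^\Omega$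 and $P$ a probability measure on $(\Omega,\mathcal B_\Omega)$; its admissible random variables are the maps $\omega\mapsto X(\omega)_*P$ with $X\in(\mathcal X^\Omega)^\Omega$, $P$ a probability measure on $(\Omega,\mathcal B_\Omega)$. Elements of $\mathsf P(\mathcal X)^{\mathcal Z}$ are Markov kernels. Composition of $K(X|S)\in\mathsf P(\mathcal X)^{\mathcal S}$ and $P(S|Z)\in\mathsf P(\mathcal S)^{\mathcal Z}$: $(K\circ P)(A|z)=\int K(X\in A|S=s)\,P(S\in ds|Z=z)$. $\bigotimes_{n\in\mathbb N}Q(X_n|S)\in\mathsf P(\mathcal X_{\mathbb N})^{\mathcal S}$ is the unique Markov kernel whose marginal on the first $n+1$ coordinates is, for every $n$ and $s$, the product of $n+1$ copies of $Q(X|S=s)$. A finite permutation is a bijection of $\mathbb N$ moving only finitely many points; invariance means that for every $z$ the measure $Q(X_{\mathbb N}|Z=z)$ is preserved by push-forward along $(x_n)_n\mapsto(x_{\sigma(n)})_n$. *)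

theory Defs
  imports "HOL-Probability.Probability"
begin

text \<open>Maps between carriers are extensional functions (\<open>\<rightarrow>\<^sub>E\<close>), so that equality of maps is equality
  on the carrier and \<^const>\<open>compose\<close> is composition.\<close>

section \<open>The sample space\<close>

definition Omega :: "(nat \<Rightarrow> real) set" where
  "Omega = UNIV \<rightarrow>\<^sub>E {0..1}"

definition Omega_borel :: "(nat \<Rightarrow> real) measure" where
  "Omega_borel = restrict_space borel Omega"

definition universally_measurable :: "(nat \<Rightarrow> real) set set" where
  "universally_measurable =
     {A. A \<subseteq> Omega \<and> (\<forall>P. prob_space P \<and> sets P = sets Omega_borel \<longrightarrow> A \<in> sets (completion P))}"

text \<open>In measures built by \<^const>\<open>sigma\<close> and used as a measurable space, only
  \<^const>\<open>space\<close> and \<^const>\<open>sets\<close> matter.\<close>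

definition Omega_um :: "(nat \<Rightarrow> real) measure" where
  "Omega_um = sigma Omega universally_measurable"

definition Omega_probs :: "(nat \<Rightarrow> real) measure set" where
  "Omega_probs = {P. prob_space P \<and> sets P = sets Omega_um}"

lemma space_Omega_borel: "space Omega_borel = Omega"
  by (simp add: Omega_borel_def space_restrict_space)

lemma sigma_algebra_universally_measurable: "sigma_algebra Omega universally_measurable"
proof -
  have sp: "space P = Omega" if "sets P = sets Omega_borel" for P
    using sets_eq_imp_space_eq[OF that] by (simp add: space_Omega_borel)
  show ?thesis
    unfolding sigma_algebra_iff2
  proof (intro conjI ballI allI impI)
    show "universally_measurable \<subseteq> Pow Omega"
      by (auto simp: universally_measurable_def)
    show "{} \<in> universally_measurable"
      by (auto simp: universally_measurable_def)
  next
    fix A assume A: "A \<in> universally_measurable"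
    have "Omega - A \<in> sets (completion P)" if "prob_space P" "sets P = sets Omega_borel" for P
    proof -
      have "A \<in> sets (completion P)" using A that by (auto simp: universally_measurable_def)
      then have "space (completion P) - A \<in> sets (completion P)" by (rule sets.compl_sets)
      then show ?thesis using sp[OF that(2)] by simp
    qed
    then show "Omega - A \<in> universally_measurable"
      by (auto simp: universally_measurable_def)
  next
    fix A :: "nat \<Rightarrow> (nat \<Rightarrow> real) set"
    assume A: "range A \<subseteq> universally_measurable"
    have "(\<Union>i. A i) \<in> sets (completion P)" if "prob_space P" "sets P = sets Omega_borel" for P
      using A that by (intro sets.countable_UN) (auto simp: universally_measurable_def image_subset_iff)
    moreover have "(\<Union>i. A i) \<subseteq> Omega"
      using A by (auto simp: universally_measurable_def image_subset_iff)
    ultimately show "(\<Union>i. A i) \<in> universally_measurable"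
      by (auto simp: universally_measurable_def)
  qed
qed

lemma space_Omega_um [simp]: "space Omega_um = Omega"
  using sigma_algebra_universally_measurable
  by (simp add: Omega_um_def sigma_algebra.space_measure_of_eq)

lemma sets_Omega_um: "sets Omega_um = universally_measurable"
  using sigma_algebra_universally_measurable
  by (simp add: Omega_um_def sigma_algebra.sets_measure_of_eq)

section \<open>Quasi-universal spaces\<close>

record 'x qus =
  points :: "'x set"
  rvs :: "((nat \<Rightarrow> real) \<Rightarrow> 'x) set"

definition Omega_maps :: "((nat \<Rightarrow> real) \<Rightarrow> (nat \<Rightarrow> real)) set" where
  "Omega_maps = measurable Omega_um Omega_um \<inter> extensional Omega"

definition quasi_universal :: "'x qus \<Rightarrow> bool" where
  "quasi_universal X \<longleftrightarrow>
     rvs X \<subseteq> Omega \<rightarrow>\<^sub>E points X \<and>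
     (\<forall>x\<in>points X. (\<lambda>\<omega>\<in>Omega. x) \<in> rvs X) \<and>
     (\<forall>f\<in>rvs X. \<forall>\<Phi>\<in>Omega_maps. compose Omega f \<Phi> \<in> rvs X)"

definition quasi_measurable :: "'x qus \<Rightarrow> 'y qus \<Rightarrow> ('x \<Rightarrow> 'y) set" where
  "quasi_measurable X Y =
     {g \<in> points X \<rightarrow>\<^sub>E points Y. \<forall>f\<in>rvs X. compose Omega g f \<in> rvs Y}"

definition Omega_qus :: "(nat \<Rightarrow> real) qus" where
  "Omega_qus = \<lparr>points = Omega, rvs = Omega_maps\<rparr>"

definition pair_qus :: "'x qus \<Rightarrow> 'y qus \<Rightarrow> ('x \<times> 'y) qus" where
  "pair_qus X Y =
     \<lparr>points = points X \<times> points Y,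
      rvs = {\<lambda>\<omega>\<in>Omega. (f \<omega>, g \<omega>) | f g. f \<in> rvs X \<and> g \<in> rvs Y}\<rparr>"

definition product_qus :: "'i set \<Rightarrow> ('i \<Rightarrow> 'x qus) \<Rightarrow> ('i \<Rightarrow> 'x) qus" where
  "product_qus I X =
     \<lparr>points = (\<Pi>\<^sub>E i\<in>I. points (X i)),
      rvs = {f \<in> Omega \<rightarrow>\<^sub>E (\<Pi>\<^sub>E i\<in>I. points (X i)). \<forall>i\<in>I. (\<lambda>\<omega>\<in>Omega. f \<omega> i) \<in> rvs (X i)}\<rparr>"

definition induced_sets :: "'x qus \<Rightarrow> 'x set set" where
  "induced_sets X = {A. A \<subseteq> points X \<and> (\<forall>f\<in>rvs X. f -` A \<inter> Omega \<in> universally_measurable)}"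

definition induced_space :: "'x qus \<Rightarrow> 'x measure" where
  "induced_space X = sigma (points X) (induced_sets X)"

definition standard :: "'x qus \<Rightarrow> bool" where
  "standard X \<longleftrightarrow>
     points X = {} \<or>
     (\<exists>i\<in>quasi_measurable X Omega_qus. \<exists>r\<in>quasi_measurable Omega_qus X. \<forall>x\<in>points X. r (i x) = x)"

lemma sigma_algebra_induced_sets:
  assumes "quasi_universal X"
  shows "sigma_algebra (points X) (induced_sets X)"
proof -
  interpret U: sigma_algebra Omega universally_measurable
    by (rule sigma_algebra_universally_measurable)
  show ?thesis
    unfolding sigma_algebra_iff2
  proof (intro conjI ballI allI impI)
    show "induced_sets X \<subseteq> Pow (points X)"
      by (auto simp: induced_sets_def)
    show "{} \<in> induced_sets X"
      by (auto simp: induced_sets_def)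
  next
    fix A assume A: "A \<in> induced_sets X"
    have "f -` (points X - A) \<inter> Omega \<in> universally_measurable" if f: "f \<in> rvs X" for f
    proof -
      have "f -` (points X - A) \<inter> Omega = Omega - (f -` A \<inter> Omega)"
        using f assms unfolding quasi_universal_def by (blast dest: PiE_mem)
      then show ?thesis using A f by (auto simp: induced_sets_def)
    qed
    then show "points X - A \<in> induced_sets X"
      by (auto simp: induced_sets_def)
  next
    fix A :: "nat \<Rightarrow> _"
    assume A: "range A \<subseteq> induced_sets X"
    have "f -` (\<Union>i. A i) \<inter> Omega \<in> universally_measurable" if f: "f \<in> rvs X" for f
    proof -
      have "(\<Union>i. f -` A i \<inter> Omega) \<in> universally_measurable"
        using A f by (intro U.countable_UN) (auto simp: induced_sets_def image_subset_iff)
      moreover have "f -` (\<Union>i. A i) \<inter> Omega = (\<Union>i. f -` A i \<inter> Omega)" by auto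
      ultimately show ?thesis by simp
    qed
    moreover have "(\<Union>i. A i) \<subseteq> points X"
      using A by (auto simp: induced_sets_def image_subset_iff)
    ultimately show "(\<Union>i. A i) \<in> induced_sets X"
      by (auto simp: induced_sets_def)
  qed
qed

lemma
  assumes "quasi_universal X"
  shows space_induced_space: "space (induced_space X) = points X"
    and sets_induced_space: "sets (induced_space X) = induced_sets X"
  using sigma_algebra_induced_sets[OF assms]
  by (simp_all add: induced_space_def sigma_algebra.space_measure_of_eq
      sigma_algebra.sets_measure_of_eq)

lemma restrict_measurable_Omega_um:
  "(\<lambda>\<omega>\<in>Omega. f \<omega>) \<in> measurable Omega_um M \<longleftrightarrow> f \<in> measurable Omega_um M"
  by (rule measurable_cong) simp

lemma Omega_maps_compose:
  "f \<in> Omega_maps \<Longrightarrow> g \<in> Omega_maps \<Longrightarrow> compose Omega f g \<in> Omega_maps"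
  unfolding Omega_maps_def compose_def by (auto simp: restrict_measurable_Omega_um simp del: restrict_apply)

lemma Omega_maps_funcset: "f \<in> Omega_maps \<Longrightarrow> f \<in> Omega \<rightarrow>\<^sub>E Omega"
  using measurable_space[of f Omega_um Omega_um]
  by (auto simp: Omega_maps_def PiE_def)

lemma quasi_universal_Omega: "quasi_universal Omega_qus"
proof -
  have "(\<lambda>\<omega>\<in>Omega. x) \<in> Omega_maps" if "x \<in> Omega" for x
    unfolding Omega_maps_def using that by (simp add: restrict_measurable_Omega_um)
  then show ?thesis
    using Omega_maps_compose Omega_maps_funcset
    by (simp add: quasi_universal_def Omega_qus_def subset_iff)
qed

lemma quasi_universal_product:
  assumes "\<And>i. i \<in> I \<Longrightarrow> quasi_universal (X i)"
  shows "quasi_universal (product_qus I X)"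
  unfolding quasi_universal_def
proof (intro conjI ballI)
  show "rvs (product_qus I X) \<subseteq> Omega \<rightarrow>\<^sub>E points (product_qus I X)"
    by (auto simp: product_qus_def)
next
  fix x assume x: "x \<in> points (product_qus I X)"
  have "(\<lambda>\<omega>\<in>Omega. (\<lambda>\<omega>\<in>Omega. x) \<omega> i) \<in> rvs (X i)" if i: "i \<in> I" for i
  proof -
    have "(\<lambda>\<omega>\<in>Omega. (\<lambda>\<omega>\<in>Omega. x) \<omega> i) = (\<lambda>\<omega>\<in>Omega. x i)" by auto
    moreover have "x i \<in> points (X i)" using x i by (auto simp: product_qus_def)
    ultimately show ?thesis using assms[OF i] by (simp add: quasi_universal_def)
  qed
  then show "(\<lambda>\<omega>\<in>Omega. x) \<in> rvs (product_qus I X)"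
    using x by (auto simp: product_qus_def)
next
  fix f \<Phi> assume f: "f \<in> rvs (product_qus I X)" and \<Phi>: "\<Phi> \<in> Omega_maps"
  have \<Phi>O: "\<Phi> \<omega> \<in> Omega" if "\<omega> \<in> Omega" for \<omega>
    using Omega_maps_funcset[OF \<Phi>] that by auto
  have "(\<lambda>\<omega>\<in>Omega. compose Omega f \<Phi> \<omega> i) \<in> rvs (X i)" if i: "i \<in> I" for i
  proof -
    have "(\<lambda>\<omega>\<in>Omega. compose Omega f \<Phi> \<omega> i) = compose Omega (\<lambda>\<omega>\<in>Omega. f \<omega> i) \<Phi>"
      using \<Phi>O by (auto simp: compose_def)
    then show ?thesis using assms[OF i] f i \<Phi> by (auto simp: quasi_universal_def product_qus_def)
  qed
  moreover have "compose Omega f \<Phi> \<in> Omega \<rightarrow>\<^sub>E (\<Pi>\<^sub>E i\<in>I. points (X i))"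
  proof (rule PiE_I)
    fix \<omega> assume w: "\<omega> \<in> Omega"
    have "f (\<Phi> \<omega>) \<in> (\<Pi>\<^sub>E i\<in>I. points (X i))"
      using f \<Phi>O[OF w] PiE_mem unfolding product_qus_def by fastforce
    then show "compose Omega f \<Phi> \<omega> \<in> (\<Pi>\<^sub>E i\<in>I. points (X i))"
      using w by (simp add: compose_def)
  qed (simp add: compose_def)
  ultimately show "compose Omega f \<Phi> \<in> rvs (product_qus I X)"
    by (simp add: product_qus_def)
qed

section \<open>Probability measures and Markov kernels\<close>

definition double_rvs :: "'x qus \<Rightarrow> ((nat \<Rightarrow> real) \<Rightarrow> (nat \<Rightarrow> real) \<Rightarrow> 'x) set" where
  "double_rvs X =
     {f \<in> Omega \<rightarrow>\<^sub>E rvs X.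
        (\<lambda>(\<omega>, \<omega>')\<in>Omega \<times> Omega. f \<omega> \<omega>') \<in> quasi_measurable (pair_qus Omega_qus Omega_qus) X}"

definition prob_qus :: "'x qus \<Rightarrow> 'x measure qus" where
  "prob_qus X =
     \<lparr>points = {distr P (induced_space X) f | P f. P \<in> Omega_probs \<and> f \<in> rvs X},
      rvs = {\<lambda>\<omega>\<in>Omega. distr P (induced_space X) (f \<omega>) | P f. P \<in> Omega_probs \<and> f \<in> double_rvs X}\<rparr>"

lemma quasi_universal_prob:
  assumes X: "quasi_universal X"
  shows "quasi_universal (prob_qus X)"
  unfolding quasi_universal_def
proof (intro conjI ballI subsetI)
  fix g assume "g \<in> rvs (prob_qus X)"
  then show "g \<in> Omega \<rightarrow>\<^sub>E points (prob_qus X)"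
    by (fastforce simp: prob_qus_def double_rvs_def)
next
  fix \<mu> assume "\<mu> \<in> points (prob_qus X)"
  then obtain P f where P: "P \<in> Omega_probs" and f: "f \<in> rvs X"
    and mu: "\<mu> = distr P (induced_space X) f"
    by (auto simp: prob_qus_def)
  have fX: "f \<in> Omega \<rightarrow>\<^sub>E points X" using X f by (auto simp: quasi_universal_def)
  let ?F = "\<lambda>\<omega>\<in>Omega. f"
  have "compose Omega (\<lambda>(\<omega>, \<omega>')\<in>Omega \<times> Omega. ?F \<omega> \<omega>') (\<lambda>\<omega>\<in>Omega. (a \<omega>, b \<omega>)) \<in> rvs X"
    if "a \<in> Omega_maps" "b \<in> Omega_maps" for a b
  proof -
    have "compose Omega (\<lambda>(\<omega>, \<omega>')\<in>Omega \<times> Omega. ?F \<omega> \<omega>') (\<lambda>\<omega>\<in>Omega. (a \<omega>, b \<omega>))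
      = compose Omega f b"
      using Omega_maps_funcset[OF that(1)] Omega_maps_funcset[OF that(2)]
      by (auto simp: compose_def fun_eq_iff dest: PiE_mem)
    then show ?thesis using X f that by (auto simp: quasi_universal_def)
  qed
  then have "?F \<in> double_rvs X"
    using f PiE_mem[OF fX]
    by (auto simp: double_rvs_def quasi_measurable_def pair_qus_def Omega_qus_def simp del: restrict_apply)
      (auto split: if_splits)
  moreover have "(\<lambda>\<omega>\<in>Omega. \<mu>) = (\<lambda>\<omega>\<in>Omega. distr P (induced_space X) (?F \<omega>))"
    by (auto simp: mu)
  ultimately show "(\<lambda>\<omega>\<in>Omega. \<mu>) \<in> rvs (prob_qus X)"
    using P unfolding prob_qus_def qus.simps mem_Collect_eq by blast
next
  fix g \<Phi> assume "g \<in> rvs (prob_qus X)" and \<Phi>: "\<Phi> \<in> Omega_maps"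
  then obtain P f where P: "P \<in> Omega_probs" and f: "f \<in> double_rvs X"
    and g: "g = (\<lambda>\<omega>\<in>Omega. distr P (induced_space X) (f \<omega>))"
    by (auto simp: prob_qus_def)
  have \<Phi>O: "\<Phi> \<omega> \<in> Omega" if "\<omega> \<in> Omega" for \<omega>
    using Omega_maps_funcset[OF \<Phi>] that by auto
  have fO: "f \<omega> \<in> rvs X" if "\<omega> \<in> Omega" for \<omega>
    using f that by (auto simp: double_rvs_def)
  have fX: "f \<omega> \<omega>' \<in> points X" if "\<omega> \<in> Omega" "\<omega>' \<in> Omega" for \<omega> \<omega>'
    using X fO[OF that(1)] that(2) by (auto simp: quasi_universal_def)
  let ?F = "compose Omega f \<Phi>"
  have "compose Omega (\<lambda>(\<omega>, \<omega>')\<in>Omega \<times> Omega. ?F \<omega> \<omega>') (\<lambda>\<omega>\<in>Omega. (a \<omega>, b \<omega>)) \<in> rvs X"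
    if a: "a \<in> Omega_maps" and b: "b \<in> Omega_maps" for a b
  proof -
    have "compose Omega (\<lambda>(\<omega>, \<omega>')\<in>Omega \<times> Omega. ?F \<omega> \<omega>') (\<lambda>\<omega>\<in>Omega. (a \<omega>, b \<omega>))
      = compose Omega (\<lambda>(\<omega>, \<omega>')\<in>Omega \<times> Omega. f \<omega> \<omega>')
          (\<lambda>\<omega>\<in>Omega. (compose Omega \<Phi> a \<omega>, b \<omega>))"
      using Omega_maps_funcset[OF a] Omega_maps_funcset[OF b] \<Phi>O
      by (auto simp: compose_def fun_eq_iff dest: PiE_mem)
    moreover have "(\<lambda>\<omega>\<in>Omega. (compose Omega \<Phi> a \<omega>, b \<omega>)) \<in> rvs (pair_qus Omega_qus Omega_qus)"
      using Omega_maps_compose[OF \<Phi> a] b unfolding pair_qus_def Omega_qus_def qus.simps by blast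
    moreover have "\<forall>h\<in>rvs (pair_qus Omega_qus Omega_qus).
        compose Omega (\<lambda>(\<omega>, \<omega>')\<in>Omega \<times> Omega. f \<omega> \<omega>') h \<in> rvs X"
      using f unfolding double_rvs_def quasi_measurable_def by blast
    ultimately show ?thesis by (simp only:)
  qed
  moreover have "?F \<in> Omega \<rightarrow>\<^sub>E rvs X"
    using fO \<Phi>O by (auto simp: compose_def)
  moreover have "?F \<omega> \<omega>' \<in> points X" if "\<omega> \<in> Omega" "\<omega>' \<in> Omega" for \<omega> \<omega>'
    using fX \<Phi>O that by (simp add: compose_def)
  ultimately have "?F \<in> double_rvs X"
    by (auto simp: double_rvs_def quasi_measurable_def pair_qus_def Omega_qus_def simp del: restrict_apply)
  moreover have "compose Omega g \<Phi> = (\<lambda>\<omega>\<in>Omega. distr P (induced_space X) (?F \<omega>))"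
    using \<Phi>O by (auto simp: g compose_def)
  ultimately show "compose Omega g \<Phi> \<in> rvs (prob_qus X)"
    unfolding prob_qus_def qus.simps mem_Collect_eq using P
    by (intro exI[of _ P] exI[of _ ?F] conjI)
qed

definition markov_kernels :: "'z qus \<Rightarrow> 'x qus \<Rightarrow> ('z \<Rightarrow> 'x measure) set" where
  "markov_kernels Z X = quasi_measurable Z (prob_qus X)"

definition kernel_comp ::
    "'z qus \<Rightarrow> 'x qus \<Rightarrow> ('s \<Rightarrow> 'x measure) \<Rightarrow> ('z \<Rightarrow> 's measure) \<Rightarrow> 'z \<Rightarrow> 'x measure" where
  "kernel_comp Z X K P =
     (\<lambda>z\<in>points Z. measure_of (points X) (induced_sets X) (\<lambda>A. \<integral>\<^sup>+ s. emeasure (K s) A \<partial>P z))"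

text \<open>The \<open>n\<close>-fold product of a probability measure lives on the induced \<open>\<sigma>\<close>-algebra of the
  product space, which in general is larger than the product \<open>\<sigma>\<close>-algebra of \<^const>\<open>PiM\<close>; it is
  therefore given by iterated integration.\<close>

primrec power_measure :: "'x qus \<Rightarrow> 'x measure \<Rightarrow> nat \<Rightarrow> (nat \<Rightarrow> 'x) measure" where
  "power_measure X \<mu> 0 = return (induced_space (product_qus {..<0} (\<lambda>_. X))) (\<lambda>_. undefined)"
| "power_measure X \<mu> (Suc n) =
     measure_of (points (product_qus {..<Suc n} (\<lambda>_. X))) (induced_sets (product_qus {..<Suc n} (\<lambda>_. X)))
       (\<lambda>A. \<integral>\<^sup>+ x. (\<integral>\<^sup>+ y. indicator A (x(n := y)) \<partial>\<mu>) \<partial>power_measure X \<mu> n)"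

abbreviation seq_qus :: "'x qus \<Rightarrow> (nat \<Rightarrow> 'x) qus" where
  "seq_qus X \<equiv> product_qus UNIV (\<lambda>_. X)"

definition iid_kernel :: "'s qus \<Rightarrow> 'x qus \<Rightarrow> ('s \<Rightarrow> 'x measure) \<Rightarrow> 's \<Rightarrow> (nat \<Rightarrow> 'x) measure" where
  "iid_kernel S X K =
     (THE L. L \<in> markov_kernels S (seq_qus X) \<and>
        (\<forall>n. \<forall>s\<in>points S.
           distr (L s) (induced_space (product_qus {..<Suc n} (\<lambda>_. X))) (\<lambda>x. restrict x {..<Suc n})
             = power_measure X (K s) (Suc n)))"

definition exchangeable :: "'z qus \<Rightarrow> 'x qus \<Rightarrow> ('z \<Rightarrow> (nat \<Rightarrow> 'x) measure) \<Rightarrow> bool" where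
  "exchangeable Z X Q \<longleftrightarrow>
     (\<forall>\<sigma>. bij \<sigma> \<and> finite {n. \<sigma> n \<noteq> n} \<longrightarrow>
        (\<forall>z\<in>points Z. distr (Q z) (induced_space (seq_qus X)) (\<lambda>x n. x (\<sigma> n)) = Q z))"

end

theory Submission
  imports Defs
begin

text \<open>A law on \<open>Omega_um\<close> is determined by its Borel part, and \<open>Omega\<close> embeds into the unit interval
  with a Borel left inverse. Hence a nonempty standard \<open>X\<close> is a retract of \<open>[0,1]\<close> via some \<open>j\<close> and
  \<open>\<rho>\<close>, every kernel into \<open>X\<close> is \<open>\<rho>\<close> of a jointly measurable quantile function applied to uniform
  noise, and its i.i.d. kernel uses the same quantile function on i.i.d. uniform noise.
  Exchangeability of mixtures is then invariance of the noise under permutations. Conversely, for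
  an exchangeable kernel the limiting empirical distribution functions of \<open>(j x\<^sub>n)\<^sub>n\<close> define a
  quasi-measurable map from sequences to laws on \<open>X\<close> that does not depend on the parameter \<open>z\<close>, and
  the push-forward of \<open>Q z\<close> along it is the mixing law. Universally measurable sets that are
  not Borel are handled by comparing Borel parts of the laws of \<open>[0,1]\<close>-valued sequences.\<close>

section \<open>The universal completion of the sample space\<close>

text \<open>Two features of the definitions shape the argument. An admissible random variable of
  \<open>prob_qus\<close> uses one probability measure for all \<open>\<omega>\<close>, so a kernel
  has to be brought into the form of a fixed noise with a varying function. Quantiles achieve this,
  and they need the linear order of \<open>[0,1]\<close>; hence \<open>X\<close> is retracted there
  and not merely to \<open>Omega\<close>. Moreover the induced sigma-algebra of a sequence space can
  be larger than the product one, so a generator argument on cylinders need not reach all of its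
  sets. Laws with different presentations are therefore typically compared upstream: both become
  push-forwards, along one common admissible map, of laws on \<open>Omega\<close>, where cylinders
  do determine everything. Conditional distributions given the tail would be chosen separately for
  each \<open>z\<close>, without control of how the choice depends on \<open>z\<close>. An explicit
  limit of empirical distribution functions, defined for every sequence, avoids that choice.\<close>

lemma Omega_eq: "Omega = UNIV \<rightarrow> {0..1}"
  by (auto simp: Omega_def)

lemma Omega_nonempty: "(\<lambda>_. 0) \<in> Omega"
  by (auto simp: Omega_def)

lemma sets_Omega_borel_subset: "sets Omega_borel \<subseteq> sets Omega_um"
proof
  fix A assume A: "A \<in> sets Omega_borel"
  then have "A \<subseteq> Omega"
    using sets.sets_into_space space_Omega_borel by blast
  with A show "A \<in> sets Omega_um"
    unfolding sets_Omega_um universally_measurable_def by auto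
qed

lemma measurable_Omega_borelI:
  assumes "\<And>k. (\<lambda>x. f x k) \<in> borel_measurable M" "f \<in> space M \<rightarrow> Omega"
  shows "f \<in> M \<rightarrow>\<^sub>M Omega_borel"
  unfolding Omega_borel_def
  by (rule measurable_restrict_space2[OF assms(2)], rule measurable_coordinatewise_then_product)
    (rule assms(1))

lemma measurable_Omega_borel_component: "(\<lambda>\<omega>. \<omega> k) \<in> borel_measurable Omega_borel"
  unfolding Omega_borel_def
  by (rule measurable_restrict_space1) (rule borel_measurable_continuous_onI, simp)

lemma measurable_ident_um_borel: "(\<lambda>\<omega>. \<omega>) \<in> Omega_um \<rightarrow>\<^sub>M Omega_borel"
proof (rule measurableI)
  fix A assume A: "A \<in> sets Omega_borel"
  then have "A \<subseteq> Omega" using sets.sets_into_space space_Omega_borel by blast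
  then show "(\<lambda>\<omega>. \<omega>) -` A \<inter> space Omega_um \<in> sets Omega_um"
    using A sets_Omega_borel_subset by (auto simp: Int_absorb2)
qed (simp add: space_Omega_borel)

lemma measurable_borel_imp_um: "f \<in> Omega_borel \<rightarrow>\<^sub>M N \<Longrightarrow> f \<in> Omega_um \<rightarrow>\<^sub>M N"
  using measurable_compose[OF measurable_ident_um_borel] .

lemma measurable_Omega_um_component: "(\<lambda>\<omega>. \<omega> k) \<in> borel_measurable Omega_um"
  by (rule measurable_borel_imp_um[OF measurable_Omega_borel_component])

section \<open>Borel laws and their extension to universally measurable sets\<close>

definition borel_probs :: "(nat \<Rightarrow> real) measure set" where
  "borel_probs = {P. prob_space P \<and> sets P = sets Omega_borel}"

lemma borel_probsD:
  assumes "P \<in> borel_probs"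
  shows "prob_space P" "sets P = sets Omega_borel" "space P = Omega"
  using assms sets_eq_imp_space_eq[of P Omega_borel]
  by (auto simp: borel_probs_def space_Omega_borel)

lemma Omega_probsD:
  assumes "P \<in> Omega_probs"
  shows "prob_space P" "sets P = sets Omega_um" "space P = Omega"
  using assms sets_eq_imp_space_eq[of P Omega_um]
  by (auto simp: Omega_probs_def)

lemma measurable_completion_um:
  assumes "P \<in> borel_probs" shows "(\<lambda>\<omega>. \<omega>) \<in> completion P \<rightarrow>\<^sub>M Omega_um"
proof (rule measurableI)
  fix A assume A: "A \<in> sets Omega_um"
  then have "A \<subseteq> Omega" using sets.sets_into_space by force
  then have "(\<lambda>\<omega>. \<omega>) -` A \<inter> space (completion P) = A"
    using borel_probsD(3)[OF assms] by auto
  then show "(\<lambda>\<omega>. \<omega>) -` A \<inter> space (completion P) \<in> sets (completion P)"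
    using A assms by (auto simp: sets_Omega_um universally_measurable_def borel_probs_def)
qed (use borel_probsD[OF assms] in auto)

text \<open>A set is universally measurable when the completion of each Borel law contains it, so
  measurability is tested one law at a time; auxiliary Borel data may then depend on the
  law.\<close>

lemma measurable_umI:
  assumes "\<And>P. P \<in> borel_probs \<Longrightarrow> f \<in> completion P \<rightarrow>\<^sub>M N" "f \<in> Omega \<rightarrow> space N"
  shows "f \<in> Omega_um \<rightarrow>\<^sub>M N"
proof (rule measurableI)
  fix A assume "A \<in> sets N"
  then have "f -` A \<inter> Omega \<in> sets (completion P)" if "P \<in> borel_probs" for P
    using measurable_sets[OF assms(1)[OF that]] borel_probsD(3)[OF that] by simp
  then show "f -` A \<inter> space Omega_um \<in> sets Omega_um"
    by (auto simp: sets_Omega_um universally_measurable_def borel_probs_def)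
qed (use assms(2) in auto)

text \<open>Every universally measurable set lies in the completion, so restricting the completed
  measure to these sets extends a Borel law. \<open>um_ext\<close> and \<open>borel_part\<close>
  turn out to be mutually inverse between \<open>borel_probs\<close> and \<open>Omega_probs\<close>,
  which moves questions about laws to Borel sets.\<close>

definition um_ext :: "(nat \<Rightarrow> real) measure \<Rightarrow> (nat \<Rightarrow> real) measure" where
  "um_ext P = distr (completion P) Omega_um (\<lambda>\<omega>. \<omega>)"

lemma prob_space_completion: "prob_space P \<Longrightarrow> prob_space (completion P)"
  by (rule prob_spaceI) (simp add: prob_space.emeasure_space_1)

lemma um_ext_in: assumes "P \<in> borel_probs" shows "um_ext P \<in> Omega_probs"
  unfolding Omega_probs_def um_ext_def
  using prob_space.prob_space_distr[OF prob_space_completion measurable_completion_um]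
    assms borel_probsD[OF assms] by auto

lemma emeasure_um_ext:
  assumes "P \<in> borel_probs" "A \<in> sets Omega_um"
  shows "emeasure (um_ext P) A = emeasure (completion P) A"
proof -
  have "A \<subseteq> Omega" using sets.sets_into_space assms(2) by force
  then show ?thesis
    unfolding um_ext_def using emeasure_distr[OF measurable_completion_um[OF assms(1)] assms(2)]
      borel_probsD(3)[OF assms(1)] by (simp add: Int_absorb2)
qed

definition borel_part :: "(nat \<Rightarrow> real) measure \<Rightarrow> (nat \<Rightarrow> real) measure" where
  "borel_part P = distr P Omega_borel (\<lambda>\<omega>. \<omega>)"

lemma measurable_Omega_probs: "P \<in> Omega_probs \<Longrightarrow> measurable P N = measurable Omega_um N"
  by (rule measurable_cong_sets) (auto dest: Omega_probsD)

lemma measurable_borel_probs: "P \<in> borel_probs \<Longrightarrow> measurable P N = measurable Omega_borel N"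
  by (rule measurable_cong_sets) (auto dest: borel_probsD)

lemma distr_um_borel_in:
  assumes "P \<in> Omega_probs" "f \<in> Omega_um \<rightarrow>\<^sub>M Omega_borel" shows "distr P Omega_borel f \<in> borel_probs"
  using assms prob_space.prob_space_distr[OF Omega_probsD(1)]
  by (auto simp: borel_probs_def measurable_Omega_probs)

lemma distr_um_um_in:
  assumes "P \<in> Omega_probs" "f \<in> Omega_um \<rightarrow>\<^sub>M Omega_um" shows "distr P Omega_um f \<in> Omega_probs"
  using assms prob_space.prob_space_distr[OF Omega_probsD(1)]
  by (auto simp: Omega_probs_def measurable_Omega_probs)

lemma borel_part_in: "P \<in> Omega_probs \<Longrightarrow> borel_part P \<in> borel_probs"
  unfolding borel_part_def using measurable_ident_um_borel by (rule distr_um_borel_in[rotated])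

text \<open>Uniqueness of the extension. Covering \<open>A\<close> by a Borel set of the same
  completed measure only bounds \<open>P A\<close> from above; the same bound for the complement,
  together with total mass one on both sides, forces equality.\<close>

lemma um_ext_borel_part:
  assumes "P \<in> Omega_probs" shows "um_ext (borel_part P) = P"
proof (rule measure_eqI)
  let ?B = "borel_part P"
  have B: "?B \<in> borel_probs" by (rule borel_part_in[OF assms])
  have id: "(\<lambda>\<omega>. \<omega>) \<in> P \<rightarrow>\<^sub>M Omega_borel"
    using measurable_ident_um_borel assms by (simp add: measurable_Omega_probs)
  have eqB: "emeasure ?B C = emeasure P C" if "C \<in> sets Omega_borel" for C
  proof -
    have "C \<subseteq> Omega" using sets.sets_into_space[OF that] by (simp add: space_Omega_borel)
    then show ?thesis unfolding borel_part_def using emeasure_distr[OF id that] Omega_probsD(3)[OF assms]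
      by (simp add: Int_absorb2)
  qed
  show "sets (um_ext ?B) = sets P" using Omega_probsD(2)[OF assms] by (simp add: um_ext_def)
  fix A assume "A \<in> sets (um_ext ?B)"
  then have A: "A \<in> sets Omega_um" by (simp add: um_ext_def)
  then have Ac: "A \<in> sets (completion ?B)"
    using B unfolding sets_Omega_um universally_measurable_def borel_probs_def by blast
  have 1: "emeasure P A \<le> emeasure (completion ?B) A"
    if A: "A \<in> sets Omega_um" for A
  proof -
    have Ac: "A \<in> sets (completion ?B)"
      using A B unfolding sets_Omega_um universally_measurable_def borel_probs_def by blast
    from completion_upper[OF Ac] obtain A' where A': "A' \<in> sets ?B" "A \<subseteq> A'"
      "emeasure (completion ?B) A = emeasure ?B A'" by auto
    have A'': "A' \<in> sets Omega_borel" using A'(1) B by (auto dest: borel_probsD)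
    then have "A' \<in> sets P" using sets_Omega_borel_subset Omega_probsD(2)[OF assms] by auto
    then have "emeasure P A \<le> emeasure P A'" by (intro emeasure_mono A')
    then show ?thesis using eqB[OF A''] A'(3) by simp
  qed
  interpret P: prob_space P by (rule Omega_probsD(1)[OF assms])
  interpret C: prob_space "completion ?B" by (intro prob_space_completion borel_probsD(1) B)
  have AP: "A \<in> sets P" using A Omega_probsD(2)[OF assms] by simp
  have "Omega - A \<in> sets Omega_um" using A sets.compl_sets[OF A] by simp
  from 1[OF this] have 2: "emeasure P (Omega - A) \<le> emeasure (completion ?B) (Omega - A)" .
  have "measure P (Omega - A) = 1 - measure P A"
    using P.prob_compl[OF AP] Omega_probsD(3)[OF assms] by simp
  moreover have "measure (completion ?B) (Omega - A) = 1 - measure (completion ?B) A"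
    using C.prob_compl[OF Ac] borel_probsD(3)[OF B] by simp
  moreover have "measure P (Omega - A) \<le> measure (completion ?B) (Omega - A)"
    using 2 by (simp only: P.emeasure_eq_measure C.emeasure_eq_measure) simp
  moreover have "measure P A \<le> measure (completion ?B) A"
    using 1[OF A] by (simp only: P.emeasure_eq_measure C.emeasure_eq_measure) simp
  ultimately have "measure (completion ?B) A = measure P A" by simp
  then show "emeasure (um_ext ?B) A = emeasure P A"
    unfolding emeasure_um_ext[OF B A] P.emeasure_eq_measure C.emeasure_eq_measure by simp
qed

lemma borel_part_um_ext:
  assumes "P \<in> borel_probs" shows "borel_part (um_ext P) = P"
proof -
  have "borel_part (um_ext P) = distr (completion P) Omega_borel (\<lambda>\<omega>. \<omega>)"
    unfolding borel_part_def um_ext_def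
    by (subst distr_distr) (use measurable_completion_um[OF assms] measurable_ident_um_borel in \<open>auto simp: comp_def\<close>)
  also have "\<dots> = P"
    using assms by (subst distr_completion) (auto dest: borel_probsD intro!: distr_id2 simp: measurable_borel_probs)
  finally show ?thesis .
qed

text \<open>For a Borel law \<open>P\<close> on the source, \<open>f\<close> pushes the completion
  of \<open>P\<close> to a Borel law \<open>?N\<close>. A universally measurable set is measurable
  for the completion of \<open>?N\<close>, and \<open>f\<close> pulls null sets of \<open>?N\<close>
  back to null sets. Hence maps in \<open>Omega_maps\<close> can be recognised by their real
  coordinates.\<close>

lemma measurable_um_um:
  assumes "f \<in> Omega_um \<rightarrow>\<^sub>M Omega_borel" shows "f \<in> Omega_um \<rightarrow>\<^sub>M Omega_um"
proof (rule measurable_umI)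
  fix P assume P: "P \<in> borel_probs"
  have f: "f \<in> completion P \<rightarrow>\<^sub>M Omega_borel"
    using measurable_compose[OF measurable_completion_um[OF P] assms] .
  let ?N = "distr (completion P) Omega_borel f"
  have N: "?N \<in> borel_probs"
    using prob_space.prob_space_distr[OF prob_space_completion[OF borel_probsD(1)[OF P]] f]
    by (simp add: borel_probs_def)
  have "f \<in> completion P \<rightarrow>\<^sub>M ?N" using f by simp
  then have "f \<in> completion P \<rightarrow>\<^sub>M completion ?N"
    by (rule completion.measurable_completion2)
      (metis distr_cong sets_distr order_refl)
  from measurable_compose[OF this measurable_completion_um[OF N]]
  show "f \<in> completion P \<rightarrow>\<^sub>M Omega_um" .
qed (use measurable_space[OF assms] in \<open>auto simp: space_Omega_borel\<close>)

lemma measurable_um_iff: "f \<in> Omega_um \<rightarrow>\<^sub>M Omega_um \<longleftrightarrow> f \<in> Omega_um \<rightarrow>\<^sub>M Omega_borel"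
  using measurable_um_um measurable_compose[OF _ measurable_ident_um_borel] by blast

text \<open>Push-forwards to the universal sigma-algebra are recovered by \<open>um_ext\<close> from
  their Borel parts, so agreement on Borel sets suffices.\<close>

lemma distr_um_eqI:
  assumes "P \<in> Omega_probs" "P' \<in> Omega_probs"
    and f: "f \<in> Omega_um \<rightarrow>\<^sub>M Omega_borel" and g: "g \<in> Omega_um \<rightarrow>\<^sub>M Omega_borel"
    and "distr P Omega_borel f = distr P' Omega_borel g"
  shows "distr P Omega_um f = distr P' Omega_um g"
proof -
  have *: "borel_part (distr P Omega_um f) = distr P Omega_borel f"
    if "f \<in> Omega_um \<rightarrow>\<^sub>M Omega_borel" "P \<in> Omega_probs" for f P
    unfolding borel_part_def
    by (subst distr_distr)
      (use measurable_um_um[OF that(1)] that in \<open>auto simp: measurable_Omega_probs comp_def measurable_ident_um_borel\<close>)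
  show ?thesis
    using um_ext_borel_part[OF distr_um_um_in[OF assms(1) measurable_um_um[OF f]]]
      um_ext_borel_part[OF distr_um_um_in[OF assms(2) measurable_um_um[OF g]]]
    by (metis * assms)
qed

section \<open>Sections of universally measurable sets\<close>

lemma measurable_completion_AE:
  assumes g: "g \<in> M \<rightarrow>\<^sub>M N" and f: "f \<in> space M \<rightarrow> space N" and ae: "AE x in M. f x = g x"
  shows "f \<in> completion M \<rightarrow>\<^sub>M N"
proof (rule measurableI)
  fix A assume A: "A \<in> sets N"
  from ae obtain N0 where N0: "{x\<in>space M. f x \<noteq> g x} \<subseteq> N0" "N0 \<in> null_sets M"
    by (auto elim!: AE_E simp: null_sets_def)
  have N0s: "N0 \<in> sets M" using N0 by auto
  have "f -` A \<inter> space M = (g -` A \<inter> space M - N0) \<union> (f -` A \<inter> space M \<inter> N0)"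
    using N0(1) by auto
  moreover have "f -` A \<inter> space M \<inter> N0 \<in> sets (completion M)"
    by (rule null_sets_completion[OF N0(2)]) auto
  moreover have "g -` A \<inter> space M - N0 \<in> sets (completion M)"
    using measurable_sets[OF g A] N0s by auto
  ultimately show "f -` A \<inter> space (completion M) \<in> sets (completion M)"
    by (metis space_completion sets.Un)
qed (use f in auto)

text \<open>Fubini for universally measurable sets: \<open>D\<close> differs from a Borel set by a null set of the
  image measure \<open>distr (R \<Otimes> P) \<Psi>\<close>, and almost every section of that null set is null.\<close>

lemma
  assumes \<Psi>: "case_prod \<Psi> \<in> Omega_borel \<Otimes>\<^sub>M Omega_borel \<rightarrow>\<^sub>M Omega_borel"
    and P: "P \<in> Omega_probs" and D: "D \<in> sets Omega_um"
  shows um_section_measurable: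
      "(\<lambda>\<omega>. emeasure P {\<omega>'\<in>Omega. \<Psi> \<omega> \<omega>' \<in> D}) \<in> borel_measurable Omega_um"
    and um_section_integral: "R \<in> Omega_probs \<Longrightarrow>
      (\<integral>\<^sup>+\<omega>. emeasure P {\<omega>'\<in>Omega. \<Psi> \<omega> \<omega>' \<in> D} \<partial>R)
        = emeasure (um_ext (distr (borel_part R \<Otimes>\<^sub>M borel_part P) Omega_borel (case_prod \<Psi>))) D"
proof -
  let ?m = "\<lambda>\<omega>. emeasure P {\<omega>'\<in>Omega. \<Psi> \<omega> \<omega>' \<in> D}"
  let ?P = "borel_part P"
  have Pb: "?P \<in> borel_probs" by (rule borel_part_in[OF P])
  interpret P: prob_space ?P by (rule borel_probsD(1)[OF Pb])
  \<comment> \<open>One Borel law \<open>R\<close> at a time: the section function has an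
    \<open>R\<close>-almost sure Borel version \<open>m1\<close>, obtained from the sections of the
    Borel main part \<open>?B\<close> of \<open>D\<close>. Both claims are read off from it.\<close>
  have *: "\<exists>m1\<in>borel_measurable R. (AE \<omega> in R. ?m \<omega> = m1 \<omega>) \<and>
      (\<integral>\<^sup>+\<omega>. m1 \<omega> \<partial>R) = emeasure (um_ext (distr (R \<Otimes>\<^sub>M ?P) Omega_borel (case_prod \<Psi>))) D"
    if R: "R \<in> borel_probs" for R
  proof -
    interpret R: prob_space R by (rule borel_probsD(1)[OF R])
    interpret RP: pair_prob_space R ?P ..
    have sRP: "sets (R \<Otimes>\<^sub>M ?P) = sets (Omega_borel \<Otimes>\<^sub>M Omega_borel)"
      by (intro sets_pair_measure_cong borel_probsD R Pb)
    have \<Psi>': "case_prod \<Psi> \<in> R \<Otimes>\<^sub>M ?P \<rightarrow>\<^sub>M Omega_borel"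
      using \<Psi> measurable_cong_sets[OF sRP refl] by blast
    let ?N = "distr (R \<Otimes>\<^sub>M ?P) Omega_borel (case_prod \<Psi>)"
    have N: "?N \<in> borel_probs"
      using RP.prob_space_distr[OF \<Psi>'] by (simp add: borel_probs_def)
    have Dc: "D \<in> sets (completion ?N)"
      using D N by (auto simp: sets_Omega_um universally_measurable_def borel_probs_def)
    let ?B = "main_part ?N D"
    have B: "?B \<in> sets Omega_borel" using main_part_sets[OF Dc] by simp
    obtain N0 where N0: "N0 \<in> null_sets ?N" "null_part ?N D \<subseteq> N0" using null_part[OF Dc] by auto
    have N0s: "N0 \<in> sets Omega_borel" using N0(1) by auto
    define m1 where "m1 \<omega> = emeasure ?P (Pair \<omega> -` (case_prod \<Psi> -` ?B \<inter> space (R \<Otimes>\<^sub>M ?P)))" for \<omega>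
    have Bs: "case_prod \<Psi> -` ?B \<inter> space (R \<Otimes>\<^sub>M ?P) \<in> sets (R \<Otimes>\<^sub>M ?P)"
      by (rule measurable_sets[OF \<Psi>' B])
    have N0s': "case_prod \<Psi> -` N0 \<inter> space (R \<Otimes>\<^sub>M ?P) \<in> sets (R \<Otimes>\<^sub>M ?P)"
      by (rule measurable_sets[OF \<Psi>' N0s])
    have m1: "m1 \<in> borel_measurable R"
      unfolding m1_def by (rule P.measurable_emeasure_Pair[OF Bs])
    have "emeasure (R \<Otimes>\<^sub>M ?P) (case_prod \<Psi> -` N0 \<inter> space (R \<Otimes>\<^sub>M ?P)) = 0"
      using N0(1) emeasure_distr[OF \<Psi>' N0s] by auto
    then have "(\<integral>\<^sup>+\<omega>. emeasure ?P (Pair \<omega> -` (case_prod \<Psi> -` N0 \<inter> space (R \<Otimes>\<^sub>M ?P))) \<partial>R) = 0"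
      by (subst (asm) P.emeasure_pair_measure_alt[OF N0s'])
    then have "AE \<omega> in R. emeasure ?P (Pair \<omega> -` (case_prod \<Psi> -` N0 \<inter> space (R \<Otimes>\<^sub>M ?P))) = 0"
      by (subst (asm) nn_integral_0_iff_AE[OF P.measurable_emeasure_Pair[OF N0s']])
    then have ae: "AE \<omega> in R. ?m \<omega> = m1 \<omega>"
    proof (rule AE_mp, intro AE_I2 impI)
      fix \<omega> assume w: "\<omega> \<in> space R"
        and 0: "emeasure ?P (Pair \<omega> -` (case_prod \<Psi> -` N0 \<inter> space (R \<Otimes>\<^sub>M ?P))) = 0"
      have wO: "\<omega> \<in> Omega" using w borel_probsD(3)[OF R] by simp
      have sec: "Pair \<omega> -` (case_prod \<Psi> -` S \<inter> space (R \<Otimes>\<^sub>M ?P)) = {\<omega>'\<in>Omega. \<Psi> \<omega> \<omega>' \<in> S}" for S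
        using wO borel_probsD(3)[OF R] borel_probsD(3)[OF Pb] by (auto simp: space_pair_measure)
      have \<Psi>w: "\<Psi> \<omega> \<in> Omega_borel \<rightarrow>\<^sub>M Omega_borel"
        using measurable_compose[OF measurable_Pair1' \<Psi>, of \<omega>] wO by (simp add: space_Omega_borel)
      have secs: "{\<omega>'\<in>Omega. \<Psi> \<omega> \<omega>' \<in> S} \<in> sets Omega_borel" if "S \<in> sets Omega_borel" for S
        using measurable_sets[OF \<Psi>w that] by (simp add: vimage_def Int_def conj_commute space_Omega_borel)
      have secU: "{\<omega>'\<in>Omega. \<Psi> \<omega> \<omega>' \<in> S} \<in> sets P" if "S \<in> sets Omega_um" for S
        using measurable_sets[OF measurable_um_um[OF measurable_borel_imp_um[OF \<Psi>w]] that] Omega_probsD(2)[OF P]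
        by (simp add: vimage_def Int_def conj_commute)
      have eP: "emeasure ?P S = emeasure P S" if "S \<in> sets Omega_borel" for S
        using emeasure_um_ext[OF Pb, of S] um_ext_borel_part[OF P] sets_Omega_borel_subset that
          borel_probsD(2)[OF Pb] by auto
      have sub: "?B \<subseteq> D" "D \<subseteq> ?B \<union> N0" using main_part_null_part_Un[OF Dc] N0 by auto
      have "emeasure P {\<omega>'\<in>Omega. \<Psi> \<omega> \<omega>' \<in> N0} = 0"
        using 0 eP[OF secs[OF N0s]] unfolding sec by simp
      then have n: "{\<omega>'\<in>Omega. \<Psi> \<omega> \<omega>' \<in> N0} \<in> null_sets P"
        using secU N0s sets_Omega_borel_subset by (auto simp: null_sets_def)
      have "?m \<omega> \<le> emeasure P ({\<omega>'\<in>Omega. \<Psi> \<omega> \<omega>' \<in> ?B} \<union> {\<omega>'\<in>Omega. \<Psi> \<omega> \<omega>' \<in> N0})"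
        by (rule emeasure_mono) (use sub secU[of ?B] secU[of N0] N0s B sets_Omega_borel_subset in auto)
      also have "\<dots> = emeasure P {\<omega>'\<in>Omega. \<Psi> \<omega> \<omega>' \<in> ?B}"
        using n secU[of ?B] B sets_Omega_borel_subset by (intro emeasure_Un_null_set) auto
      finally have "?m \<omega> \<le> emeasure P {\<omega>'\<in>Omega. \<Psi> \<omega> \<omega>' \<in> ?B}" .
      moreover have "emeasure P {\<omega>'\<in>Omega. \<Psi> \<omega> \<omega>' \<in> ?B} \<le> ?m \<omega>"
        by (rule emeasure_mono) (use sub secU D in auto)
      ultimately have "?m \<omega> = emeasure P {\<omega>'\<in>Omega. \<Psi> \<omega> \<omega>' \<in> ?B}" by simp
      then show "?m \<omega> = m1 \<omega>" unfolding m1_def sec eP[OF secs[OF B]] .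
    qed
    have "(\<integral>\<^sup>+\<omega>. m1 \<omega> \<partial>R) = emeasure ?N ?B"
      unfolding m1_def by (subst P.emeasure_pair_measure_alt[OF Bs, symmetric]) (simp add: emeasure_distr[OF \<Psi>' B])
    also have "\<dots> = emeasure (um_ext ?N) D"
      using emeasure_um_ext[OF N D] emeasure_completion[OF Dc] by simp
    finally show ?thesis using m1 ae by blast
  qed
  \<comment> \<open>The version \<open>m1\<close> changes with \<open>R\<close>, which is exactly
    what measurability for all completions tolerates.\<close>
  show "?m \<in> borel_measurable Omega_um"
  proof (rule measurable_umI)
    fix R assume "R \<in> borel_probs"
    from *[OF this] obtain m1 where m1: "m1 \<in> borel_measurable R" "AE \<omega> in R. ?m \<omega> = m1 \<omega>"
      by blast
    show "?m \<in> borel_measurable (completion R)"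
      by (rule measurable_completion_AE[OF m1(1) _ m1(2)]) simp
  qed auto
  then have mc: "?m \<in> borel_measurable Omega_um" .
  show "(\<integral>\<^sup>+\<omega>. ?m \<omega> \<partial>R)
        = emeasure (um_ext (distr (borel_part R \<Otimes>\<^sub>M ?P) Omega_borel (case_prod \<Psi>))) D" if R: "R \<in> Omega_probs"
  proof -
    have Rb: "borel_part R \<in> borel_probs" by (rule borel_part_in[OF R])
    from *[OF Rb] obtain m1 where m1: "m1\<in>borel_measurable (borel_part R)" "AE \<omega> in borel_part R. ?m \<omega> = m1 \<omega>"
      "(\<integral>\<^sup>+\<omega>. m1 \<omega> \<partial>borel_part R) = emeasure (um_ext (distr (borel_part R \<Otimes>\<^sub>M ?P) Omega_borel (case_prod \<Psi>))) D"
      by auto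
    have "(\<integral>\<^sup>+\<omega>. ?m \<omega> \<partial>R) = (\<integral>\<^sup>+\<omega>. ?m \<omega> \<partial>um_ext (borel_part R))"
      by (simp add: um_ext_borel_part[OF R])
    also have "\<dots> = (\<integral>\<^sup>+\<omega>. ?m \<omega> \<partial>completion (borel_part R))"
      unfolding um_ext_def by (rule nn_integral_distr[OF measurable_completion_um[OF Rb]]) (use mc in simp)
    also have "\<dots> = (\<integral>\<^sup>+\<omega>. m1 \<omega> \<partial>completion (borel_part R))"
      by (rule nn_integral_cong_AE) (rule AE_completion[OF m1(2)])
    also have "\<dots> = (\<integral>\<^sup>+\<omega>. m1 \<omega> \<partial>borel_part R)"
      by (rule nn_integral_completion)
    finally show ?thesis using m1(3) by simp
  qed
qed

section \<open>The sample space as a retract of the unit interval\<close>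

text \<open>One countable dense set serves twice: as thresholds that encode a coordinate by bits,
  and as points at which distribution functions are evaluated. Containing 0 makes its part below any
  positive bound nonempty; containing 1 gives a quantile a candidate that always qualifies when
  \<open>F 1 = 1\<close>.\<close>

definition rat01 :: "real set" where "rat01 = \<rat> \<inter> {0..1}"

lemma countable_rat01: "countable rat01"
  unfolding rat01_def using countable_rat by blast

lemma zero_in_rat01: "0 \<in> rat01" and one_in_rat01: "1 \<in> rat01"
  by (auto simp: rat01_def)

lemma rat01_between:
  assumes "a < b" "0 < b" "a < 1" obtains q where "q \<in> rat01" "a \<le> q" "q < b"
proof -
  have "max a 0 < min b 1" using assms by auto
  then obtain q where "q \<in> \<rat>" "max a 0 < q" "q < min b 1" using Rats_dense_in_real by blast
  then show thesis using that[of q] by (auto simp: rat01_def)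
qed

definition enum01 :: "nat \<Rightarrow> real" where "enum01 = from_nat_into rat01"

lemma range_enum01: "range enum01 = rat01"
  unfolding enum01_def using range_from_nat_into[OF _ countable_rat01] zero_in_rat01 by auto

lemma enum01_bounds: "0 \<le> enum01 m" "enum01 m \<le> 1"
  using range_enum01 by (auto simp: rat01_def)

text \<open>Digits \<open>0\<close> and \<open>1\<close> in base \<open>3\<close> leave a tail of at most \<open>1/2\<close>, so they are recovered by
  iterating \<open>t \<mapsto> 3t - \<lfloor>3t\<rfloor>\<close>.\<close>

definition ternary :: "(nat \<Rightarrow> real) \<Rightarrow> real" where
  "ternary b = (\<Sum>n. b n * (1/3) ^ Suc n)"

primrec ternary_digit :: "nat \<Rightarrow> real \<Rightarrow> real" where
  "ternary_digit 0 t = real_of_int \<lfloor>3 * t\<rfloor>"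
| "ternary_digit (Suc n) t = ternary_digit n (3 * t - real_of_int \<lfloor>3 * t\<rfloor>)"

lemma ternary_digit_measurable [measurable]: "ternary_digit n \<in> borel_measurable borel"
proof (induction n)
  case (Suc n)
  have "(\<lambda>t::real. 3 * t - real_of_int \<lfloor>3 * t\<rfloor>) \<in> borel_measurable borel" by measurable
  from measurable_compose[OF this Suc] show ?case by (simp cong: measurable_cong)
qed (simp cong: measurable_cong)

lemma
  assumes "\<And>n. b n \<in> {0, 1}"
  shows ternary_summable: "summable (\<lambda>n. b n * (1/3) ^ Suc n)"
    and ternary_nonneg: "0 \<le> ternary b"
    and ternary_le: "ternary b \<le> 1/2"
proof -
  have g: "summable (\<lambda>n. (1/3::real) ^ Suc n)"
    by (subst summable_Suc_iff) (rule summable_geometric, simp)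
  have b: "0 \<le> b n" "b n \<le> 1" for n using assms[of n] by auto
  show s: "summable (\<lambda>n. b n * (1/3) ^ Suc n)"
    by (rule summable_comparison_test'[OF g, of 0]) (use b in \<open>auto simp: abs_mult intro!: mult_left_le_one_le\<close>)
  show "0 \<le> ternary b" unfolding ternary_def by (rule suminf_nonneg[OF s]) (use b in auto)
  have "ternary b \<le> (\<Sum>n. (1/3) ^ Suc n)" unfolding ternary_def
    by (rule suminf_le[OF _ s g]) (use b in \<open>auto intro!: mult_left_le_one_le\<close>)
  also have "\<dots> = 1/2"
    using suminf_geometric[of "1/3::real"] suminf_split_head[OF summable_geometric[of "1/3::real"]] by simp
  finally show "ternary b \<le> 1/2" .
qed

lemma ternary_shift:
  assumes "\<And>n. b n \<in> {0, 1}" shows "3 * ternary b = b 0 + ternary (\<lambda>n. b (Suc n))"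
proof -
  have s: "summable (\<lambda>n. b (Suc n) * (1/3) ^ Suc n)" using ternary_summable[of "\<lambda>n. b (Suc n)"] assms by auto
  have "ternary b = (\<Sum>n. b (Suc n) * (1/3) ^ Suc (Suc n)) + b 0 * (1/3)"
    unfolding ternary_def by (subst suminf_split_head[OF ternary_summable[OF assms]]) simp
  also have "(\<Sum>n. b (Suc n) * (1/3) ^ Suc (Suc n)) = (1/3) * ternary (\<lambda>n. b (Suc n))"
    unfolding ternary_def suminf_mult[OF s, symmetric] by (simp add: mult_ac)
  finally show ?thesis by simp
qed

lemma ternary_digit_ternary:
  assumes "\<And>n. b n \<in> {0, 1}" shows "ternary_digit n (ternary b) = b n"
  using assms
proof (induction n arbitrary: b)
  have fl: "real_of_int \<lfloor>3 * ternary b\<rfloor> = b 0" if b: "\<And>n. b n \<in> {0, 1::real}" for b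
  proof -
    have t: "0 \<le> ternary (\<lambda>n. b (Suc n))" "ternary (\<lambda>n. b (Suc n)) \<le> 1/2"
      by (rule ternary_nonneg, rule b) (rule ternary_le, rule b)
    have "\<lfloor>3 * ternary b\<rfloor> = (if b 0 = 0 then 0 else 1)"
      unfolding ternary_shift[OF b] using t b[of 0] by (intro floor_unique) auto
    then show ?thesis using b[of 0] by auto
  qed
  {
    case 0 then show ?case using fl by simp
  next
    case (Suc n)
    have "3 * ternary b - real_of_int \<lfloor>3 * ternary b\<rfloor> = ternary (\<lambda>n. b (Suc n))"
      using fl[of b, OF Suc.prems] ternary_shift[of b, OF Suc.prems] by linarith
    then show ?case using Suc.IH[of "\<lambda>n. b (Suc n)"] Suc.prems by (simp del: insert_iff)
  }
qed

text \<open>Each coordinate is stored as its lower Dedekind cut among the rationals of the unit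
  interval, and \<open>prod_decode\<close> interleaves the cuts of all coordinates into one bit
  sequence.\<close>

definition Omega_bits :: "(nat \<Rightarrow> real) \<Rightarrow> nat \<Rightarrow> real" where
  "Omega_bits \<omega> n = (case prod_decode n of (k, m) \<Rightarrow> if enum01 m \<le> \<omega> k then 1 else 0)"

definition Omega_code :: "(nat \<Rightarrow> real) \<Rightarrow> real" where
  "Omega_code \<omega> = ternary (Omega_bits \<omega>)"

text \<open>Supremum of the decoded cut. The value 0 for unset digits does not raise the supremum
  for a nonnegative coordinate, and it keeps the result in the unit interval for every real
  \<open>t\<close>, code or not.\<close>

definition Omega_decode :: "real \<Rightarrow> nat \<Rightarrow> real" where
  "Omega_decode t k = (SUP m. if ternary_digit (prod_encode (k, m)) t = 1 then enum01 m else 0)"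

lemma Omega_bits_01: "Omega_bits \<omega> n \<in> {0, 1}"
  by (auto simp: Omega_bits_def split: prod.splits)

lemma Omega_code_bounds: "0 \<le> Omega_code \<omega>" "Omega_code \<omega> \<le> 1"
  using ternary_nonneg[of "Omega_bits \<omega>"] ternary_le[of "Omega_bits \<omega>"] Omega_bits_01
  by (auto simp: Omega_code_def)

lemma Omega_decode_bdd: "bdd_above (range (\<lambda>m. if ternary_digit (prod_encode (k, m)) t = 1 then enum01 m else 0))"
  by (rule bdd_aboveI[of _ 1]) (use enum01_bounds in auto)

lemma Omega_decode_in: "Omega_decode t \<in> Omega"
proof -
  have "0 \<le> Omega_decode t k" "Omega_decode t k \<le> 1" for k
  proof -
    show "0 \<le> Omega_decode t k" unfolding Omega_decode_def
      by (rule cSUP_upper2[OF Omega_decode_bdd, of 0]) (use enum01_bounds in auto)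
    show "Omega_decode t k \<le> 1" unfolding Omega_decode_def
      by (rule cSUP_least) (use enum01_bounds in auto)
  qed
  then show ?thesis by (auto simp: Omega_eq)
qed

lemma Omega_decode_code:
  assumes "\<omega> \<in> Omega" shows "Omega_decode (Omega_code \<omega>) = \<omega>"
proof
  fix k
  have w: "0 \<le> \<omega> k" "\<omega> k \<le> 1" using assms by (auto simp: Omega_eq Pi_iff)
  have *: "Omega_decode (Omega_code \<omega>) k = (SUP m. if enum01 m \<le> \<omega> k then enum01 m else 0)"
    unfolding Omega_decode_def Omega_code_def ternary_digit_ternary[OF Omega_bits_01]
    by (rule SUP_cong) (auto simp: Omega_bits_def)
  have bdd: "bdd_above (range (\<lambda>m. if enum01 m \<le> \<omega> k then enum01 m else 0))"
    by (rule bdd_aboveI[of _ 1]) (use enum01_bounds in auto)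
  show "Omega_decode (Omega_code \<omega>) k = \<omega> k" unfolding *
  proof (rule antisym)
    show "(SUP m. if enum01 m \<le> \<omega> k then enum01 m else 0) \<le> \<omega> k"
      by (rule cSUP_least) (use w in auto)
    show "\<omega> k \<le> (SUP m. if enum01 m \<le> \<omega> k then enum01 m else 0)"
    \<comment> \<open>The lower end -1 makes the interval below \<open>\<omega> k\<close> nonempty
      even when \<open>\<omega> k = 0\<close>.\<close>
    proof (rule dense_le_bounded[of "-1"])
      fix a assume a: "-1 < a" "a < \<omega> k"
      show "a \<le> (SUP m. if enum01 m \<le> \<omega> k then enum01 m else 0)"
      proof (cases "a \<le> 0")
        case True
        have "0 \<le> (SUP m. if enum01 m \<le> \<omega> k then enum01 m else 0)"
          by (rule cSUP_upper2[OF bdd, of 0]) (use enum01_bounds in auto)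
        with True show ?thesis by simp
      next
        case False
        then obtain q where q: "q \<in> rat01" "a \<le> q" "q < \<omega> k"
          using rat01_between[of a "\<omega> k"] a w by auto
        then obtain m where "q = enum01 m" using range_enum01 by (metis imageE)
        then show ?thesis using q by (intro cSUP_upper2[OF bdd, of m]) auto
      qed
    qed (use w in auto)
  qed
qed

lemma Omega_code_measurable [measurable]: "Omega_code \<in> borel_measurable Omega_borel"
proof -
  have [measurable]: "(\<lambda>\<omega>. Omega_bits \<omega> n) \<in> borel_measurable Omega_borel" for n
  proof -
    note [measurable] = measurable_Omega_borel_component
    show ?thesis unfolding Omega_bits_def by (cases "prod_decode n") simp
  qed
  show ?thesis unfolding Omega_code_def ternary_def by measurable
qed

lemma Omega_decode_measurable: "Omega_decode \<in> borel \<rightarrow>\<^sub>M Omega_borel"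
proof (rule measurable_Omega_borelI)
  show "(\<lambda>t. Omega_decode t k) \<in> borel_measurable borel" for k
    unfolding Omega_decode_def
    by (rule borel_measurable_cSUP) (use Omega_decode_bdd in \<open>auto simp: image_def\<close>)
qed (use Omega_decode_in in auto)

section \<open>Noise and quantiles\<close>

text \<open>Restricting the space, rather than putting a density on the whole line, makes the
  underlying set \<open>{0..1}\<close>, so that the countable power of \<open>unif\<close> lives on
  exactly \<open>Omega\<close>.\<close>

definition unif :: "real measure" where "unif = restrict_space lborel {0..1}"

lemma space_unif [simp]: "space unif = {0..1}"
  by (simp add: unif_def space_restrict_space)

lemma prob_space_unif: "prob_space unif"
  by (rule prob_spaceI) (simp add: unif_def space_restrict_space emeasure_restrict_space)

lemma sets_unif: "sets unif = sets (restrict_space borel {0..1})"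
  unfolding unif_def by (rule sets_restrict_space_cong) simp

lemma measurable_unif_ident: "(\<lambda>u. u) \<in> borel_measurable unif"
  unfolding unif_def by (rule measurable_restrict_space1) simp

interpretation unif: prob_space unif by (rule prob_space_unif)

interpretation unif_seq: sequence_space unif ..

abbreviation noise_borel :: "(nat \<Rightarrow> real) measure" where
  "noise_borel \<equiv> PiM UNIV (\<lambda>_. unif)"

lemma space_noise_borel: "space noise_borel = Omega"
  by (simp add: space_PiM Omega_def)

lemma measurable_ident_imp_sets_subset:
  assumes "(\<lambda>x. x) \<in> M \<rightarrow>\<^sub>M N" "space M = space N"
  shows "sets N \<subseteq> sets M"
proof
  fix A assume A: "A \<in> sets N"
  have "(\<lambda>x. x) -` A \<inter> space M = A" using sets.sets_into_space[OF A] assms(2) by auto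
  then show "A \<in> sets M" using measurable_sets[OF assms(1) A] by simp
qed

lemma sets_noise_borel: "sets noise_borel = sets Omega_borel"
proof (rule antisym)
  have "(\<lambda>\<omega>. \<omega>) \<in> Omega_borel \<rightarrow>\<^sub>M noise_borel"
  proof (rule measurable_PiM_single')
    show "(\<lambda>\<omega>. \<omega> i) \<in> Omega_borel \<rightarrow>\<^sub>M unif" for i
      unfolding measurable_cong_sets[OF refl sets_unif]
      by (rule measurable_restrict_space2) (auto simp: space_Omega_borel Omega_eq intro: measurable_Omega_borel_component)
  qed (auto simp: space_Omega_borel Omega_eq)
  then show "sets noise_borel \<subseteq> sets Omega_borel"
    by (rule measurable_ident_imp_sets_subset) (simp add: space_noise_borel space_Omega_borel)
  have "(\<lambda>\<omega>. \<omega>) \<in> noise_borel \<rightarrow>\<^sub>M Omega_borel"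
  proof (rule measurable_Omega_borelI)
    show "(\<lambda>\<omega>. \<omega> k) \<in> borel_measurable noise_borel" for k
      using measurable_compose[OF measurable_component_singleton[of k UNIV "\<lambda>_. unif"] measurable_unif_ident]
      by simp
  qed (simp add: space_noise_borel)
  then show "sets Omega_borel \<subseteq> sets noise_borel"
    by (rule measurable_ident_imp_sets_subset) (simp add: space_noise_borel space_Omega_borel)
qed

lemma noise_borel_in: "noise_borel \<in> borel_probs"
  using unif_seq.P.prob_space_axioms sets_noise_borel by (simp add: borel_probs_def)

text \<open>The one law on the sample space that all kernels below share; only the functions applied
  to it vary with the parameter.\<close>

definition noise :: "(nat \<Rightarrow> real) measure" where "noise = um_ext noise_borel"

lemma noise_in: "noise \<in> Omega_probs"
  unfolding noise_def by (rule um_ext_in[OF noise_borel_in])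

lemma borel_part_noise: "borel_part noise = noise_borel"
  unfolding noise_def by (rule borel_part_um_ext[OF noise_borel_in])

lemma emeasure_noise: "A \<in> sets Omega_borel \<Longrightarrow> emeasure noise A = emeasure noise_borel A"
  unfolding noise_def using emeasure_um_ext[OF noise_borel_in, of A] sets_Omega_borel_subset
  by (auto simp: sets_noise_borel)

lemma emeasure_noise_cylinder:
  assumes "\<And>k. k < n \<Longrightarrow> B k \<in> sets unif"
  shows "emeasure noise {\<omega>\<in>Omega. \<forall>k<n. \<omega> k \<in> B k} = (\<Prod>k<n. emeasure unif (B k))"
proof -
  have eq: "{\<omega>\<in>Omega. \<forall>k<n. \<omega> k \<in> B k} = prod_emb UNIV (\<lambda>_. unif) {..<n} (Pi\<^sub>E {..<n} B)"
    by (auto simp: prod_emb_def PiE_iff Omega_eq)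
  have s: "prod_emb UNIV (\<lambda>_. unif) {..<n} (Pi\<^sub>E {..<n} B) \<in> sets noise_borel"
    by (rule sets_PiM_I) (use assms in auto)
  show ?thesis unfolding eq
    by (subst emeasure_noise) (use s sets_noise_borel assms in \<open>auto intro!: unif_seq.emeasure_PiM_emb\<close>)
qed

text \<open>An injective choice of coordinates from independent identically distributed ones leaves
  the Borel product law alone; \<open>distr_um_eqI\<close> extends the invariance to universally
  measurable sets.\<close>

lemma noise_reindex:
  assumes "inj \<sigma>"
  shows "distr noise Omega_um (\<lambda>\<omega> k. \<omega> (\<sigma> k)) = noise"
proof -
  have m: "(\<lambda>\<omega> k. \<omega> (\<sigma> k)) \<in> Omega_um \<rightarrow>\<^sub>M Omega_borel"
    by (rule measurable_Omega_borelI) (auto simp: Omega_eq intro: measurable_Omega_um_component)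
  have m': "(\<lambda>\<omega> k. \<omega> (\<sigma> k)) \<in> Omega_borel \<rightarrow>\<^sub>M Omega_borel"
    by (rule measurable_Omega_borelI) (auto simp: Omega_eq space_Omega_borel intro: measurable_Omega_borel_component)
  have 1: "distr noise_borel noise_borel (\<lambda>\<omega> k. \<omega> (\<sigma> k)) = noise_borel"
    using distr_PiM_reindex[of UNIV "\<lambda>_. unif" \<sigma> UNIV] assms prob_space_unif by (auto simp: restrict_def)
  have "distr noise Omega_borel (\<lambda>\<omega> k. \<omega> (\<sigma> k)) = distr (borel_part noise) Omega_borel (\<lambda>\<omega> k. \<omega> (\<sigma> k))"
    unfolding borel_part_def
    by (subst distr_distr) (use m' noise_in in \<open>auto simp: comp_def measurable_Omega_probs measurable_ident_um_borel\<close>)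
  also have "\<dots> = distr noise_borel noise_borel (\<lambda>\<omega> k. \<omega> (\<sigma> k))"
    unfolding borel_part_noise by (rule distr_cong) (auto simp: sets_noise_borel)
  also have "\<dots> = distr noise Omega_borel (\<lambda>\<omega>. \<omega>)"
    using 1 borel_part_noise by (simp add: borel_part_def)
  finally have "distr noise Omega_um (\<lambda>\<omega> k. \<omega> (\<sigma> k)) = distr noise Omega_um (\<lambda>\<omega>. \<omega>)"
    by (intro distr_um_eqI noise_in m measurable_ident_um_borel)
  also have "\<dots> = noise" using Omega_probsD[OF noise_in] by (intro distr_id2) simp
  finally show ?thesis .
qed

lemma sets_cylinder:
  fixes t :: "nat \<Rightarrow> real"
  shows "{\<omega>\<in>Omega. \<forall>k<n. \<omega> k < t k} \<in> sets Omega_borel"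
proof -
  note [measurable] = measurable_Omega_borel_component
  have "{\<omega>\<in>space Omega_borel. \<forall>k<n. \<omega> k < t k} \<in> sets Omega_borel" by measurable
  then show ?thesis unfolding space_Omega_borel .
qed

text \<open>Cylinders with strict upper bounds are stable under intersection, by taking minima of
  thresholds, and generate the Borel sets. Strict inequalities are the ones that a quantile, being
  an infimum, resolves exactly.\<close>

lemma borel_probs_eqI:
  assumes P: "P \<in> borel_probs" and P': "P' \<in> borel_probs"
    and eq: "\<And>n t. emeasure P {\<omega>\<in>Omega. \<forall>k<n. \<omega> k < t k} = emeasure P' {\<omega>\<in>Omega. \<forall>k<n. \<omega> k < (t k :: real)}"
  shows "P = P'"
proof -
  define C where "C n t = {\<omega>\<in>Omega. \<forall>k<n. \<omega> k < (t k :: real)}" for n :: nat and t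
  define E where "E = {C n t | n t. True}"
  have CO: "C n t \<subseteq> Omega" for n t by (auto simp: C_def)
  then have EO: "E \<subseteq> Pow Omega" by (auto simp: E_def)
  have E_I: "C n t \<in> E" for n t unfolding E_def by blast
  have sp: "space (sigma Omega E) = Omega" and se: "sets (sigma Omega E) = sigma_sets Omega E"
    using EO by simp_all
  have bd: "\<omega> k < 2" if "\<omega> \<in> Omega" for \<omega> k
  proof -
    have "\<omega> k \<le> 1" using that by (auto simp: Omega_eq Pi_iff)
    then show ?thesis by simp
  qed
  have "(\<lambda>\<omega>. \<omega>) \<in> sigma Omega E \<rightarrow>\<^sub>M Omega_borel"
  proof (rule measurable_Omega_borelI)
    fix k :: nat
    show "(\<lambda>\<omega>. \<omega> k) \<in> borel_measurable (sigma Omega E)"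
    proof (rule borel_measurableI_less)
      fix y :: real
      \<comment> \<open>The threshold 2 imposes nothing, since coordinates are at most 1.\<close>
      let ?t = "\<lambda>i. if i = k then y else 2"
      have "{\<omega>\<in>Omega. \<omega> k < y} = C (Suc k) ?t"
      proof safe
        fix \<omega> assume "\<omega> \<in> Omega" "\<omega> k < y"
        then show "\<omega> \<in> C (Suc k) ?t" using bd by (simp add: C_def)
      next
        fix \<omega> assume w: "\<omega> \<in> C (Suc k) ?t"
        then show "\<omega> \<in> Omega" using CO by blast
        have "\<omega> k < ?t k" using w unfolding C_def by blast
        then show "\<omega> k < y" by simp
      qed
      then show "{\<omega>\<in>space (sigma Omega E). \<omega> k < y} \<in> sets (sigma Omega E)"
        unfolding sp se using E_I by (metis sigma_sets.Basic)
    qed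
  qed (simp add: sp)
  then have "sets Omega_borel \<subseteq> sets (sigma Omega E)"
    by (rule measurable_ident_imp_sets_subset) (simp only: space_Omega_borel sp)
  then have 1: "sets Omega_borel \<subseteq> sigma_sets Omega E"
    unfolding se .
  have "C n t \<in> sets Omega_borel" for n t unfolding C_def by (rule sets_cylinder)
  then have "E \<subseteq> sets Omega_borel" unfolding E_def by blast
  then have "sigma_sets (space Omega_borel) E \<subseteq> sets Omega_borel"
    by (rule sets.sigma_sets_subset)
  with 1 have sE: "sets Omega_borel = sigma_sets Omega E"
    unfolding space_Omega_borel by (rule subset_antisym)
  interpret P: prob_space P by (rule borel_probsD(1)[OF P])
  show ?thesis
  proof (rule measure_eqI_generator_eq[of E Omega P P' "\<lambda>_. Omega"])
    show "Int_stable E"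
    proof (rule Int_stableI)
      fix a b assume "a \<in> E" "b \<in> E"
      then obtain n t m t' where ab: "a = C n t" "b = C m t'" unfolding E_def by blast
      \<comment> \<open>Beyond the length of either cylinder the vacuous bound 2 is used, so that
        minima can be taken at every index.\<close>
      let ?t = "\<lambda>k. min (if k < n then t k else 2) (if k < m then t' k else 2)"
      have "a \<inter> b = C (max n m) ?t"
      proof safe
        fix \<omega> assume w: "\<omega> \<in> C (max n m) ?t"
        have wt: "\<omega> k < ?t k" if "k < max n m" for k using w that unfolding C_def by blast
        have "\<omega> k < t k" if "k < n" for k using wt[of k] that by simp
        moreover have "\<omega> k < t' k" if "k < m" for k using wt[of k] that by simp
        ultimately show "\<omega> \<in> a" "\<omega> \<in> b" using w CO unfolding ab C_def by simp_all
      next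
        fix \<omega> assume w: "\<omega> \<in> a" "\<omega> \<in> b"
        then have "\<omega> \<in> Omega" using CO ab by blast
        with w bd show "\<omega> \<in> C (max n m) ?t" unfolding ab C_def by simp
      qed
      then show "a \<inter> b \<in> E" using E_I by simp
    qed
    have "C 0 (\<lambda>_. 0) = Omega" by (simp add: C_def)
    then show "range (\<lambda>_::nat. Omega) \<subseteq> E" using E_I[of 0 "\<lambda>_. 0"] by simp
    show "emeasure P A = emeasure P' A" if "A \<in> E" for A
    proof -
      from that obtain n t where A: "A = C n t" unfolding E_def by blast
      show ?thesis unfolding A C_def by (rule eq)
    qed
  qed (use EO sE borel_probsD[OF P] borel_probsD[OF P'] in \<open>simp_all\<close>)
qed

text \<open>If \<open>F\<close> is the distribution function of a law on the unit interval, then \<open>quant F\<close> maps the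
  uniform law to it; joint measurability in \<open>F\<close> and \<open>u\<close> is immediate from the countable infimum.\<close>

definition quant :: "(real \<Rightarrow> ennreal) \<Rightarrow> real \<Rightarrow> real" where
  "quant F u = (INF q\<in>rat01. if ennreal u \<le> F q then q else 1)"

lemma quant_bdd: "bdd_below ((\<lambda>q. if ennreal u \<le> F q then q else 1) ` rat01)"
  by (rule bdd_belowI[of _ 0]) (auto simp: rat01_def)

lemma quant_bounds: "0 \<le> quant F u" "quant F u \<le> 1"
proof -
  show "0 \<le> quant F u" unfolding quant_def
    by (rule cINF_greatest) (use zero_in_rat01 in \<open>auto simp: rat01_def\<close>)
  show "quant F u \<le> 1" unfolding quant_def
    by (rule cINF_lower2[OF quant_bdd one_in_rat01]) auto
qed

text \<open>An infimum is below \<open>t\<close> exactly when one of its terms is; the default term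
  1 is covered by \<open>q = 1\<close>. The equivalence is exact also for functions that are not
  right-continuous, as \<open>lim_cdf s\<close> can be.\<close>

lemma quant_less_iff:
  assumes "F 1 = 1" "u \<le> 1"
  shows "quant F u < t \<longleftrightarrow> (\<exists>q\<in>rat01. q < t \<and> ennreal u \<le> F q)"
proof -
  have "ennreal u \<le> F 1" using assms ennreal_leI[of u 1] by simp
  then show ?thesis unfolding quant_def
    using one_in_rat01 by (subst cINF_less_iff[OF _ quant_bdd]) (auto split: if_splits)
qed

lemma quant_measurable [measurable (raw)]:
  assumes [measurable]: "\<And>q. (\<lambda>x. F x q) \<in> borel_measurable M" "u \<in> borel_measurable M"
  shows "(\<lambda>x. quant (F x) (u x)) \<in> borel_measurable M"
  unfolding quant_def by (rule borel_measurable_cINF[OF countable_rat01 _ quant_bdd]) measurable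

text \<open>Running maxima of an enumeration of the rationals below \<open>t\<close>. Such a cofinal
  chain turns the existence of a suitable rational below \<open>t\<close> into an increasing
  countable union, to which continuity from below applies.\<close>

lemma rat01_chain:
  assumes "0 < t"
  obtains q where "incseq q" "\<And>m::nat. q m \<in> rat01" "\<And>m. q m < t"
    "\<And>p. p \<in> rat01 \<Longrightarrow> p < t \<Longrightarrow> \<exists>m. p \<le> q m"
proof
  let ?S = "{p\<in>rat01. p < t}"
  let ?e = "from_nat_into ?S"
  have ne: "?S \<noteq> {}" and c: "countable ?S" using assms zero_in_rat01 countable_rat01 by auto
  define q where "q m = Max (?e ` {..m})" for m :: nat
  have "q m \<in> ?S" for m
  proof -
    have "q m \<in> ?e ` {..m}" unfolding q_def by (rule Max_in) auto
    then show ?thesis using from_nat_into[OF ne] by (metis (no_types, lifting) imageE)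
  qed
  then show "q m \<in> rat01" "q m < t" for m by auto
  show "incseq q" unfolding q_def by (auto simp: incseq_def intro!: Max_mono)
  show "\<exists>m. p \<le> q m" if p: "p \<in> rat01" "p < t" for p
  proof -
    obtain m where "?e m = p" using from_nat_into_surj[OF c, of p] p by auto
    then show ?thesis unfolding q_def by (intro exI[of _ m] Max_ge) auto
  qed
qed

text \<open>The set is the increasing union of the intervals from 0 to \<open>F (q m)\<close>, whose
  lengths are these values; the result is the left limit of \<open>F\<close> at \<open>t\<close>
  along the rationals.\<close>

lemma emeasure_quant_less:
  assumes F: "mono F" "F 1 = 1" and Fle: "\<And>x. F x \<le> 1"
    and q: "incseq q" "\<And>m::nat. q m \<in> rat01" "\<And>m. q m < t"
    "\<And>p. p \<in> rat01 \<Longrightarrow> p < t \<Longrightarrow> \<exists>m. p \<le> q m"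
  shows "emeasure unif {u\<in>{0..1}. quant F u < t} = (SUP m. F (q m))"
proof -
  let ?A = "\<lambda>m. {0..enn2real (F (q m))}"
  have Ff: "F x < top" for x using Fle[of x] by (simp add: le_less_trans)
  have iff: "ennreal u \<le> F x \<longleftrightarrow> u \<le> enn2real (F x)" for u x
    using Ff[of x] by (metis enn2real_nonneg ennreal_enn2real ennreal_le_iff)
  have "{u\<in>{0..1}. quant F u < t} = (\<Union>m. ?A m)"
  proof safe
    fix u assume u: "u \<in> {0..1}" "quant F u < t"
    then obtain p where p: "p \<in> rat01" "p < t" "ennreal u \<le> F p"
      using quant_less_iff[of F, OF F(2)] by auto
    then obtain m where "p \<le> q m" using q(4) by blast
    then have "ennreal u \<le> F (q m)" using monoD[OF F(1)] p(3) order_trans by blast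
    then show "u \<in> (\<Union>m. ?A m)" using u iff by auto
  next
    fix u m assume u: "u \<in> ?A m"
    moreover have "enn2real (F (q m)) \<le> 1" using Fle[of "q m"] by (simp add: enn2real_leI)
    ultimately show u01: "u \<in> {0..1}" by auto
    show "quant F u < t" using quant_less_iff[of F u t, OF F(2)] u u01 iff q by auto
  qed
  moreover have Am: "?A m \<in> sets unif" and Ae: "emeasure unif (?A m) = F (q m)" for m
  proof -
    have 1: "enn2real (F (q m)) \<le> 1" using Fle[of "q m"] by (simp add: enn2real_leI)
    then show "?A m \<in> sets unif" by (auto simp: sets_unif sets_restrict_space intro!: image_eqI[of _ _ "?A m"])
    show "emeasure unif (?A m) = F (q m)" unfolding unif_def
      by (subst emeasure_restrict_space) (use 1 Ff[of "q m"] in auto)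
  qed
  moreover have "incseq ?A"
  proof (rule incseq_SucI)
    fix m
    have "F (q m) \<le> F (q (Suc m))" using q(1) F(1) by (simp add: incseq_SucD monoD)
    then show "?A m \<subseteq> ?A (Suc m)" using enn2real_mono[OF _ Ff] by auto
  qed
  ultimately show ?thesis using SUP_emeasure_incseq[of ?A unif] by (auto simp: image_subset_iff)
qed

section \<open>De Finetti's theorem for real sequences\<close>

definition avg :: "nat \<Rightarrow> real \<Rightarrow> (nat \<Rightarrow> real) \<Rightarrow> real" where
  "avg n t s = (\<Sum>k<n. indicator {..t} (s k)) / real n"

text \<open>Along the sparse sequence \<open>4^l\<close> the empirical frequencies converge almost surely by a mere
  second moment bound. The limit superior keeps monotonicity in \<open>t\<close> for every sequence \<open>s\<close>.\<close>

definition lim_cdf :: "(nat \<Rightarrow> real) \<Rightarrow> real \<Rightarrow> ennreal" where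
  "lim_cdf s t = limsup (\<lambda>l. ennreal (avg (4 ^ l) t s))"

section \<open>Bounds, monotonicity and permutation invariance of empirical frequencies\<close>

lemma avg_nonneg: "0 \<le> avg n t s"
  by (auto simp: avg_def intro!: divide_nonneg_nonneg sum_nonneg)

lemma avg_le_1: "avg n t s \<le> 1"
proof -
  have "(\<Sum>k<n. indicator {..t} (s k)) \<le> (\<Sum>k<n. 1::real)"
    by (rule sum_mono) (simp add: indicator_def)
  then show ?thesis by (cases "n = 0") (auto simp: avg_def divide_le_eq)
qed

lemma avg_mono: "t \<le> t' \<Longrightarrow> avg n t s \<le> avg n t' s"
  unfolding avg_def by (intro divide_right_mono sum_mono) (auto simp: indicator_def)

lemma lim_cdf_mono: "mono (lim_cdf s)"
  unfolding lim_cdf_def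
  by (intro monoI Limsup_mono always_eventually allI ennreal_leI avg_mono)

lemma lim_cdf_le_1: "lim_cdf s t \<le> 1"
  unfolding lim_cdf_def
  by (rule Limsup_bounded) (use avg_le_1 in \<open>auto simp: ennreal_le_1\<close>)

lemma lim_cdf_1: assumes "s \<in> Omega" shows "lim_cdf s 1 = 1"
proof -
  have "indicator {..1} (s k) = (1::real)" for k using assms by (auto simp: Omega_eq Pi_iff)
  then have "avg (4 ^ l) 1 s = 1" for l by (simp add: avg_def)
  then show ?thesis by (simp add: lim_cdf_def Limsup_const)
qed

text \<open>If \<open>\<sigma>\<close> moved some \<open>n < N\<close> to an index from
  \<open>N\<close> on, that index would be fixed, against injectivity. So \<open>\<sigma>\<close>
  permutes the first \<open>N\<close> indices and only reorders the sum.\<close>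

lemma avg_perm:
  assumes "bij \<sigma>" "{n. \<sigma> n \<noteq> n} \<subseteq> {..<N}"
  shows "avg N t (\<lambda>k. s (\<sigma> k)) = avg N t s"
proof -
  have inj: "inj \<sigma>" using assms(1) by (rule bij_is_inj)
  have "\<sigma> n < N" if "n < N" for n
  proof (rule ccontr)
    assume c: "\<not> \<sigma> n < N"
    then have "\<sigma> (\<sigma> n) = \<sigma> n" using assms(2) by auto
    then have "\<sigma> n = n" using inj by (simp add: inj_eq)
    then show False using c that by simp
  qed
  then have "\<sigma> ` {..<N} \<subseteq> {..<N}" by auto
  then have "\<sigma> ` {..<N} = {..<N}"
    using inj_on_subset[OF inj subset_UNIV] by (intro card_subset_eq) (auto simp: card_image)
  then have "bij_betw \<sigma> {..<N} {..<N}"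
    using inj_on_subset[OF inj subset_UNIV] by (simp add: bij_betw_def)
  then have "(\<Sum>k<N. indicator {..t} (s (\<sigma> k))) = (\<Sum>k<N. indicator {..t} (s k) :: real)"
    by (rule sum.reindex_bij_betw)
  then show ?thesis by (simp add: avg_def)
qed

text \<open>From some \<open>l\<close> on, \<open>4 ^ l\<close> exceeds the support of
  \<open>\<sigma>\<close> and the averages coincide. The invariance holds for every sequence, not
  just almost surely, so limit factors can be carried along inside exact symmetry arguments.\<close>

lemma lim_cdf_perm:
  assumes "bij \<sigma>" "finite {n. \<sigma> n \<noteq> n}"
  shows "lim_cdf (\<lambda>k. s (\<sigma> k)) t = lim_cdf s t"
proof -
  obtain m where m: "{n. \<sigma> n \<noteq> n} \<subseteq> {..<m}" using finite_nat_bounded[OF assms(2)] by auto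
  have "avg (4 ^ l) t (\<lambda>k. s (\<sigma> k)) = avg (4 ^ l) t s" if "m \<le> l" for l
  proof (rule avg_perm[OF assms(1)])
    have "l < 4 ^ l" by (rule less_exp[THEN less_le_trans]) (simp add: power_mono)
    with m that show "{n. \<sigma> n \<noteq> n} \<subseteq> {..<4 ^ l}" by force
  qed
  then have "\<forall>\<^sub>F l in sequentially. ennreal (avg (4 ^ l) t (\<lambda>k. s (\<sigma> k))) = ennreal (avg (4 ^ l) t s)"
    unfolding eventually_sequentially by (intro exI[of _ m]) simp
  then show ?thesis unfolding lim_cdf_def by (rule Limsup_eq)
qed

lemma lim_cdf_measurable:
  assumes "\<And>k. (\<lambda>x. s x k) \<in> borel_measurable M"
  shows "(\<lambda>x. lim_cdf (s x) t) \<in> borel_measurable M"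
proof -
  note [measurable] = assms
  have "(\<lambda>x. indicator {..t} (s x k) :: real) \<in> borel_measurable M" for k by measurable
  then have "(\<lambda>x. ennreal (avg (4 ^ l) t (s x))) \<in> borel_measurable M" for l
    unfolding avg_def by (intro measurable_compose[OF _ measurable_ennreal] borel_measurable_divide
        borel_measurable_sum) auto
  then show ?thesis unfolding lim_cdf_def by (rule borel_measurable_limsup)
qed

lemma finite_transpose: "finite {n. Transposition.transpose a b n \<noteq> n}"
  by (rule finite_subset[of _ "{a, b}"]) (auto simp: Transposition.transpose_def)

lemma ex_perm_pair:
  assumes "i \<noteq> (j::nat)"
  obtains \<sigma> where "bij \<sigma>" "finite {n. \<sigma> n \<noteq> n}" "\<sigma> 0 = i" "\<sigma> 1 = j"
proof
  \<comment> \<open>\<open>?k\<close> is the index that the outer swap sends to \<open>j\<close>; it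
    differs from 0 because \<open>i \<noteq> j\<close>, so the inner swap leaves 0 alone.\<close>
  let ?k = "Transposition.transpose 0 i j"
  let ?\<sigma> = "Transposition.transpose 0 i \<circ> Transposition.transpose 1 ?k"
  show "bij ?\<sigma>" by (intro bij_comp) simp_all
  show "finite {n. ?\<sigma> n \<noteq> n}"
    by (rule finite_subset[of _ "{0, i, 1, ?k}"]) (auto simp: Transposition.transpose_def split: if_splits)
  have "?k \<noteq> 0" using assms by (auto simp: Transposition.transpose_def split: if_splits)
  then show "?\<sigma> 0 = i" by (simp add: Transposition.transpose_def)
  show "?\<sigma> 1 = j" by simp
qed

text \<open>The law is carried by all real sequences; concentration on the cube \<open>Omega\<close>
  enters later as an almost sure statement, where quantiles require it.\<close>

locale exch_seq = prob_space N for N :: "(nat \<Rightarrow> real) measure" +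
  assumes sets_N: "sets N = sets borel"
    and exch: "bij \<sigma> \<Longrightarrow> finite {n. \<sigma> n \<noteq> n} \<Longrightarrow> distr N N (\<lambda>s k. s (\<sigma> k)) = N"
begin

lemma space_N: "space N = UNIV"
  using sets_eq_imp_space_eq[OF sets_N] by simp

lemma measurable_N: "measurable N M = measurable borel M"
  by (rule measurable_cong_sets[OF sets_N refl])

lemma component_measurable [measurable]: "(\<lambda>s. s k) \<in> borel_measurable N"
  unfolding measurable_N by (rule borel_measurable_continuous_onI) simp

lemma perm_measurable: "(\<lambda>s k. s (\<sigma> k)) \<in> N \<rightarrow>\<^sub>M N"
  unfolding measurable_cong_sets[OF refl sets_N]
  by (rule measurable_coordinatewise_then_product) (rule component_measurable)

lemma exch_integral:
  fixes f :: "(nat \<Rightarrow> real) \<Rightarrow> real"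
  assumes "f \<in> borel_measurable N" "bij \<sigma>" "finite {n. \<sigma> n \<noteq> n}"
  shows "(\<integral>s. f (\<lambda>k. s (\<sigma> k)) \<partial>N) = (\<integral>s. f s \<partial>N)"
  using integral_distr[OF perm_measurable assms(1), of \<sigma>] exch[OF assms(2,3)] by simp

lemma integrable_bounded:
  fixes f :: "(nat \<Rightarrow> real) \<Rightarrow> real"
  assumes "f \<in> borel_measurable N" "\<And>s. \<bar>f s\<bar> \<le> B"
  shows "integrable N f"
  by (rule integrable_const_bound[of _ B]) (use assms in auto)

definition Y :: "real \<Rightarrow> nat \<Rightarrow> (nat \<Rightarrow> real) \<Rightarrow> real" where
  "Y t k s = indicator {..t} (s k)"

lemma Y_measurable [measurable]: "Y t k \<in> borel_measurable N"
  unfolding Y_def by measurable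

lemma Y_bounds: "0 \<le> Y t k s" "Y t k s \<le> 1"
  by (auto simp: Y_def indicator_def)

lemma avg_Y: "avg n t s = (\<Sum>k<n. Y t k s) / real n"
  by (simp add: avg_def Y_def)

lemma avg_measurable [measurable]: "avg n t \<in> borel_measurable N"
  unfolding avg_Y by measurable

text \<open>Exchangeability leaves only two moments: the mean of \<open>Y t 0\<close> on the
  diagonal, as an indicator equals its square, and the mean of \<open>Y t 0 * Y t 1\<close> off it.
  The weights \<open>c\<close> are arbitrary so that differences of averages can be
  inserted.\<close>

lemma second_moment:
  "(\<integral>s. (\<Sum>k<m. c k * Y t k s)\<^sup>2 \<partial>N)
    = (\<integral>s. Y t 0 s * Y t 1 s \<partial>N) * (\<Sum>k<m. c k)\<^sup>2
      + ((\<integral>s. Y t 0 s \<partial>N) - (\<integral>s. Y t 0 s * Y t 1 s \<partial>N)) * (\<Sum>k<m. (c k)\<^sup>2)"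
proof -
  define a where "a = (\<integral>s. Y t 0 s \<partial>N)"
  define b where "b = (\<integral>s. Y t 0 s * Y t 1 s \<partial>N)"
  have int: "integrable N (\<lambda>s. Y t i s * Y t j s)" for i j
    by (rule integrable_bounded[of _ 1]) (auto simp: Y_def indicator_def)
  have E: "(\<integral>s. Y t i s * Y t j s \<partial>N) = b + (if i = j then a - b else 0)" for i j
  proof (cases "i = j")
    case True
    have "(\<integral>s. Y t i s * Y t i s \<partial>N) = (\<integral>s. Y t i s \<partial>N)"
      by (rule Bochner_Integration.integral_cong) (auto simp: Y_def indicator_def)
    also have "\<dots> = a"
      using exch_integral[of "Y t 0" "Transposition.transpose 0 i"] finite_transpose[of 0 i]
      by (simp add: Y_def a_def)
    finally show ?thesis using True by simp
  next
    case False
    from ex_perm_pair[OF False] obtain \<sigma> where s: "bij \<sigma>" "finite {n. \<sigma> n \<noteq> n}" "\<sigma> 0 = i" "\<sigma> 1 = j" .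
    have "(\<lambda>s. Y t 0 s * Y t 1 s) \<in> borel_measurable N" by measurable
    from exch_integral[OF this s(1,2)] s(3,4) False show ?thesis by (simp add: Y_def b_def)
  qed
  have "(\<integral>s. (\<Sum>k<m. c k * Y t k s)\<^sup>2 \<partial>N) = (\<integral>s. (\<Sum>i<m. \<Sum>j<m. c i * c j * (Y t i s * Y t j s)) \<partial>N)"
    by (rule Bochner_Integration.integral_cong) (simp_all add: power2_eq_square sum_product mult_ac)
  also have "\<dots> = (\<Sum>i<m. \<Sum>j<m. c i * c j * (\<integral>s. Y t i s * Y t j s \<partial>N))"
    using int by (simp add: Bochner_Integration.integral_sum)
  also have "\<dots> = (\<Sum>i<m. \<Sum>j<m. b * (c i * c j) + (if i = j then (a - b) * (c i * c j) else 0))"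
    by (intro sum.cong refl) (simp add: E algebra_simps)
  also have "\<dots> = (\<Sum>i<m. \<Sum>j<m. b * (c i * c j)) + (\<Sum>i<m. (a - b) * (c i * c i))"
    by (simp add: sum.distrib)
  also have "\<dots> = b * (\<Sum>k<m. c k)\<^sup>2 + (a - b) * (\<Sum>k<m. (c k)\<^sup>2)"
  proof -
    have "(\<Sum>i<m. \<Sum>j<m. b * (c i * c j)) = b * (\<Sum>k<m. c k)\<^sup>2"
      by (simp only: power2_eq_square sum_product) (simp only: sum_distrib_left)
    moreover have "(\<Sum>i<m. (a - b) * (c i * c i)) = (a - b) * (\<Sum>k<m. (c k)\<^sup>2)"
      by (simp only: power2_eq_square sum_distrib_left)
    ultimately show ?thesis by (simp only:)
  qed
  finally show ?thesis unfolding a_def b_def .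
qed

text \<open>The difference of two averages has weights summing to zero, so only the term with the
  sum of squares survives in \<open>second_moment\<close>, and it is at most
  \<open>(1/4) ^ l\<close>. Passing from second to first moments leaves a summable geometric
  bound.\<close>

lemma avg_increment_L1:
  "(\<integral>s. \<bar>avg (4 ^ Suc l) t s - avg (4 ^ l) t s\<bar> \<partial>N) \<le> (1/2) ^ l"
proof -
  let ?M = "4 ^ Suc l :: nat" and ?n = "4 ^ l :: nat"
  let ?D = "\<lambda>s. avg ?M t s - avg ?n t s"
  define c where "c k = 1 / real ?M - (if k < ?n then 1 / real ?n else 0)" for k
  have nM: "?n \<le> ?M" by simp
  have sub: "(\<Sum>k<?M. if k < ?n then f k else 0) = (\<Sum>k<?n. f k)" for f :: "nat \<Rightarrow> real"
    using nM by (subst sum.inter_filter[symmetric]) (auto intro!: sum.cong)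
  have D: "?D s = (\<Sum>k<?M. c k * Y t k s)" for s
  proof -
    have "(\<Sum>k<?M. c k * Y t k s) = (\<Sum>k<?M. Y t k s / real ?M - (if k < ?n then Y t k s / real ?n else 0))"
      by (rule sum.cong) (auto simp: c_def algebra_simps)
    also have "\<dots> = ?D s"
      unfolding sum_subtractf sub avg_Y by (simp add: sum_divide_distrib)
    finally show ?thesis by simp
  qed
  have c0: "(\<Sum>k<?M. c k) = 0"
    unfolding c_def sum_subtractf sub by simp
  have "(c k)\<^sup>2 = (1 / real ?M)\<^sup>2 + (if k < ?n then (1 / real ?n)\<^sup>2 - 2 * (1 / real ?M) * (1 / real ?n) else 0)" for k
    by (auto simp: c_def power2_eq_square algebra_simps)
  then have "(\<Sum>k<?M. (c k)\<^sup>2) = real ?M * (1 / real ?M)\<^sup>2 + real ?n * ((1 / real ?n)\<^sup>2 - 2 * (1 / real ?M) * (1 / real ?n))"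
    by (simp only: sum.distrib sub) simp
  also have "\<dots> = 1 / real ?n - 1 / real ?M"
    by (simp add: power2_eq_square field_simps)
  also have "\<dots> \<le> 1 / real ?n"
    using divide_nonneg_nonneg[of 1 "real ?M"] by linarith
  finally have c2: "(\<Sum>k<?M. (c k)\<^sup>2) \<le> (1/4) ^ l" by (simp add: power_one_over)
  have intD2: "integrable N (\<lambda>s. (?D s)\<^sup>2)"
  proof (rule integrable_bounded[of _ 1])
    fix s
    have "\<bar>?D s\<bar> \<le> 1" using avg_nonneg[of ?M t s] avg_nonneg[of ?n t s] avg_le_1[of ?M t s] avg_le_1[of ?n t s] by linarith
    then show "\<bar>(?D s)\<^sup>2\<bar> \<le> 1" by (simp add: abs_square_le_1)
  qed measurable
  have "(\<integral>s. (?D s)\<^sup>2 \<partial>N) = ((\<integral>s. Y t 0 s \<partial>N) - (\<integral>s. Y t 0 s * Y t 1 s \<partial>N)) * (\<Sum>k<?M. (c k)\<^sup>2)"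
    unfolding D second_moment c0 by simp
  also have "\<dots> \<le> 1 * (\<Sum>k<?M. (c k)\<^sup>2)"
  proof (rule mult_right_mono)
    have i: "integrable N (Y t 0)" "integrable N (\<lambda>s. Y t 0 s * Y t 1 s)"
      by (rule integrable_bounded[of _ 1]; auto simp: Y_def indicator_def)+
    have "(\<integral>s. Y t 0 s \<partial>N) - (\<integral>s. Y t 0 s * Y t 1 s \<partial>N) = (\<integral>s. Y t 0 s - Y t 0 s * Y t 1 s \<partial>N)"
      using i by simp
    also have "\<dots> \<le> (\<integral>s. 1 \<partial>N)"
    proof (rule integral_mono)
      show "integrable N (\<lambda>s. Y t 0 s - Y t 0 s * Y t 1 s)" using i by simp
    qed (auto simp: Y_def indicator_def)
    finally show "(\<integral>s. Y t 0 s \<partial>N) - (\<integral>s. Y t 0 s * Y t 1 s \<partial>N) \<le> 1" by (simp add: prob_space)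
  qed (simp add: sum_nonneg)
  finally have D2: "(\<integral>s. (?D s)\<^sup>2 \<partial>N) \<le> (1/4) ^ l" using c2 by simp
  have intD: "integrable N (\<lambda>s. \<bar>?D s\<bar>)"
  proof (rule integrable_bounded[of _ 1])
    fix s
    show "\<bar>\<bar>?D s\<bar>\<bar> \<le> 1" using avg_nonneg[of ?M t s] avg_nonneg[of ?n t s] avg_le_1[of ?M t s] avg_le_1[of ?n t s] by linarith
  qed measurable
  \<comment> \<open>The elementary inequality \<open>x \<le> e/2 + x^2/(2e)\<close>, with
    \<open>e = (1/2) ^ l\<close> chosen to balance the two terms.\<close>
  have "(\<integral>s. \<bar>?D s\<bar> \<partial>N) \<le> (\<integral>s. (1/2) ^ l / 2 + 2 ^ l / 2 * (?D s)\<^sup>2 \<partial>N)"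
  proof (rule integral_mono[OF intD])
    fix s
    let ?x = "\<bar>?D s\<bar>"
    have e: "(1/2::real) ^ l * 2 ^ l = 1" by (simp add: power_mult_distrib[symmetric])
    have "0 \<le> 2 ^ l / 2 * (?x - (1/2) ^ l)\<^sup>2" by simp
    also have "\<dots> = 2 ^ l / 2 * ?x\<^sup>2 - ((1/2) ^ l * 2 ^ l) * ?x + ((1/2) ^ l * 2 ^ l) * (1/2) ^ l / 2"
      by (simp only: power2_eq_square) (simp add: algebra_simps)
    finally show "?x \<le> (1/2) ^ l / 2 + 2 ^ l / 2 * (?D s)\<^sup>2" unfolding e by simp
  qed (use intD2 in auto)
  also have "\<dots> = (1/2) ^ l / 2 + 2 ^ l / 2 * (\<integral>s. (?D s)\<^sup>2 \<partial>N)"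
    using intD2 by (simp add: prob_space)
  also have "\<dots> \<le> (1/2) ^ l / 2 + 2 ^ l / 2 * (1/4) ^ l"
    using D2 by simp
  also have "\<dots> = (1/2) ^ l" by (simp add: power_mult_distrib[symmetric])
  finally show ?thesis .
qed

section \<open>Almost sure limits and factorisation of mixed moments\<close>

definition Fr :: "real \<Rightarrow> (nat \<Rightarrow> real) \<Rightarrow> real" where
  "Fr t s = enn2real (lim_cdf s t)"

lemma Fr_measurable [measurable]: "Fr t \<in> borel_measurable N"
proof -
  have "(\<lambda>s. lim_cdf s t) \<in> borel_measurable N" by (rule lim_cdf_measurable) measurable
  then show ?thesis unfolding Fr_def by measurable
qed

lemma ennreal_Fr: "ennreal (Fr t s) = lim_cdf s t"
  using lim_cdf_le_1[of s t] by (simp add: Fr_def le_less_trans)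

lemma Fr_bounds: "0 \<le> Fr t s" "Fr t s \<le> 1"
  using lim_cdf_le_1[of s t] by (auto simp: Fr_def intro: enn2real_leI)

text \<open>The increments have summable expected absolute values, so almost surely they are
  absolutely summable and the averages telescope to a limit. A convergent sequence has its limit as
  limit superior, which identifies the limit with \<open>Fr\<close>.\<close>

lemma AE_avg_tendsto: "AE s in N. (\<lambda>l. avg (4 ^ l) t s) \<longlonglongrightarrow> Fr t s"
proof -
  let ?D = "\<lambda>l s. avg (4 ^ Suc l) t s - avg (4 ^ l) t s"
  have [measurable]: "(\<lambda>s. ennreal \<bar>?D l s\<bar>) \<in> borel_measurable N" for l by measurable
  have intD: "integrable N (\<lambda>s. \<bar>?D l s\<bar>)" for l
  proof (rule integrable_bounded[of _ 1])
    fix s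
    show "\<bar>\<bar>?D l s\<bar>\<bar> \<le> 1" using avg_nonneg[of "4 ^ Suc l" t s] avg_nonneg[of "4 ^ l" t s]
        avg_le_1[of "4 ^ Suc l" t s] avg_le_1[of "4 ^ l" t s] by linarith
  qed measurable
  have "(\<integral>\<^sup>+s. (\<Sum>l. ennreal \<bar>?D l s\<bar>) \<partial>N) = (\<Sum>l. \<integral>\<^sup>+s. ennreal \<bar>?D l s\<bar> \<partial>N)"
    by (rule nn_integral_suminf) measurable
  also have "\<dots> \<le> (\<Sum>l. ennreal ((1/2) ^ l))"
  proof (rule suminf_le)
    fix l
    have "(\<integral>\<^sup>+s. ennreal \<bar>?D l s\<bar> \<partial>N) = ennreal (\<integral>s. \<bar>?D l s\<bar> \<partial>N)"
      by (rule nn_integral_eq_integral[OF intD]) simp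
    then show "(\<integral>\<^sup>+s. ennreal \<bar>?D l s\<bar> \<partial>N) \<le> ennreal ((1/2) ^ l)"
      using avg_increment_L1[where t=t and l=l] by (simp add: ennreal_leI)
  qed simp_all
  also have "\<dots> = ennreal (\<Sum>l. (1/2) ^ l)"
    by (rule suminf_ennreal2) (simp_all add: summable_geometric)
  finally have "(\<integral>\<^sup>+s. (\<Sum>l. ennreal \<bar>?D l s\<bar>) \<partial>N) \<noteq> \<infinity>"
    by (auto simp: top_unique)
  then have "AE s in N. (\<Sum>l. ennreal \<bar>?D l s\<bar>) \<noteq> \<infinity>"
    by (intro nn_integral_PInf_AE) measurable
  then show ?thesis
  proof (rule AE_mp, intro AE_I2 impI)
    fix s assume "(\<Sum>l. ennreal \<bar>?D l s\<bar>) \<noteq> \<infinity>"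
    then have "summable (\<lambda>l. \<bar>?D l s\<bar>)" by (intro summable_suminf_not_top) auto
    then have "summable (\<lambda>l. ?D l s)" by (rule summable_rabs_cancel)
    then obtain L where L: "(\<lambda>n. \<Sum>l<n. ?D l s) \<longlonglongrightarrow> L" by (auto simp: summable_def sums_def)
    have "(\<Sum>l<n. ?D l s) = avg (4 ^ n) t s - avg (4 ^ 0) t s" for n
      by (rule sum_lessThan_telescope)
    then have "(\<lambda>n. avg (4 ^ n) t s - avg (4 ^ 0) t s + avg (4 ^ 0) t s) \<longlonglongrightarrow> L + avg (4 ^ 0) t s"
      using L by (intro tendsto_add tendsto_const) simp
    then have c: "(\<lambda>n. avg (4 ^ n) t s) \<longlonglongrightarrow> L + avg (4 ^ 0) t s" by simp
    then have "(\<lambda>n. ennreal (avg (4 ^ n) t s)) \<longlonglongrightarrow> ennreal (L + avg (4 ^ 0) t s)"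
      by (rule tendsto_ennrealI)
    then have "lim_cdf s t = ennreal (L + avg (4 ^ 0) t s)"
      unfolding lim_cdf_def by (rule lim_imp_Limsup[OF sequentially_bot])
    moreover have "0 \<le> L + avg (4 ^ 0) t s"
      by (rule LIMSEQ_le_const[OF c]) (use avg_nonneg in auto)
    ultimately show "(\<lambda>l. avg (4 ^ l) t s) \<longlonglongrightarrow> Fr t s" using c by (simp add: Fr_def)
  qed
qed

text \<open>Swapping \<open>m\<close> with any \<open>k \<ge> m\<close> leaves \<open>V\<close> alone, so \<open>Y t m\<close> may be replaced by
  an average over all \<open>k\<close> at the cost of the \<open>m\<close> first summands.\<close>

lemma replace_by_limit:
  assumes [measurable]: "V \<in> borel_measurable N"
    and b: "\<And>s. 0 \<le> V s" "\<And>s. V s \<le> 1"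
    and inv: "\<And>k s. m \<le> k \<Longrightarrow> V (\<lambda>i. s (Transposition.transpose m k i)) = V s"
  shows "(\<integral>s. V s * Y t m s \<partial>N) = (\<integral>s. V s * Fr t s \<partial>N)"
proof -
  let ?e = "\<lambda>k. \<integral>s. V s * Y t k s \<partial>N"
  have VY: "0 \<le> V s * Y t k s" "V s * Y t k s \<le> 1" for s k
    using b[of s] Y_bounds[of t k s] by (auto intro: mult_le_one)
  have int: "integrable N (\<lambda>s. V s * Y t k s)" for k
    by (rule integrable_bounded[of _ 1]) (use VY in auto)
  have e01: "0 \<le> ?e k" "?e k \<le> 1" for k
  proof -
    show "0 \<le> ?e k" by (rule integral_nonneg_AE) (use VY in auto)
    have "?e k \<le> (\<integral>s. 1 \<partial>N)" by (rule integral_mono[OF int]) (use VY in auto)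
    then show "?e k \<le> 1" by (simp add: prob_space)
  qed
  have em: "?e k = ?e m" if "m \<le> k" for k
  proof -
    have "(\<lambda>s. V s * Y t m s) \<in> borel_measurable N" by measurable
    from exch_integral[OF this bij_transpose[of m k] finite_transpose] show ?thesis
      using inv[OF that] by (simp add: Y_def)
  qed
  have avg_eq: "(\<integral>s. V s * avg n t s \<partial>N) = (\<Sum>k<n. ?e k) / real n" for n
  proof -
    have "V s * avg n t s = (\<Sum>k<n. V s * Y t k s) / real n" for s
      by (simp add: avg_Y sum_distrib_left)
    then show ?thesis using int by (simp add: Bochner_Integration.integral_sum)
  qed
  have bound: "\<bar>(\<integral>s. V s * avg n t s \<partial>N) - ?e m\<bar> \<le> real m / real n" if "n > 0" for n
  proof -
    have "(\<Sum>k<n. ?e k) - real n * ?e m = (\<Sum>k<n. ?e k - ?e m)" by (simp add: sum_subtractf)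
    also have "\<bar>\<dots>\<bar> \<le> (\<Sum>k<n. \<bar>?e k - ?e m\<bar>)" by (rule sum_abs)
    also have "\<dots> \<le> (\<Sum>k<n. if k < m then 1 else 0)"
    proof (rule sum_mono)
      fix k
      show "\<bar>?e k - ?e m\<bar> \<le> (if k < m then 1 else 0)"
        using e01[of k] e01[of m] em[of k] by auto
    qed
    also have "\<dots> = real (card {k\<in>{..<n}. k < m})" by (subst sum.inter_filter[symmetric]) auto
    also have "\<dots> \<le> real m"
      using card_mono[of "{..<m}" "{k\<in>{..<n}. k < m}"] by auto
    finally have "\<bar>(\<Sum>k<n. ?e k) - real n * ?e m\<bar> \<le> real m" .
    moreover have "(\<Sum>k<n. ?e k) / real n - ?e m = ((\<Sum>k<n. ?e k) - real n * ?e m) / real n"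
      using that by (simp add: field_simps)
    ultimately show ?thesis unfolding avg_eq using that by (simp add: abs_divide divide_right_mono)
  qed
  have pw: "filterlim (\<lambda>l. (4::nat) ^ l) at_top sequentially"
    by (rule filterlim_subseq) (simp add: strict_mono_def)
  have "(\<lambda>l. real m / real ((4::nat) ^ l)) \<longlonglongrightarrow> 0"
    by (rule real_tendsto_divide_at_top[OF tendsto_const])
      (rule filterlim_compose[OF filterlim_real_sequentially pw])
  then have "(\<lambda>l. (\<integral>s. V s * avg (4 ^ l) t s \<partial>N) - ?e m) \<longlonglongrightarrow> 0"
  proof (rule Lim_null_comparison[rotated])
    have "norm ((\<integral>s. V s * avg (4 ^ l) t s \<partial>N) - ?e m) \<le> real m / real ((4::nat) ^ l)" for l
      unfolding real_norm_def by (rule bound) simp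
    then show "\<forall>\<^sub>F l in sequentially. norm ((\<integral>s. V s * avg (4 ^ l) t s \<partial>N) - ?e m) \<le> real m / real ((4::nat) ^ l)"
      by (intro always_eventually allI)
  qed
  then have 1: "(\<lambda>l. \<integral>s. V s * avg (4 ^ l) t s \<partial>N) \<longlonglongrightarrow> ?e m"
    by (simp add: LIM_zero_iff)
  have 2: "(\<lambda>l. \<integral>s. V s * avg (4 ^ l) t s \<partial>N) \<longlonglongrightarrow> (\<integral>s. V s * Fr t s \<partial>N)"
  proof (rule integral_dominated_convergence[where w = "\<lambda>_. 1"])
    show "AE s in N. (\<lambda>l. V s * avg (4 ^ l) t s) \<longlonglongrightarrow> V s * Fr t s"
      using AE_avg_tendsto[of t] by (rule AE_mp) (auto intro!: tendsto_intros)
    show "AE s in N. norm (V s * avg (4 ^ l) t s) \<le> 1" for l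
      using b avg_nonneg avg_le_1 by (auto simp: abs_mult intro!: mult_le_one)
  qed measurable
  show ?thesis by (rule LIMSEQ_unique[OF 1 2])
qed

text \<open>Indicators are traded for limits one at a time, from the last down. The remaining
  factors qualify for \<open>replace_by_limit\<close>: the indicators have indices below
  \<open>m\<close>, which a swap of \<open>m\<close> with a later index fixes, and the limits are
  invariant under finite permutations.\<close>

lemma mixed_product:
  assumes "m \<le> n"
  shows "(\<integral>s. (\<Prod>k<m. Y (t k) k s) * (\<Prod>k\<in>{m..<n}. Fr (t k) s) \<partial>N) = (\<integral>s. (\<Prod>k<n. Fr (t k) s) \<partial>N)"
  using assms
proof (induction m)
  case 0
  then show ?case by (simp add: atLeast0LessThan)
next
  case (Suc m)
  let ?V = "\<lambda>s. (\<Prod>k<m. Y (t k) k s) * (\<Prod>k\<in>{Suc m..<n}. Fr (t k) s)"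
  have "(\<integral>s. (\<Prod>k<Suc m. Y (t k) k s) * (\<Prod>k\<in>{Suc m..<n}. Fr (t k) s) \<partial>N) = (\<integral>s. ?V s * Y (t m) m s \<partial>N)"
    by (simp add: mult_ac)
  also have "\<dots> = (\<integral>s. ?V s * Fr (t m) s \<partial>N)"
  proof (rule replace_by_limit)
    fix s
    have 1: "0 \<le> (\<Prod>k<m. Y (t k) k s)" "(\<Prod>k<m. Y (t k) k s) \<le> 1"
      using Y_bounds by (auto intro!: prod_nonneg prod_le_1)
    have 2: "0 \<le> (\<Prod>k\<in>{Suc m..<n}. Fr (t k) s)" "(\<Prod>k\<in>{Suc m..<n}. Fr (t k) s) \<le> 1"
      using Fr_bounds by (auto intro!: prod_nonneg prod_le_1)
    show "0 \<le> ?V s" "?V s \<le> 1" using 1 2 by (auto intro: mult_le_one)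
  next
    fix k s assume k: "m \<le> k"
    have "(\<Prod>i<m. Y (t i) i (\<lambda>j. s (Transposition.transpose m k j))) = (\<Prod>i<m. Y (t i) i s)"
      using k by (intro prod.cong) (auto simp: Y_def Transposition.transpose_def)
    moreover have "Fr u (\<lambda>j. s (Transposition.transpose m k j)) = Fr u s" for u
      unfolding Fr_def using lim_cdf_perm[OF bij_transpose finite_transpose] by simp
    ultimately show "?V (\<lambda>j. s (Transposition.transpose m k j)) = ?V s" by simp
  qed measurable
  also have "\<dots> = (\<integral>s. (\<Prod>k<m. Y (t k) k s) * (\<Prod>k\<in>{m..<n}. Fr (t k) s) \<partial>N)"
    using Suc.prems by (simp add: prod.atLeast_Suc_lessThan mult_ac)
  finally show ?case using Suc by simp
qed

text \<open>The case \<open>m = n\<close> of \<open>mixed_product\<close>, where only indicators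
  stand on the left, moved to extended nonnegative reals so that monotone convergence can
  follow.\<close>

lemma de_Finetti_cdf:
  "emeasure N {s. \<forall>k<n. s k \<le> t k} = (\<integral>\<^sup>+s. (\<Prod>k<n. lim_cdf s (t k)) \<partial>N)"
proof -
  have A: "{s. \<forall>k<n. s k \<le> t k} \<in> sets N"
  proof -
    have "{s\<in>space N. \<forall>k<n. s k \<le> t k} \<in> sets N" by measurable
    then show ?thesis by (simp add: space_N)
  qed
  have "(\<Prod>k<n. Y (t k) k s) = indicator {s. \<forall>k<n. s k \<le> t k} s" for s
    by (induction n) (auto simp: Y_def indicator_def less_Suc_eq)
  then have "(\<integral>s. (\<Prod>k<n. Y (t k) k s) \<partial>N) = measure N {s. \<forall>k<n. s k \<le> t k}"
    using A by simp
  then have "measure N {s. \<forall>k<n. s k \<le> t k} = (\<integral>s. (\<Prod>k<n. Fr (t k) s) \<partial>N)"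
    using mixed_product[of n n t] by simp
  then have "emeasure N {s. \<forall>k<n. s k \<le> t k} = ennreal (\<integral>s. (\<Prod>k<n. Fr (t k) s) \<partial>N)"
    by (simp add: emeasure_eq_measure)
  also have "\<dots> = (\<integral>\<^sup>+s. ennreal (\<Prod>k<n. Fr (t k) s) \<partial>N)"
  proof (rule nn_integral_eq_integral[symmetric])
    show "integrable N (\<lambda>s. \<Prod>k<n. Fr (t k) s)"
    proof (rule integrable_bounded[of _ 1])
      fix s
      have "0 \<le> (\<Prod>k<n. Fr (t k) s)" "(\<Prod>k<n. Fr (t k) s) \<le> 1"
        using Fr_bounds by (auto intro!: prod_nonneg prod_le_1)
      then show "\<bar>\<Prod>k<n. Fr (t k) s\<bar> \<le> 1" by simp
    qed measurable
  qed (use Fr_bounds in \<open>auto intro!: prod_nonneg\<close>)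
  also have "\<dots> = (\<integral>\<^sup>+s. (\<Prod>k<n. lim_cdf s (t k)) \<partial>N)"
    by (rule nn_integral_cong) (simp add: prod_ennreal[symmetric] Fr_bounds ennreal_Fr)
  finally show ?thesis .
qed

text \<open>Approximating each \<open>t k\<close> from below by a rational chain turns the closed
  orthants of \<open>de_Finetti_cdf\<close> into open ones and the values of \<open>lim_cdf\<close>
  into left limits, which are the uniform measures of the quantile sets. This matches the cylinders
  of \<open>borel_probs_eqI\<close>.\<close>

lemma de_Finetti_quant:
  assumes Om: "AE s in N. s \<in> Omega"
  shows "emeasure N {s. \<forall>k<n. s k < t k}
    = (\<integral>\<^sup>+s. (\<Prod>k<n. emeasure unif {u\<in>{0..1}. quant (lim_cdf s) u < t k}) \<partial>N)"
\<comment> \<open>A chain of rationals from the unit interval exists only below a positive bound;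
  with some \<open>t k \<le> 0\<close> both sides vanish.\<close>
proof (cases "\<exists>k<n. t k \<le> 0")
  case True
  then obtain k where k: "k < n" "t k \<le> 0" by auto
  have "AE s in N. \<not> (\<forall>k<n. s k < t k)"
    using Om
  proof (rule AE_mp, intro AE_I2 impI)
    fix s assume "s \<in> Omega"
    then have "0 \<le> s k" by (auto simp: Omega_eq Pi_iff)
    then show "\<not> (\<forall>k<n. s k < t k)" using k by (meson leD order_trans)
  qed
  then have "emeasure N {s. \<forall>k<n. s k < t k} = 0"
    using emeasure_eq_0_AE[of "\<lambda>s. \<forall>k<n. s k < t k" N] by (simp add: space_N)
  moreover have empty: "{u\<in>{0..1}. quant (lim_cdf s) u < t k} = {}" for s
  proof -
    have "\<not> quant (lim_cdf s) u < t k" for u using quant_bounds(1)[of "lim_cdf s" u] k(2) by linarith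
    then show ?thesis by auto
  qed
  then have "(\<Prod>k<n. emeasure unif {u\<in>{0..1}. quant (lim_cdf s) u < t k}) = 0" for s
    using k(1) by (intro prod_zero finite_lessThan bexI[of _ k])
      (simp_all only: empty emeasure_empty lessThan_iff)
  ultimately show ?thesis by (simp only: nn_integral_const mult_zero_left)
next
  case False
  define chain where "chain q t \<longleftrightarrow> incseq q \<and> (\<forall>m::nat. q m \<in> rat01 \<and> q m < t) \<and>
      (\<forall>p\<in>rat01. p < t \<longrightarrow> (\<exists>m. p \<le> q m))" for q and t :: real
  have "\<exists>q. chain q (t k)" if "k < n" for k
  proof -
    have "0 < t k" using False that by (meson not_le)
    then show ?thesis unfolding chain_def by (rule rat01_chain) blast
  qed
  then obtain q where q: "\<And>k. k < n \<Longrightarrow> chain (q k) (t k)" by metis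
  have q1: "incseq (q k)" "q k m \<in> rat01" "q k m < t k" "p \<in> rat01 \<Longrightarrow> p < t k \<Longrightarrow> \<exists>m. p \<le> q k m"
    if "k < n" for k m p
    using q[OF that] by (auto simp: chain_def)
  have incP: "(\<Prod>k<j. lim_cdf s (q k m)) \<le> (\<Prod>k<j. lim_cdf s (q k (Suc m)))" if "j \<le> n" for j s m
    using that
  proof (induction j)
    case (Suc j)
    have "lim_cdf s (q j m) \<le> lim_cdf s (q j (Suc m))"
      using incseq_SucD[OF q1(1), of j m] Suc.prems by (intro monoD[OF lim_cdf_mono]) simp
    then show ?case using Suc by (simp add: mult_mono)
  qed simp
  let ?A = "\<lambda>m. {s. \<forall>k<n. s k \<le> q k m}"
  have A[measurable]: "?A m \<in> sets N" for m
  proof -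
    have "{s\<in>space N. \<forall>k<n. s k \<le> q k m} \<in> sets N" by measurable
    then show ?thesis by (simp add: space_N)
  qed
  have L: "{s. \<forall>k<n. s k < t k} \<in> sets N"
  proof -
    have "{s\<in>space N. \<forall>k<n. s k < t k} \<in> sets N" by measurable
    then show ?thesis by (simp add: space_N)
  qed
  have incA: "incseq ?A"
  proof (rule incseq_SucI, safe)
    fix m s k assume "\<forall>k<n. s k \<le> q k m" "k < n"
    then show "s k \<le> q k (Suc m)" using incseq_SucD[OF q1(1), of k m] by force
  qed
  have "AE s in N. s \<in> {s. \<forall>k<n. s k < t k} \<longleftrightarrow> s \<in> (\<Union>m. ?A m)"
    using Om
  proof (rule AE_mp, intro AE_I2 impI)
    fix s assume s: "s \<in> Omega"
    show "s \<in> {s. \<forall>k<n. s k < t k} \<longleftrightarrow> s \<in> (\<Union>m. ?A m)"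
    proof
      assume a: "s \<in> {s. \<forall>k<n. s k < t k}"
      have "\<exists>m. s k \<le> q k m" if k: "k < n" for k
      proof -
        have sk: "s k < t k" "0 \<le> s k" "s k \<le> 1" using a k s by (auto simp: Omega_eq Pi_iff)
        obtain p where "p \<in> rat01" "s k \<le> p" "p < t k"
        proof (cases "s k < 1")
          case True
          then show ?thesis using rat01_between[of "s k" "t k"] sk that by auto
        next
          case False
          then show ?thesis using sk that[of 1] one_in_rat01 by auto
        qed
        then show ?thesis using q1(4)[OF k] by (meson order_trans)
      qed
      then obtain m where m: "\<And>k. k < n \<Longrightarrow> s k \<le> q k (m k)" by metis
      \<comment> \<open>A common index for all coordinates; the added 0 keeps the maximum defined
        when \<open>n = 0\<close>.\<close>
      let ?m = "Max (m ` {..<n} \<union> {0})"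
      have "s k \<le> q k ?m" if k: "k < n" for k
      proof -
        have "m k \<le> ?m" using k by (intro Max_ge) auto
        then show ?thesis using incseqD[OF q1(1)[OF k]] m[OF k] by (meson order_trans)
      qed
      then show "s \<in> (\<Union>m. ?A m)" by blast
    next
      assume "s \<in> (\<Union>m. ?A m)"
      then show "s \<in> {s. \<forall>k<n. s k < t k}" using q1(3) by (auto intro: le_less_trans)
    qed
  qed
  then have "emeasure N {s. \<forall>k<n. s k < t k} = emeasure N (\<Union>m. ?A m)"
    by (rule emeasure_eq_AE) (use L A in auto)
  also have "\<dots> = (SUP m. emeasure N (?A m))"
    using SUP_emeasure_incseq[of ?A N] incA A by (simp add: image_subset_iff)
  also have "\<dots> = (SUP m. \<integral>\<^sup>+s. (\<Prod>k<n. lim_cdf s (q k m)) \<partial>N)"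
    by (simp add: de_Finetti_cdf)
  also have "\<dots> = (\<integral>\<^sup>+s. (SUP m. \<Prod>k<n. lim_cdf s (q k m)) \<partial>N)"
  proof (rule nn_integral_monotone_convergence_SUP[symmetric])
    show "incseq (\<lambda>m s. \<Prod>k<n. lim_cdf s (q k m))"
      by (intro incseq_SucI le_funI incP) simp
    show "(\<lambda>s. \<Prod>k<n. lim_cdf s (q k m)) \<in> borel_measurable N" for m
      by (intro borel_measurable_prod_ennreal lim_cdf_measurable component_measurable)
  qed
  also have "\<dots> = (\<integral>\<^sup>+s. (\<Prod>k<n. emeasure unif {u\<in>{0..1}. quant (lim_cdf s) u < t k}) \<partial>N)"
  proof (rule nn_integral_cong_AE, rule AE_mp[OF Om], intro AE_I2 impI)
    fix s assume s: "s \<in> Omega"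
    \<comment> \<open>Suprema of increasing sequences are limits, and limits commute with finite
      products of finite values, so the supremum passes into the product.\<close>
    have "(SUP m. \<Prod>k<j. lim_cdf s (q k m)) = (\<Prod>k<j. SUP m. lim_cdf s (q k m))" if "j \<le> n" for j
    proof -
      have "(\<lambda>m. \<Prod>k<j. lim_cdf s (q k m)) \<longlonglongrightarrow> (\<Prod>k<j. SUP m. lim_cdf s (q k m))"
        using that
      proof (induction j)
        case (Suc j)
        have "(\<lambda>m. lim_cdf s (q j m)) \<longlonglongrightarrow> (SUP m. lim_cdf s (q j m))"
          using Suc.prems incseq_SucD[OF q1(1), of j]
          by (intro LIMSEQ_SUP incseq_SucI monoD[OF lim_cdf_mono]) auto
        moreover have "(SUP m. lim_cdf s (q k m)) \<noteq> top" for k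
        proof -
          have "(SUP m. lim_cdf s (q k m)) \<le> 1" by (rule SUP_least) (rule lim_cdf_le_1)
          then show ?thesis using ennreal_one_less_top by (metis leD)
        qed
        moreover from this have "(\<Prod>k<j. SUP m. lim_cdf s (q k m)) \<noteq> top"
          by (simp add: ennreal_prod_eq_top)
        ultimately show ?case using Suc
          unfolding prod.lessThan_Suc by (intro tendsto_mult_ennreal) auto
      qed simp
      moreover have "incseq (\<lambda>m. \<Prod>k<j. lim_cdf s (q k m))"
        using that by (intro incseq_SucI incP)
      ultimately show ?thesis using LIMSEQ_unique[OF LIMSEQ_SUP] by blast
    qed
    then have "(SUP m. \<Prod>k<n. lim_cdf s (q k m)) = (\<Prod>k<n. SUP m. lim_cdf s (q k m))" by simp
    also have "\<dots> = (\<Prod>k<n. emeasure unif {u\<in>{0..1}. quant (lim_cdf s) u < t k})"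
    proof (rule prod.cong[OF refl])
      fix k assume "k \<in> {..<n}"
      then have k: "k < n" by simp
      show "(SUP m. lim_cdf s (q k m)) = emeasure unif {u\<in>{0..1}. quant (lim_cdf s) u < t k}"
        by (rule emeasure_quant_less[OF lim_cdf_mono lim_cdf_1[OF s] lim_cdf_le_1
              q1(1)[OF k] q1(2)[OF k] q1(3)[OF k] q1(4)[OF k], symmetric])
    qed
    finally show "(SUP m. \<Prod>k<n. lim_cdf s (q k m))
      = (\<Prod>k<n. emeasure unif {u\<in>{0..1}. quant (lim_cdf s) u < t k})" .
  qed
  finally show ?thesis .
qed

end

section \<open>Laws on quasi-universal spaces\<close>

lemma measurable_um_borelI:
  assumes "\<And>k. (\<lambda>\<omega>. f \<omega> k) \<in> borel_measurable Omega_um" "\<And>\<omega>. \<omega> \<in> Omega \<Longrightarrow> f \<omega> \<in> Omega"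
  shows "f \<in> Omega_um \<rightarrow>\<^sub>M Omega_borel"
  by (rule measurable_Omega_borelI) (use assms in auto)

lemma restrict_Omega_maps:
  "f \<in> Omega_um \<rightarrow>\<^sub>M Omega_borel \<Longrightarrow> (\<lambda>\<omega>\<in>Omega. f \<omega>) \<in> Omega_maps"
  unfolding Omega_maps_def using measurable_um_um[of f] restrict_measurable_Omega_um[of f] by auto

lemma Omega_mapsD:
  assumes "a \<in> Omega_maps"
  shows "a \<in> Omega_um \<rightarrow>\<^sub>M Omega_borel" "\<omega> \<in> Omega \<Longrightarrow> a \<omega> \<in> Omega" "a \<in> extensional Omega"
  using assms Omega_maps_funcset[OF assms] measurable_um_iff by (auto simp: Omega_maps_def)

lemma rvsD:
  assumes "quasi_universal X" "f \<in> rvs X"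
  shows "\<omega> \<in> Omega \<Longrightarrow> f \<omega> \<in> points X" "f \<in> extensional Omega"
  using assms by (auto simp: quasi_universal_def PiE_iff subset_iff)

lemma rvs_comp:
  assumes "quasi_universal X" "f \<in> rvs X" "a \<in> Omega_um \<rightarrow>\<^sub>M Omega_borel"
  shows "(\<lambda>\<omega>\<in>Omega. f (a \<omega>)) \<in> rvs X"
proof -
  have "compose Omega f (\<lambda>\<omega>\<in>Omega. a \<omega>) \<in> rvs X"
    using assms restrict_Omega_maps[OF assms(3)] by (auto simp: quasi_universal_def)
  also have "compose Omega f (\<lambda>\<omega>\<in>Omega. a \<omega>) = (\<lambda>\<omega>\<in>Omega. f (a \<omega>))"
    by (auto simp: compose_def)
  finally show ?thesis .
qed

lemma rvs_const: "quasi_universal X \<Longrightarrow> x \<in> points X \<Longrightarrow> (\<lambda>\<omega>\<in>Omega. x) \<in> rvs X"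
  by (auto simp: quasi_universal_def)

lemma rvs_preimage:
  assumes "f \<in> rvs X" "A \<in> induced_sets X"
  shows "{\<omega>\<in>Omega. f \<omega> \<in> A} \<in> sets Omega_um"
proof -
  have "{\<omega>\<in>Omega. f \<omega> \<in> A} = f -` A \<inter> Omega" by auto
  then show ?thesis using assms by (auto simp: induced_sets_def sets_Omega_um)
qed

lemma rvs_measurable:
  assumes "quasi_universal X" "f \<in> rvs X" shows "f \<in> Omega_um \<rightarrow>\<^sub>M induced_space X"
proof (rule measurableI)
  fix A assume "A \<in> sets (induced_space X)"
  then have "A \<in> induced_sets X" by (simp add: sets_induced_space assms(1))
  then show "f -` A \<inter> space Omega_um \<in> sets Omega_um"
    using assms by (auto simp: induced_sets_def sets_Omega_um)
qed (use assms rvsD in \<open>auto simp: space_induced_space\<close>)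

text \<open>The induced sigma-algebra is the final one for the admissible random variables, so
  measurability out of it is tested along each of them.\<close>

lemma induced_measurableI:
  assumes X: "quasi_universal X" and g: "\<And>f. f \<in> rvs X \<Longrightarrow> (\<lambda>\<omega>. g (f \<omega>)) \<in> Omega_um \<rightarrow>\<^sub>M M"
    and sp: "\<And>x. x \<in> points X \<Longrightarrow> g x \<in> space M"
  shows "g \<in> induced_space X \<rightarrow>\<^sub>M M"
proof (rule measurableI)
  fix A assume A: "A \<in> sets M"
  have "f -` (g -` A \<inter> points X) \<inter> Omega \<in> universally_measurable" if f: "f \<in> rvs X" for f
  proof -
    have "f -` (g -` A \<inter> points X) \<inter> Omega = (\<lambda>\<omega>. g (f \<omega>)) -` A \<inter> space Omega_um"
      using rvsD(1)[OF X f] by auto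
    then show ?thesis using measurable_sets[OF g[OF f] A] by (simp add: sets_Omega_um)
  qed
  then show "g -` A \<inter> space (induced_space X) \<in> sets (induced_space X)"
    by (auto simp: space_induced_space sets_induced_space X induced_sets_def)
qed (use sp in \<open>auto simp: space_induced_space X\<close>)

lemma induced_measurable_quasi:
  assumes X: "quasi_universal X" and Y: "quasi_universal Y" and g: "g \<in> quasi_measurable X Y"
  shows "g \<in> induced_space X \<rightarrow>\<^sub>M induced_space Y"
proof (rule induced_measurableI[OF X])
  fix f assume f: "f \<in> rvs X"
  then have "compose Omega g f \<in> rvs Y" using g by (auto simp: quasi_measurable_def)
  from rvs_measurable[OF Y this] show "(\<lambda>\<omega>. g (f \<omega>)) \<in> Omega_um \<rightarrow>\<^sub>M induced_space Y"
    unfolding compose_def restrict_measurable_Omega_um .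
qed (use g in \<open>auto simp: space_induced_space Y quasi_measurable_def\<close>)

lemma induced_setsI:
  assumes "A \<subseteq> points X" "\<And>f. f \<in> rvs X \<Longrightarrow> {\<omega>\<in>Omega. f \<omega> \<in> A} \<in> sets Omega_um"
  shows "A \<in> induced_sets X"
proof -
  have "f -` A \<inter> Omega = {\<omega>\<in>Omega. f \<omega> \<in> A}" for f by auto
  then show ?thesis using assms by (auto simp: induced_sets_def sets_Omega_um)
qed

lemma emeasure_law:
  assumes X: "quasi_universal X" and "P \<in> Omega_probs" "f \<in> rvs X" "A \<in> induced_sets X"
  shows "emeasure (distr P (induced_space X) f) A = emeasure P {\<omega>\<in>Omega. f \<omega> \<in> A}"
proof -
  have "f -` A \<inter> space P = {\<omega>\<in>Omega. f \<omega> \<in> A}" using Omega_probsD(3)[OF assms(2)] by auto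
  then show ?thesis
    using emeasure_distr[of f P "induced_space X" A] rvs_measurable[OF X assms(3)] assms
    by (simp add: measurable_Omega_probs sets_induced_space)
qed

section \<open>Laws as push-forwards and criteria for their equality\<close>

lemma law_in: "P \<in> Omega_probs \<Longrightarrow> f \<in> rvs X \<Longrightarrow> distr P (induced_space X) f \<in> points (prob_qus X)"
  by (auto simp: prob_qus_def)

lemma points_probE:
  assumes "\<mu> \<in> points (prob_qus X)"
  obtains P f where "P \<in> Omega_probs" "f \<in> rvs X" "\<mu> = distr P (induced_space X) f"
  using assms by (auto simp: prob_qus_def)

lemma points_probD:
  assumes "quasi_universal X" "\<mu> \<in> points (prob_qus X)"
  shows "prob_space \<mu>" "sets \<mu> = induced_sets X" "space \<mu> = points X"
    "measurable \<mu> N = measurable (induced_space X) N"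
proof -
  from assms(2) obtain P f where P: "P \<in> Omega_probs" "f \<in> rvs X" and \<mu>: "\<mu> = distr P (induced_space X) f"
    by (rule points_probE)
  show "prob_space \<mu>" unfolding \<mu>
    by (rule prob_space.prob_space_distr[OF Omega_probsD(1)[OF P(1)]])
      (simp add: measurable_Omega_probs P rvs_measurable assms(1))
  show "sets \<mu> = induced_sets X" "space \<mu> = points X"
    by (simp_all add: \<mu> sets_induced_space space_induced_space assms(1))
  show "measurable \<mu> N = measurable (induced_space X) N" by (simp add: \<mu>)
qed

lemma law_cong: "P \<in> Omega_probs \<Longrightarrow> (\<And>\<omega>. \<omega> \<in> Omega \<Longrightarrow> f \<omega> = g \<omega>) \<Longrightarrow> distr P N f = distr P N g"
  by (rule distr_cong) (auto dest: Omega_probsD)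

lemma law_map:
  assumes "quasi_universal X" "quasi_universal Y" "g \<in> quasi_measurable X Y" "P \<in> Omega_probs" "f \<in> rvs X"
  shows "distr (distr P (induced_space X) f) (induced_space Y) g = distr P (induced_space Y) (compose Omega g f)"
proof -
  have "distr (distr P (induced_space X) f) (induced_space Y) g = distr P (induced_space Y) (g \<circ> f)"
    using assms by (intro distr_distr) (auto simp: measurable_Omega_probs rvs_measurable induced_measurable_quasi)
  also have "\<dots> = distr P (induced_space Y) (compose Omega g f)"
    by (rule law_cong[OF assms(4)]) (simp add: compose_def)
  finally show ?thesis .
qed

text \<open>Both laws are push-forwards along the same admissible \<open>r\<close>. Agreement on
  strict cylinders gives equal Borel laws of \<open>H\<close> and \<open>H'\<close>, hence equal
  universal laws, and \<open>r\<close> carries that equality to all induced sets at once.\<close>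

lemma law_eqI:
  assumes X: "quasi_universal X" and r: "(\<lambda>\<omega>\<in>Omega. r \<omega>) \<in> rvs X"
    and "P \<in> Omega_probs" "P' \<in> Omega_probs"
    and H: "H \<in> Omega_um \<rightarrow>\<^sub>M Omega_borel" and H': "H' \<in> Omega_um \<rightarrow>\<^sub>M Omega_borel"
    and eq: "\<And>n t. emeasure P {\<omega>\<in>Omega. \<forall>k<n. H \<omega> k < t k} = emeasure P' {\<omega>\<in>Omega. \<forall>k<n. H' \<omega> k < (t k :: real)}"
  shows "distr P (induced_space X) (\<lambda>\<omega>\<in>Omega. r (H \<omega>)) = distr P' (induced_space X) (\<lambda>\<omega>\<in>Omega. r (H' \<omega>))"
proof -
  have e: "emeasure (distr P Omega_borel H) {\<omega>\<in>Omega. \<forall>k<n. \<omega> k < t k} = emeasure P {\<omega>\<in>Omega. \<forall>k<n. H \<omega> k < t k}"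
    if "P \<in> Omega_probs" and H: "H \<in> Omega_um \<rightarrow>\<^sub>M Omega_borel" for P H n and t :: "nat \<Rightarrow> real"
  proof -
    have HO: "H \<omega> \<in> Omega" if "\<omega> \<in> Omega" for \<omega>
      using measurable_space[OF H, of \<omega>] that by (simp add: space_Omega_borel)
    have "H -` {\<omega>\<in>Omega. \<forall>k<n. \<omega> k < t k} \<inter> space P = {\<omega>\<in>Omega. \<forall>k<n. H \<omega> k < t k}"
      unfolding Omega_probsD(3)[OF that(1)] using HO by blast
    moreover have "H \<in> P \<rightarrow>\<^sub>M Omega_borel" using H that(1) by (simp add: measurable_Omega_probs)
    ultimately show ?thesis using emeasure_distr[of H P Omega_borel, OF _ sets_cylinder] by simp
  qed
  have "distr P Omega_borel H = distr P' Omega_borel H'"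
  proof (rule borel_probs_eqI)
    show "distr P Omega_borel H \<in> borel_probs" "distr P' Omega_borel H' \<in> borel_probs"
      by (intro distr_um_borel_in assms)+
    show "emeasure (distr P Omega_borel H) {\<omega>\<in>Omega. \<forall>k<n. \<omega> k < t k}
        = emeasure (distr P' Omega_borel H') {\<omega>\<in>Omega. \<forall>k<n. \<omega> k < t k}" for n t
      unfolding e[OF assms(3) H] e[OF assms(4) H'] by (rule eq)
  qed
  then have um: "distr P Omega_um H = distr P' Omega_um H'"
    by (intro distr_um_eqI assms)
  have *: "distr P (induced_space X) (\<lambda>\<omega>\<in>Omega. r (H \<omega>)) = distr (distr P Omega_um H) (induced_space X) (\<lambda>\<omega>\<in>Omega. r \<omega>)"
    if P: "P \<in> Omega_probs" and H: "H \<in> Omega_um \<rightarrow>\<^sub>M Omega_borel" for P H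
  proof -
    have "distr (distr P Omega_um H) (induced_space X) (\<lambda>\<omega>\<in>Omega. r \<omega>) = distr P (induced_space X) ((\<lambda>\<omega>\<in>Omega. r \<omega>) \<circ> H)"
      using P measurable_um_um[OF H] by (intro distr_distr) (auto simp: measurable_Omega_probs rvs_measurable[OF X r])
    also have "\<dots> = distr P (induced_space X) (\<lambda>\<omega>\<in>Omega. r (H \<omega>))"
      by (rule law_cong[OF P]) (use measurable_space[OF H] in \<open>auto simp: space_Omega_borel\<close>)
    finally show ?thesis by simp
  qed
  show ?thesis using um *[OF assms(3) H] *[OF assms(4) H'] by simp
qed

text \<open>Matching the set function with an existing measure settles its countable additivity, so
  values defined through \<open>measure_of\<close>, as in \<open>power_measure\<close> and
  \<open>kernel_comp\<close>, are identified by computing on single sets.\<close>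

lemma measure_of_eqI:
  assumes "quasi_universal X" "sets \<nu> = induced_sets X" "\<And>A. A \<in> induced_sets X \<Longrightarrow> \<phi> A = emeasure \<nu> A"
  shows "measure_of (points X) (induced_sets X) \<phi> = \<nu>"
proof -
  have sp: "space \<nu> = points X"
    using sets_eq_imp_space_eq[of \<nu> "induced_space X"] assms by (simp add: sets_induced_space space_induced_space)
  have sub: "induced_sets X \<subseteq> Pow (points X)" by (auto simp: induced_sets_def)
  have ss: "sigma_sets (points X) (induced_sets X) = induced_sets X"
    by (rule sigma_algebra.sigma_sets_eq[OF sigma_algebra_induced_sets[OF assms(1)]])
  have "measure_of (points X) (induced_sets X) \<phi> = measure_of (points X) (induced_sets X) (emeasure \<nu>)"
    by (rule measure_of_eq[OF sub]) (simp add: ss assms(3))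
  also have "\<dots> = \<nu>" using measure_of_of_measure[of \<nu>] sp assms(2) by simp
  finally show ?thesis .
qed

lemma product_rvsI:
  assumes "\<And>i. i \<in> I \<Longrightarrow> (\<lambda>\<omega>\<in>Omega. f \<omega> i) \<in> rvs (X i)" "\<And>i. i \<in> I \<Longrightarrow> quasi_universal (X i)"
    "\<And>\<omega>. \<omega> \<in> Omega \<Longrightarrow> f \<omega> \<in> extensional I"
  shows "(\<lambda>\<omega>\<in>Omega. f \<omega>) \<in> rvs (product_qus I X)"
proof -
  have "f \<omega> i \<in> points (X i)" if "i \<in> I" "\<omega> \<in> Omega" for i \<omega>
    using rvsD(1)[OF assms(2)[OF that(1)] assms(1)[OF that(1)] that(2)] that by simp
  moreover have "(\<lambda>\<omega>\<in>Omega. (\<lambda>\<omega>\<in>Omega. f \<omega>) \<omega> i) = (\<lambda>\<omega>\<in>Omega. f \<omega> i)" for i by auto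
  ultimately show ?thesis using assms by (auto simp: product_qus_def PiE_iff simp del: restrict_apply)
      (auto simp: PiE_iff)
qed

lemma product_rvsD:
  assumes "f \<in> rvs (product_qus I X)"
  shows "i \<in> I \<Longrightarrow> (\<lambda>\<omega>\<in>Omega. f \<omega> i) \<in> rvs (X i)" "\<omega> \<in> Omega \<Longrightarrow> f \<omega> \<in> extensional I"
    "f \<in> extensional Omega"
  using assms by (auto simp: product_qus_def PiE_iff)

text \<open>Even and odd coordinates identify pairs of sample points with single ones, so
  independent pairs and variables of two parameters can be handled on \<open>Omega\<close>
  itself.\<close>

definition dfst :: "(nat \<Rightarrow> real) \<Rightarrow> nat \<Rightarrow> real" where "dfst \<omega> k = \<omega> (2 * k)"
definition dsnd :: "(nat \<Rightarrow> real) \<Rightarrow> nat \<Rightarrow> real" where "dsnd \<omega> k = \<omega> (2 * k + 1)"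
definition djoin :: "(nat \<Rightarrow> real) \<Rightarrow> (nat \<Rightarrow> real) \<Rightarrow> nat \<Rightarrow> real" where
  "djoin \<omega> \<omega>' k = (if even k then \<omega> (k div 2) else \<omega>' (k div 2))"

lemma dfst_djoin [simp]: "dfst (djoin \<omega> \<omega>') = \<omega>" and dsnd_djoin [simp]: "dsnd (djoin \<omega> \<omega>') = \<omega>'"
  by (auto simp: dfst_def dsnd_def djoin_def)

lemma djoin_in: "\<omega> \<in> Omega \<Longrightarrow> \<omega>' \<in> Omega \<Longrightarrow> djoin \<omega> \<omega>' \<in> Omega"
  by (auto simp: Omega_eq djoin_def Pi_iff)

lemma dfst_measurable: "dfst \<in> Omega_um \<rightarrow>\<^sub>M Omega_borel" and dsnd_measurable: "dsnd \<in> Omega_um \<rightarrow>\<^sub>M Omega_borel"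
  by (rule measurable_um_borelI; auto simp: dfst_def dsnd_def Omega_eq intro: measurable_Omega_um_component)+

lemma djoin_measurable: "case_prod djoin \<in> Omega_borel \<Otimes>\<^sub>M Omega_borel \<rightarrow>\<^sub>M Omega_borel"
proof (rule measurable_Omega_borelI)
  fix k
  have "(\<lambda>x. fst x (k div 2)) \<in> borel_measurable (Omega_borel \<Otimes>\<^sub>M Omega_borel)"
    "(\<lambda>x. snd x (k div 2)) \<in> borel_measurable (Omega_borel \<Otimes>\<^sub>M Omega_borel)"
    by (rule measurable_compose[OF measurable_fst measurable_Omega_borel_component],
        rule measurable_compose[OF measurable_snd measurable_Omega_borel_component])
  then show "(\<lambda>x. (case x of (\<omega>, \<omega>') \<Rightarrow> djoin \<omega> \<omega>') k) \<in> borel_measurable (Omega_borel \<Otimes>\<^sub>M Omega_borel)"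
    by (cases "even k") (simp_all add: djoin_def split_beta')
qed (auto simp: space_pair_measure space_Omega_borel djoin_in)

text \<open>The product is formed on Borel parts, joined, and only then extended, so that it
  measures every universally measurable set of joined points, as in
  \<open>um_section_integral\<close>.\<close>

definition pair_law :: "(nat \<Rightarrow> real) measure \<Rightarrow> (nat \<Rightarrow> real) measure \<Rightarrow> (nat \<Rightarrow> real) measure" where
  "pair_law R P = um_ext (distr (borel_part R \<Otimes>\<^sub>M borel_part P) Omega_borel (case_prod djoin))"

lemma pair_law_in:
  assumes "R \<in> Omega_probs" "P \<in> Omega_probs" shows "pair_law R P \<in> Omega_probs"
  unfolding pair_law_def
proof (rule um_ext_in)
  have R: "borel_part R \<in> borel_probs" "borel_part P \<in> borel_probs" using assms borel_part_in by auto
  interpret R: prob_space "borel_part R" by (rule borel_probsD(1)[OF R(1)])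
  interpret P: prob_space "borel_part P" by (rule borel_probsD(1)[OF R(2)])
  interpret RP: pair_prob_space "borel_part R" "borel_part P" ..
  have "sets (borel_part R \<Otimes>\<^sub>M borel_part P) = sets (Omega_borel \<Otimes>\<^sub>M Omega_borel)"
    by (intro sets_pair_measure_cong borel_probsD R)
  then have "case_prod djoin \<in> borel_part R \<Otimes>\<^sub>M borel_part P \<rightarrow>\<^sub>M Omega_borel"
    using djoin_measurable measurable_cong_sets by blast
  from RP.prob_space_distr[OF this]
  show "distr (borel_part R \<Otimes>\<^sub>M borel_part P) Omega_borel (case_prod djoin) \<in> borel_probs"
    by (simp add: borel_probs_def)
qed

section \<open>Variables of two parameters and mixtures of laws\<close>

lemma double_rvsI:
  assumes "\<And>\<omega>. \<omega> \<in> Omega \<Longrightarrow> F \<omega> \<in> rvs X" "quasi_universal X"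
    "\<And>a b. a \<in> Omega_um \<rightarrow>\<^sub>M Omega_borel \<Longrightarrow> b \<in> Omega_um \<rightarrow>\<^sub>M Omega_borel \<Longrightarrow> (\<lambda>\<omega>\<in>Omega. F (a \<omega>) (b \<omega>)) \<in> rvs X"
  shows "(\<lambda>\<omega>\<in>Omega. F \<omega>) \<in> double_rvs X"
proof -
  let ?G = "\<lambda>(\<omega>, \<omega>')\<in>Omega \<times> Omega. (\<lambda>\<omega>\<in>Omega. F \<omega>) \<omega> \<omega>'"
  have "compose Omega ?G (\<lambda>\<omega>\<in>Omega. (a \<omega>, b \<omega>)) \<in> rvs X"
    if ab: "a \<in> Omega_maps" "b \<in> Omega_maps" for a b
  proof -
    have "compose Omega ?G (\<lambda>\<omega>\<in>Omega. (a \<omega>, b \<omega>)) = (\<lambda>\<omega>\<in>Omega. F (a \<omega>) (b \<omega>))"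
      using Omega_mapsD(2)[OF ab(1)] Omega_mapsD(2)[OF ab(2)] by (auto simp: compose_def fun_eq_iff)
    then show ?thesis using assms(3) Omega_mapsD ab by simp
  qed
  moreover have "F \<omega> \<omega>' \<in> points X" if "\<omega> \<in> Omega" "\<omega>' \<in> Omega" for \<omega> \<omega>'
    using rvsD(1)[OF assms(2) assms(1)] that by simp
  ultimately have "?G \<in> quasi_measurable (pair_qus Omega_qus Omega_qus) X"
    unfolding quasi_measurable_def pair_qus_def Omega_qus_def
    by (auto simp del: restrict_apply) (auto simp: PiE_iff)
  moreover have "(\<lambda>\<omega>\<in>Omega. F \<omega>) \<in> Omega \<rightarrow>\<^sub>E rvs X" using assms(1) by auto
  ultimately show ?thesis unfolding double_rvs_def by blast
qed

lemma double_rvsD: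
  assumes "F \<in> double_rvs X"
  shows "\<omega> \<in> Omega \<Longrightarrow> F \<omega> \<in> rvs X"
    "a \<in> Omega_um \<rightarrow>\<^sub>M Omega_borel \<Longrightarrow> b \<in> Omega_um \<rightarrow>\<^sub>M Omega_borel \<Longrightarrow> (\<lambda>\<omega>\<in>Omega. F (a \<omega>) (b \<omega>)) \<in> rvs X"
proof -
  show "\<omega> \<in> Omega \<Longrightarrow> F \<omega> \<in> rvs X" using assms by (auto simp: double_rvs_def PiE_iff)
  assume a: "a \<in> Omega_um \<rightarrow>\<^sub>M Omega_borel" and b: "b \<in> Omega_um \<rightarrow>\<^sub>M Omega_borel"
  let ?G = "\<lambda>(\<omega>, \<omega>')\<in>Omega \<times> Omega. F \<omega> \<omega>'"
  have "?G \<in> quasi_measurable (pair_qus Omega_qus Omega_qus) X" using assms by (auto simp: double_rvs_def)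
  moreover have "(\<lambda>\<omega>\<in>Omega. ((\<lambda>\<omega>\<in>Omega. a \<omega>) \<omega>, (\<lambda>\<omega>\<in>Omega. b \<omega>) \<omega>)) \<in> rvs (pair_qus Omega_qus Omega_qus)"
    using restrict_Omega_maps[OF a] restrict_Omega_maps[OF b] unfolding pair_qus_def Omega_qus_def qus.simps by blast
  ultimately have "compose Omega ?G (\<lambda>\<omega>\<in>Omega. ((\<lambda>\<omega>\<in>Omega. a \<omega>) \<omega>, (\<lambda>\<omega>\<in>Omega. b \<omega>) \<omega>)) \<in> rvs X"
    unfolding quasi_measurable_def by blast
  also have "compose Omega ?G (\<lambda>\<omega>\<in>Omega. ((\<lambda>\<omega>\<in>Omega. a \<omega>) \<omega>, (\<lambda>\<omega>\<in>Omega. b \<omega>) \<omega>)) = (\<lambda>\<omega>\<in>Omega. F (a \<omega>) (b \<omega>))"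
    using measurable_space[OF a] measurable_space[OF b] by (auto simp: compose_def space_Omega_borel)
  finally show "(\<lambda>\<omega>\<in>Omega. F (a \<omega>) (b \<omega>)) \<in> rvs X" .
qed

lemma prob_rvsI:
  assumes "P \<in> Omega_probs" "F \<in> double_rvs X"
  shows "(\<lambda>\<omega>\<in>Omega. distr P (induced_space X) (F \<omega>)) \<in> rvs (prob_qus X)"
  unfolding prob_qus_def qus.simps mem_Collect_eq using assms by blast

lemma prob_rvsE:
  assumes "h \<in> rvs (prob_qus X)"
  obtains P F where "P \<in> Omega_probs" "F \<in> double_rvs X" "h = (\<lambda>\<omega>\<in>Omega. distr P (induced_space X) (F \<omega>))"
  using assms unfolding prob_qus_def qus.simps mem_Collect_eq by blast

text \<open>Read through \<open>dfst\<close> and \<open>dsnd\<close>, the preimage of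
  \<open>A\<close> is one universally measurable set of joined points, to which the section
  statements apply. In particular a mixture of such laws is the law of a single admissible variable
  under \<open>pair_law R P\<close>.\<close>

lemma
  assumes X: "quasi_universal X" and P: "P \<in> Omega_probs" and F: "F \<in> double_rvs X" and A: "A \<in> induced_sets X"
  shows double_law_measurable:
      "(\<lambda>\<omega>. emeasure (distr P (induced_space X) (F \<omega>)) A) \<in> borel_measurable Omega_um"
    and double_law_integral: "R \<in> Omega_probs \<Longrightarrow>
      (\<integral>\<^sup>+\<omega>. emeasure (distr P (induced_space X) (F \<omega>)) A \<partial>R)
        = emeasure (distr (pair_law R P) (induced_space X) (\<lambda>\<omega>\<in>Omega. F (dfst \<omega>) (dsnd \<omega>))) A"
proof -
  let ?G = "\<lambda>\<omega>\<in>Omega. F (dfst \<omega>) (dsnd \<omega>)"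
  have G: "?G \<in> rvs X" by (rule double_rvsD(2)[OF F dfst_measurable dsnd_measurable])
  let ?D = "{\<omega>\<in>Omega. ?G \<omega> \<in> A}"
  have D: "?D \<in> sets Omega_um" by (rule rvs_preimage[OF G A])
  have eq: "emeasure (distr P (induced_space X) (F \<omega>)) A = emeasure P {\<omega>'\<in>Omega. djoin \<omega> \<omega>' \<in> ?D}"
    if "\<omega> \<in> Omega" for \<omega>
  proof -
    have "{\<omega>'\<in>Omega. djoin \<omega> \<omega>' \<in> ?D} = {\<omega>'\<in>Omega. F \<omega> \<omega>' \<in> A}"
      using djoin_in[OF that] by auto
    then show ?thesis using emeasure_law[OF X P double_rvsD(1)[OF F that] A] by simp
  qed
  show "(\<lambda>\<omega>. emeasure (distr P (induced_space X) (F \<omega>)) A) \<in> borel_measurable Omega_um"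
    using um_section_measurable[OF djoin_measurable P D] eq
    by (subst measurable_cong[of Omega_um]) auto
  show "(\<integral>\<^sup>+\<omega>. emeasure (distr P (induced_space X) (F \<omega>)) A \<partial>R)
        = emeasure (distr (pair_law R P) (induced_space X) ?G) A" if R: "R \<in> Omega_probs"
  proof -
    have "(\<integral>\<^sup>+\<omega>. emeasure (distr P (induced_space X) (F \<omega>)) A \<partial>R)
        = (\<integral>\<^sup>+\<omega>. emeasure P {\<omega>'\<in>Omega. djoin \<omega> \<omega>' \<in> ?D} \<partial>R)"
      by (rule nn_integral_cong) (use eq Omega_probsD(3)[OF R] in auto)
    also have "\<dots> = emeasure (pair_law R P) ?D"
      unfolding pair_law_def by (rule um_section_integral[OF djoin_measurable P D R])
    also have "\<dots> = emeasure (distr (pair_law R P) (induced_space X) ?G) A"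
      by (rule emeasure_law[OF X pair_law_in[OF R P] G A, symmetric])
    finally show ?thesis .
  qed
qed

lemma prob_rv_measurable:
  assumes X: "quasi_universal X" and "h \<in> rvs (prob_qus X)" "A \<in> induced_sets X"
  shows "(\<lambda>\<omega>. emeasure (h \<omega>) A) \<in> borel_measurable Omega_um"
proof -
  from assms(2) obtain P F where P: "P \<in> Omega_probs" "F \<in> double_rvs X" "h = (\<lambda>\<omega>\<in>Omega. distr P (induced_space X) (F \<omega>))"
    by (rule prob_rvsE)
  show ?thesis using double_law_measurable[OF X P(1,2) assms(3)]
    by (subst measurable_cong[of Omega_um]) (auto simp: P(3))
qed

text \<open>Along an admissible variable of \<open>Z\<close> the measure \<open>P\<close> stays
  fixed and only the inner variables are composed with \<open>g\<close>; this keeps the push-forward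
  kernel admissible.\<close>

lemma prob_map:
  assumes X: "quasi_universal X" and Y: "quasi_universal Y" and Z: "quasi_universal Z"
    and g: "g \<in> quasi_measurable X Y" and K: "K \<in> markov_kernels Z X"
  shows "(\<lambda>z\<in>points Z. distr (K z) (induced_space Y) g) \<in> markov_kernels Z Y"
proof -
  let ?L = "\<lambda>z\<in>points Z. distr (K z) (induced_space Y) g"
  have gF: "compose Omega g f \<in> rvs Y" if "f \<in> rvs X" for f using g that by (auto simp: quasi_measurable_def)
  have "?L z \<in> points (prob_qus Y)" if "z \<in> points Z" for z
  proof -
    have "K z \<in> points (prob_qus X)" using K that by (auto simp: markov_kernels_def quasi_measurable_def)
    then obtain P f where P: "P \<in> Omega_probs" "f \<in> rvs X" "K z = distr P (induced_space X) f" by (rule points_probE)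
    then show ?thesis using that law_map[OF X Y g P(1,2)] law_in[OF P(1) gF[OF P(2)]] by simp
  qed
  moreover have "compose Omega ?L f \<in> rvs (prob_qus Y)" if f: "f \<in> rvs Z" for f
  proof -
    have fZ: "f \<omega> \<in> points Z" if "\<omega> \<in> Omega" for \<omega> by (rule rvsD(1)[OF Z f that])
    have "compose Omega K f \<in> rvs (prob_qus X)" using K f by (auto simp: markov_kernels_def quasi_measurable_def)
    then obtain P F where P: "P \<in> Omega_probs" "F \<in> double_rvs X"
      and KF: "compose Omega K f = (\<lambda>\<omega>\<in>Omega. distr P (induced_space X) (F \<omega>))" by (rule prob_rvsE)
    have K_eq: "K (f \<omega>) = distr P (induced_space X) (F \<omega>)" if "\<omega> \<in> Omega" for \<omega>
      using fun_cong[OF KF, of \<omega>] that by (simp add: compose_def)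
    let ?G = "\<lambda>\<omega>\<in>Omega. compose Omega g (F \<omega>)"
    have "?G \<in> double_rvs Y"
    proof (rule double_rvsI[OF _ Y])
      fix a b assume ab: "a \<in> Omega_um \<rightarrow>\<^sub>M Omega_borel" "b \<in> Omega_um \<rightarrow>\<^sub>M Omega_borel"
      have "compose Omega g (\<lambda>\<omega>\<in>Omega. F (a \<omega>) (b \<omega>)) \<in> rvs Y" by (intro gF double_rvsD(2)[OF P(2)] ab)
      also have "compose Omega g (\<lambda>\<omega>\<in>Omega. F (a \<omega>) (b \<omega>)) = (\<lambda>\<omega>\<in>Omega. compose Omega g (F (a \<omega>)) (b \<omega>))"
        using measurable_space[OF ab(2)] by (auto simp: compose_def space_Omega_borel)
      finally show "(\<lambda>\<omega>\<in>Omega. compose Omega g (F (a \<omega>)) (b \<omega>)) \<in> rvs Y" .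
    qed (use gF double_rvsD(1)[OF P(2)] in auto)
    from prob_rvsI[OF P(1) this]
    have "(\<lambda>\<omega>\<in>Omega. distr P (induced_space Y) (?G \<omega>)) \<in> rvs (prob_qus Y)" .
    also have "(\<lambda>\<omega>\<in>Omega. distr P (induced_space Y) (?G \<omega>)) = compose Omega ?L f"
      using fZ K_eq law_map[OF X Y g P(1) double_rvsD(1)[OF P(2)]] by (auto simp: compose_def fun_eq_iff)
    finally show ?thesis .
  qed
  ultimately show ?thesis by (auto simp: markov_kernels_def quasi_measurable_def)
qed

section \<open>Independent sequences in a standard space\<close>

text \<open>The conditions speak of compositions with admissible variables and with universally
  measurable real functions, so \<open>j\<close> may be arbitrary off \<open>points X\<close> and
  \<open>\<rho>\<close> off the unit interval.\<close>

locale unit_retract =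
  fixes X :: "'x qus" and j :: "'x \<Rightarrow> real" and \<rho> :: "real \<Rightarrow> 'x"
  assumes qu: "quasi_universal X"
    and j_rv: "f \<in> rvs X \<Longrightarrow> (\<lambda>\<omega>. j (f \<omega>)) \<in> borel_measurable Omega_um"
    and j_bounds: "x \<in> points X \<Longrightarrow> j x \<in> {0..1}"
    and \<rho>_rv: "h \<in> borel_measurable Omega_um \<Longrightarrow> (\<And>\<omega>. \<omega> \<in> Omega \<Longrightarrow> h \<omega> \<in> {0..1}) \<Longrightarrow>
      (\<lambda>\<omega>\<in>Omega. \<rho> (h \<omega>)) \<in> rvs X"
    and \<rho>_j: "x \<in> points X \<Longrightarrow> \<rho> (j x) = x"

text \<open>The given retraction through \<open>Omega\<close> is composed with
  \<open>Omega_code\<close> and its left inverse \<open>Omega_decode\<close>.\<close>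

lemma ex_unit_retract:
  assumes X: "quasi_universal X" and "standard X" "points X \<noteq> {}"
  shows "\<exists>j \<rho>. unit_retract X j \<rho>"
proof -
  from assms obtain i r where i: "i \<in> quasi_measurable X Omega_qus" and r: "r \<in> quasi_measurable Omega_qus X"
    and ri: "\<And>x. x \<in> points X \<Longrightarrow> r (i x) = x"
    by (auto simp: standard_def)
  have iO: "i x \<in> Omega" if "x \<in> points X" for x
    using i that by (auto simp: quasi_measurable_def Omega_qus_def)
  have "unit_retract X (\<lambda>x. Omega_code (i x)) (\<lambda>t. r (Omega_decode t))"
  proof
    fix f assume f: "f \<in> rvs X"
    have "compose Omega i f \<in> Omega_maps" using i f by (auto simp: quasi_measurable_def Omega_qus_def)
    then have "compose Omega i f \<in> Omega_um \<rightarrow>\<^sub>M Omega_borel" by (rule Omega_mapsD)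
    then have "(\<lambda>\<omega>. i (f \<omega>)) \<in> Omega_um \<rightarrow>\<^sub>M Omega_borel"
      unfolding compose_def restrict_measurable_Omega_um .
    then show "(\<lambda>\<omega>. Omega_code (i (f \<omega>))) \<in> borel_measurable Omega_um"
      by (rule measurable_compose[OF _ Omega_code_measurable])
  next
    fix h :: "(nat \<Rightarrow> real) \<Rightarrow> real" assume h: "h \<in> borel_measurable Omega_um"
    have "(\<lambda>\<omega>\<in>Omega. Omega_decode (h \<omega>)) \<in> Omega_maps"
      by (rule restrict_Omega_maps) (rule measurable_compose[OF h Omega_decode_measurable])
    then have "compose Omega r (\<lambda>\<omega>\<in>Omega. Omega_decode (h \<omega>)) \<in> rvs X"
      using r by (auto simp: quasi_measurable_def Omega_qus_def)
    also have "compose Omega r (\<lambda>\<omega>\<in>Omega. Omega_decode (h \<omega>)) = (\<lambda>\<omega>\<in>Omega. r (Omega_decode (h \<omega>)))"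
      by (auto simp: compose_def)
    finally show "(\<lambda>\<omega>\<in>Omega. r (Omega_decode (h \<omega>))) \<in> rvs X" .
  qed (use X Omega_code_bounds ri iO Omega_decode_code in auto)
  then show ?thesis by blast
qed

context unit_retract
begin

abbreviation "Xn n \<equiv> product_qus {..<n} (\<lambda>_. X)"

lemma qu_product: "quasi_universal (product_qus I (\<lambda>_. X))"
  by (rule quasi_universal_product) (rule qu)

lemma \<rho>_points: assumes "t \<in> {0..1}" shows "\<rho> t \<in> points X"
proof -
  have "(\<lambda>\<omega>\<in>Omega. \<rho> t) \<in> rvs X" by (rule \<rho>_rv) (use assms in auto)
  from rvsD(1)[OF qu this Omega_nonempty] show ?thesis by (simp add: Omega_nonempty)
qed

lemma product_rv:
  assumes "\<And>k. k \<in> I \<Longrightarrow> (\<lambda>\<omega>. H \<omega> k) \<in> borel_measurable Omega_um"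
    "\<And>\<omega> k. \<omega> \<in> Omega \<Longrightarrow> k \<in> I \<Longrightarrow> H \<omega> k \<in> {0..1}"
  shows "(\<lambda>\<omega>\<in>Omega. \<lambda>k\<in>I. \<rho> (H \<omega> k)) \<in> rvs (product_qus I (\<lambda>_. X))"
proof (rule product_rvsI[OF _ qu])
  fix i assume i: "i \<in> I"
  have "(\<lambda>\<omega>\<in>Omega. \<rho> (H \<omega> i)) \<in> rvs X" using assms i by (intro \<rho>_rv) auto
  then show "(\<lambda>\<omega>\<in>Omega. (\<lambda>k\<in>I. \<rho> (H \<omega> k)) i) \<in> rvs X" using i by simp
qed auto

lemma seq_rv:
  assumes "H \<in> Omega_um \<rightarrow>\<^sub>M Omega_borel"
  shows "(\<lambda>\<omega>\<in>Omega. \<lambda>k. \<rho> (H \<omega> k)) \<in> rvs (seq_qus X)"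
proof -
  have H: "H \<omega> \<in> Omega" if "\<omega> \<in> Omega" for \<omega>
    using measurable_space[OF assms, of \<omega>] that by (simp add: space_Omega_borel)
  have "(\<lambda>\<omega>\<in>Omega. \<lambda>k\<in>UNIV. \<rho> (H \<omega> k)) \<in> rvs (seq_qus X)"
  proof (rule product_rv)
    show "(\<lambda>\<omega>. H \<omega> k) \<in> borel_measurable Omega_um" for k
      using measurable_compose[OF assms measurable_Omega_borel_component] .
  qed (use H in \<open>auto simp: Omega_eq Pi_iff\<close>)
  then show ?thesis unfolding restrict_UNIV .
qed

text \<open>An admissible sequence factors as \<open>\<rho>\<close> applied coordinatewise to an
  \<open>Omega\<close>-valued variable. This puts all sequence laws into the shape that
  \<open>seq_law_eqI\<close> compares.\<close>

lemma seq_rv_j: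
  assumes "f \<in> rvs (seq_qus X)"
  shows "(\<lambda>\<omega> k. j (f \<omega> k)) \<in> Omega_um \<rightarrow>\<^sub>M Omega_borel" "f = (\<lambda>\<omega>\<in>Omega. \<lambda>k. \<rho> (j (f \<omega> k)))"
    "\<omega> \<in> Omega \<Longrightarrow> f \<omega> k \<in> points X"
proof -
  have rv: "(\<lambda>\<omega>\<in>Omega. f \<omega> k) \<in> rvs X" for k by (rule product_rvsD(1)[OF assms]) simp
  have p: "f \<omega> k \<in> points X" if "\<omega> \<in> Omega" for \<omega> k using rvsD(1)[OF qu rv that] that by simp
  show "(\<lambda>\<omega> k. j (f \<omega> k)) \<in> Omega_um \<rightarrow>\<^sub>M Omega_borel"
  proof (rule measurable_um_borelI)
    fix k
    show "(\<lambda>\<omega>. j (f \<omega> k)) \<in> borel_measurable Omega_um"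
      using j_rv[OF rv[of k]] by (subst measurable_cong[where g="\<lambda>\<omega>. j ((\<lambda>\<omega>\<in>Omega. f \<omega> k) \<omega>)"]) auto
  qed (use p j_bounds in \<open>auto simp: Omega_eq\<close>)
  show "f = (\<lambda>\<omega>\<in>Omega. \<lambda>k. \<rho> (j (f \<omega> k)))"
  proof
    fix \<omega>
    show "f \<omega> = (\<lambda>\<omega>\<in>Omega. \<lambda>k. \<rho> (j (f \<omega> k))) \<omega>"
    proof (cases "\<omega> \<in> Omega")
      case True
      then show ?thesis using p[OF True] by (simp add: \<rho>_j)
    next
      case False
      then show ?thesis using extensional_arb[OF product_rvsD(3)[OF assms] False] by simp
    qed
  qed
  show "\<omega> \<in> Omega \<Longrightarrow> f \<omega> k \<in> points X" by (rule p)
qed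

lemma seq_law_eqI:
  assumes "P \<in> Omega_probs" "P' \<in> Omega_probs"
    and "H \<in> Omega_um \<rightarrow>\<^sub>M Omega_borel" "H' \<in> Omega_um \<rightarrow>\<^sub>M Omega_borel"
    and "\<And>n t. emeasure P {\<omega>\<in>Omega. \<forall>k<n. H \<omega> k < t k} = emeasure P' {\<omega>\<in>Omega. \<forall>k<n. H' \<omega> k < (t k :: real)}"
  shows "distr P (induced_space (seq_qus X)) (\<lambda>\<omega>\<in>Omega. \<lambda>k. \<rho> (H \<omega> k))
    = distr P' (induced_space (seq_qus X)) (\<lambda>\<omega>\<in>Omega. \<lambda>k. \<rho> (H' \<omega> k))"
proof (rule law_eqI[OF qu_product _ assms, where r="\<lambda>\<omega> k. \<rho> (\<omega> k)"])
  show "(\<lambda>\<omega>\<in>Omega. \<lambda>k. \<rho> (\<omega> k)) \<in> rvs (seq_qus X)"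
    by (rule seq_rv) (rule measurable_ident_um_borel)
qed

text \<open>A real variable enters \<open>law_eqI\<close> as a constant sequence. Its cylinders are
  single strict bounds at the least threshold, or all of \<open>Omega\<close> when
  \<open>n = 0\<close>.\<close>

lemma law_eqI_1:
  assumes "P \<in> Omega_probs" "P' \<in> Omega_probs"
    and g: "g \<in> borel_measurable Omega_um" "\<And>\<omega>. \<omega> \<in> Omega \<Longrightarrow> g \<omega> \<in> {0..1}"
    and g': "g' \<in> borel_measurable Omega_um" "\<And>\<omega>. \<omega> \<in> Omega \<Longrightarrow> g' \<omega> \<in> {0..1}"
    and eq: "\<And>t. emeasure P {\<omega>\<in>Omega. g \<omega> < t} = emeasure P' {\<omega>\<in>Omega. g' \<omega> < t}"
  shows "distr P (induced_space X) (\<lambda>\<omega>\<in>Omega. \<rho> (g \<omega>)) = distr P' (induced_space X) (\<lambda>\<omega>\<in>Omega. \<rho> (g' \<omega>))"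
proof -
  have H: "(\<lambda>\<omega> k. g \<omega>) \<in> Omega_um \<rightarrow>\<^sub>M Omega_borel" if "g \<in> borel_measurable Omega_um" "\<And>\<omega>. \<omega> \<in> Omega \<Longrightarrow> g \<omega> \<in> {0..1}"
    for g :: "(nat \<Rightarrow> real) \<Rightarrow> real"
    by (rule measurable_um_borelI) (use that in \<open>auto simp: Omega_eq\<close>)
  have cyl: "{\<omega>\<in>Omega. \<forall>k<n. g \<omega> < t k} = (if n = 0 then Omega else {\<omega>\<in>Omega. g \<omega> < Min (t ` {..<n})})"
    for g :: "(nat \<Rightarrow> real) \<Rightarrow> real" and n :: nat and t
    by (auto simp: Min_gr_iff lessThan_empty_iff)
  have one: "emeasure P Omega = 1" if "P \<in> Omega_probs" for P
    using prob_space.emeasure_space_1[OF Omega_probsD(1)[OF that]] Omega_probsD(3)[OF that] by simp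
  show ?thesis
  proof (rule law_eqI[OF qu, where r="\<lambda>\<omega>. \<rho> (\<omega> 0)" and H="\<lambda>\<omega> k. g \<omega>" and H'="\<lambda>\<omega> k. g' \<omega>"])
    show "(\<lambda>\<omega>\<in>Omega. \<rho> (\<omega> 0)) \<in> rvs X"
      by (rule \<rho>_rv) (auto simp: Omega_eq Pi_iff intro: measurable_Omega_um_component)
    show "emeasure P {\<omega>\<in>Omega. \<forall>k<n. g \<omega> < t k} = emeasure P' {\<omega>\<in>Omega. \<forall>k<n. g' \<omega> < t k}" for n and t :: "nat \<Rightarrow> real"
      unfolding cyl using one assms by simp
  qed (use H g g' assms in auto)
qed

lemma j_le_induced: "{x\<in>points X. j x \<le> q} \<in> induced_sets X"
proof (rule induced_setsI)
  fix f assume f: "f \<in> rvs X"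
  have "{\<omega>\<in>space Omega_um. j (f \<omega>) \<le> q} \<in> sets Omega_um"
    using j_rv[OF f] by measurable
  then show "{\<omega>\<in>Omega. f \<omega> \<in> {x\<in>points X. j x \<le> q}} \<in> sets Omega_um"
    using rvsD(1)[OF qu f] by (auto cong: conj_cong)
qed auto

section \<open>Distribution functions and the quantile representation of laws\<close>

definition cdf :: "'x measure \<Rightarrow> real \<Rightarrow> ennreal" where
  "cdf \<mu> q = emeasure \<mu> {x\<in>points X. j x \<le> q}"

lemma
  assumes "\<mu> \<in> points (prob_qus X)"
  shows cdf_mono: "mono (cdf \<mu>)" and cdf_le_1: "cdf \<mu> q \<le> 1" and cdf_1: "cdf \<mu> 1 = 1"
proof -
  note \<mu> = points_probD[OF qu assms]
  interpret prob_space \<mu> by (rule \<mu>)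
  show "mono (cdf \<mu>)" unfolding cdf_def
    by (intro monoI emeasure_mono) (auto simp: \<mu>(2) j_le_induced)
  show "cdf \<mu> q \<le> 1" unfolding cdf_def by (rule emeasure_le_1)
  have "{x\<in>points X. j x \<le> 1} = space \<mu>" using j_bounds \<mu>(3) by auto
  then show "cdf \<mu> 1 = 1" unfolding cdf_def using emeasure_space_1 by simp
qed

lemma cdf_law:
  assumes "P \<in> Omega_probs" "f \<in> rvs X"
  shows "cdf (distr P (induced_space X) f) q = emeasure P {\<omega>\<in>Omega. j (f \<omega>) \<le> q}"
  unfolding cdf_def emeasure_law[OF qu assms j_le_induced]
  using rvsD(1)[OF qu assms(2)] by (intro arg_cong[where f="emeasure P"]) auto

lemma cdf_measurable: "h \<in> rvs (prob_qus X) \<Longrightarrow> (\<lambda>\<omega>. cdf (h \<omega>) q) \<in> borel_measurable Omega_um"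
  unfolding cdf_def by (rule prob_rv_measurable[OF qu _ j_le_induced])

lemma quant_u_measurable: "quant F \<in> borel_measurable borel"
  by (rule quant_measurable) simp_all

lemma emeasure_noise_product:
  assumes h: "h \<in> borel_measurable borel"
  shows "emeasure noise {\<omega>\<in>Omega. \<forall>k<n. h (\<omega> k) < (t k :: real)} = (\<Prod>k<n. emeasure unif {u\<in>{0..1}. h u < t k})"
proof -
  have s: "{u\<in>{0..1}. h u < t k} \<in> sets unif" for k
  proof -
    have "{u\<in>space borel. h u < t k} \<in> sets borel" using h by measurable
    then have "{0..1} \<inter> {u. h u < t k} \<in> sets (restrict_space borel {0..1})"
      by (simp add: sets_restrict_space)
    moreover have "{0..1} \<inter> {u. h u < t k} = {u\<in>{0..1}. h u < t k}" by auto
    ultimately show ?thesis by (simp only: sets_unif)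
  qed
  have "{\<omega>\<in>Omega. \<forall>k<n. h (\<omega> k) < t k} = {\<omega>\<in>Omega. \<forall>k<n. \<omega> k \<in> {u\<in>{0..1}. h u < t k}}"
    by (auto simp: Omega_eq Pi_iff)
  then show ?thesis using emeasure_noise_cylinder[of n "\<lambda>k. {u\<in>{0..1}. h u < t k}"] s by simp
qed

text \<open>On strict half-lines both the quantile and \<open>j \<circ> f\<close> have the left
  limit of \<open>cdf \<mu>\<close> as measure; \<open>law_eqI_1\<close> lifts this to all induced
  sets.\<close>

lemma quant_law:
  assumes \<mu>: "\<mu> \<in> points (prob_qus X)"
  shows "distr noise (induced_space X) (\<lambda>\<omega>\<in>Omega. \<rho> (quant (cdf \<mu>) (\<omega> 0))) = \<mu>"
proof -
  from \<mu> obtain P f where P: "P \<in> Omega_probs" "f \<in> rvs X" and \<mu>_eq: "\<mu> = distr P (induced_space X) f"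
    by (rule points_probE)
  interpret P: prob_space P by (rule Omega_probsD(1)[OF P(1)])
  have fX: "f \<omega> \<in> points X" if "\<omega> \<in> Omega" for \<omega> using rvsD(1)[OF qu P(2) that] .
  have f_eq: "f = (\<lambda>\<omega>\<in>Omega. \<rho> (j (f \<omega>)))"
  proof
    show "f \<omega> = (\<lambda>\<omega>\<in>Omega. \<rho> (j (f \<omega>))) \<omega>" for \<omega>
    proof (cases "\<omega> \<in> Omega")
      case True
      then show ?thesis using fX[OF True] by (simp add: \<rho>_j)
    next
      case False
      then show ?thesis using extensional_arb[OF rvsD(2)[OF qu P(2)] False] by simp
    qed
  qed
  have jf: "(\<lambda>\<omega>. j (f \<omega>)) \<in> borel_measurable Omega_um" by (rule j_rv[OF P(2)])
  have sets: "{\<omega>\<in>Omega. j (f \<omega>) \<le> q} \<in> sets P" for q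
  proof -
    have "{\<omega>\<in>space Omega_um. j (f \<omega>) \<le> q} \<in> sets Omega_um" using jf by measurable
    then show ?thesis using Omega_probsD(2)[OF P(1)] by simp
  qed
  have "distr noise (induced_space X) (\<lambda>\<omega>\<in>Omega. \<rho> (quant (cdf \<mu>) (\<omega> 0)))
      = distr P (induced_space X) (\<lambda>\<omega>\<in>Omega. \<rho> (j (f \<omega>)))"
  proof (rule law_eqI_1[OF noise_in P(1) _ _ jf])
    show "(\<lambda>\<omega>. quant (cdf \<mu>) (\<omega> 0)) \<in> borel_measurable Omega_um"
      by (rule measurable_compose[OF measurable_Omega_um_component quant_u_measurable])
    fix t :: real
    have L: "emeasure noise {\<omega>\<in>Omega. quant (cdf \<mu>) (\<omega> 0) < t} = emeasure unif {u\<in>{0..1}. quant (cdf \<mu>) u < t}"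
      using emeasure_noise_product[OF quant_u_measurable, of 1 "cdf \<mu>" "\<lambda>_. t"] by simp
    show "emeasure noise {\<omega>\<in>Omega. quant (cdf \<mu>) (\<omega> 0) < t} = emeasure P {\<omega>\<in>Omega. j (f \<omega>) < t}"
    proof (cases "t \<le> 0")
      case True
      have "\<not> quant (cdf \<mu>) u < t" for u using quant_bounds(1)[of "cdf \<mu>" u] True by linarith
      then have e1: "{u\<in>{0..1}. quant (cdf \<mu>) u < t} = {}" by auto
      have "\<not> j (f \<omega>) < t" if "\<omega> \<in> Omega" for \<omega> using j_bounds[OF fX[OF that]] True by auto
      then have e2: "{\<omega>\<in>Omega. j (f \<omega>) < t} = {}" by auto
      show ?thesis unfolding L e1 e2 by simp
    next
      case False
      then have "0 < t" by simp
      then obtain q where q: "incseq q" "\<And>m::nat. q m \<in> rat01" "\<And>m. q m < t"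
        "\<And>p. p \<in> rat01 \<Longrightarrow> p < t \<Longrightarrow> \<exists>m. p \<le> q m" by (rule rat01_chain) blast
      have "{\<omega>\<in>Omega. j (f \<omega>) < t} = (\<Union>m. {\<omega>\<in>Omega. j (f \<omega>) \<le> q m})"
      proof safe
        fix \<omega> assume w: "\<omega> \<in> Omega" "j (f \<omega>) < t"
        have b: "0 \<le> j (f \<omega>)" "j (f \<omega>) \<le> 1" using j_bounds[OF fX[OF w(1)]] by auto
        obtain p where "p \<in> rat01" "j (f \<omega>) \<le> p" "p < t"
        proof (cases "j (f \<omega>) < 1")
          case True
          then show ?thesis using rat01_between[of "j (f \<omega>)" t] w b \<open>0 < t\<close> that by auto
        next
          case False
          then show ?thesis using w b that[of 1] one_in_rat01 by auto
        qed
        then obtain m where "j (f \<omega>) \<le> q m" using q(4) by (meson order_trans)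
        then show "\<omega> \<in> (\<Union>m. {\<omega>\<in>Omega. j (f \<omega>) \<le> q m})" using w by blast
      next
        fix \<omega> m assume "j (f \<omega>) \<le> q m"
        then show "j (f \<omega>) < t" using q(3) le_less_trans by blast
      qed
      moreover have "incseq (\<lambda>m. {\<omega>\<in>Omega. j (f \<omega>) \<le> q m})"
      proof (rule incseq_SucI)
        fix m
        have "q m \<le> q (Suc m)" by (rule incseq_SucD[OF q(1)])
        then show "{\<omega>\<in>Omega. j (f \<omega>) \<le> q m} \<subseteq> {\<omega>\<in>Omega. j (f \<omega>) \<le> q (Suc m)}" by auto
      qed
      ultimately have "emeasure P {\<omega>\<in>Omega. j (f \<omega>) < t} = (SUP m. emeasure P {\<omega>\<in>Omega. j (f \<omega>) \<le> q m})"
        using SUP_emeasure_incseq[of "\<lambda>m. {\<omega>\<in>Omega. j (f \<omega>) \<le> q m}" P] sets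
        by (simp add: image_subset_iff)
      also have "\<dots> = (SUP m. cdf \<mu> (q m))" by (simp add: \<mu>_eq cdf_law[OF P])
      also have "\<dots> = emeasure unif {u\<in>{0..1}. quant (cdf \<mu>) u < t}"
        by (rule emeasure_quant_less[OF cdf_mono[OF \<mu>] cdf_1[OF \<mu>] cdf_le_1[OF \<mu>] q, symmetric])
      finally show ?thesis unfolding L by simp
    qed
  qed (use quant_bounds j_bounds fX in auto)
  then show ?thesis using f_eq \<mu>_eq by simp
qed

text \<open>The explicit candidate for the values of \<open>iid_kernel\<close>. As
  \<open>quant\<close> always lands in the unit interval, it is a law of an admissible sequence for
  every argument \<open>\<mu>\<close>.\<close>

definition iid_law :: "'x measure \<Rightarrow> (nat \<Rightarrow> 'x) measure" where
  "iid_law \<mu> = distr noise (induced_space (seq_qus X)) (\<lambda>\<omega>\<in>Omega. \<lambda>k. \<rho> (quant (cdf \<mu>) (\<omega> k)))"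

text \<open>Each induction step draws fresh independent noise for coordinate \<open>n\<close>, and
  the iterated integral becomes an integral of sections over two copies of \<open>noise\<close>. The
  transformation \<open>h\<close> is arbitrary because \<open>directing\<close> produces laws from
  \<open>lim_cdf\<close>, which need not be their \<open>cdf\<close>.\<close>

lemma power_measure_law:
  assumes h: "h \<in> borel_measurable borel" "\<And>u. h u \<in> {0..1}"
    and \<mu>: "\<mu> = distr noise (induced_space X) (\<lambda>\<omega>\<in>Omega. \<rho> (h (\<omega> 0)))"
  shows "power_measure X \<mu> n = distr noise (induced_space (Xn n)) (\<lambda>\<omega>\<in>Omega. \<lambda>k\<in>{..<n}. \<rho> (h (\<omega> k)))"
proof (induction n)
  have hc: "(\<lambda>\<omega>. h (a \<omega> k)) \<in> borel_measurable Omega_um" if "a \<in> Omega_um \<rightarrow>\<^sub>M Omega_borel" for a k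
    by (rule measurable_compose[OF measurable_compose[OF that measurable_Omega_borel_component] h(1)])
  let ?f = "\<lambda>n. \<lambda>\<omega>\<in>Omega. \<lambda>k\<in>{..<n}. \<rho> (h (\<omega> k))"
  have f: "?f n \<in> rvs (Xn n)" for n
    by (rule product_rv) (use hc[OF measurable_ident_um_borel] h in auto)
  have f0: "(\<lambda>\<omega>\<in>Omega. \<rho> (h (\<omega> 0))) \<in> rvs X"
    by (rule \<rho>_rv) (use hc[OF measurable_ident_um_borel] h in auto)
  {
    case 0
    have "?f 0 = (\<lambda>\<omega>\<in>Omega. \<lambda>_. undefined)" by (auto simp: fun_eq_iff)
    then have "distr noise (induced_space (Xn 0)) (?f 0) = distr noise (induced_space (Xn 0)) (\<lambda>\<omega>. \<lambda>_. undefined)"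
      using law_cong[OF noise_in, of "?f 0" "\<lambda>\<omega>. \<lambda>_. undefined"] by simp
    also have "\<dots> = return (induced_space (Xn 0)) (\<lambda>_. undefined)"
      by (rule prob_space.distr_const[OF Omega_probsD(1)[OF noise_in]])
        (simp only: space_induced_space[OF qu_product], simp add: product_qus_def)
    finally show ?case by (simp only: power_measure.simps)
  next
    case (Suc n)
    show ?case unfolding power_measure.simps
    proof (rule measure_of_eqI[OF qu_product])
      show "sets (distr noise (induced_space (Xn (Suc n))) (?f (Suc n))) = induced_sets (Xn (Suc n))"
        by (simp add: sets_induced_space[OF qu_product])
    next
      fix A assume A: "A \<in> induced_sets (Xn (Suc n))"
      have upd: "(\<lambda>\<omega>\<in>Omega. (\<phi> \<omega>)(n := g \<omega>)) \<in> rvs (Xn (Suc n))"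
        if \<phi>: "\<And>k. k < n \<Longrightarrow> (\<lambda>\<omega>\<in>Omega. \<phi> \<omega> k) \<in> rvs X" "\<And>\<omega>. \<omega> \<in> Omega \<Longrightarrow> \<phi> \<omega> \<in> extensional {..<n}"
          and g: "(\<lambda>\<omega>\<in>Omega. g \<omega>) \<in> rvs X" for \<phi> :: "(nat \<Rightarrow> real) \<Rightarrow> nat \<Rightarrow> 'x" and g
      proof (rule product_rvsI[OF _ qu])
        fix i assume "i \<in> {..<Suc n}"
        then show "(\<lambda>\<omega>\<in>Omega. ((\<phi> \<omega>)(n := g \<omega>)) i) \<in> rvs X"
          using \<phi>(1)[of i] g by (cases "i = n") auto
      next
        fix \<omega> assume "\<omega> \<in> Omega"
        then show "(\<phi> \<omega>)(n := g \<omega>) \<in> extensional {..<Suc n}"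
          using \<phi>(2) by (auto simp: extensional_def)
      qed
      let ?sec = "\<lambda>x. {y\<in>points X. x(n := y) \<in> A}"
      \<comment> \<open>The inner integral is the noise measure of a section. The section is an
        induced set, since inserting an admissible coordinate into a fixed \<open>x\<close> gives an
        admissible tuple.\<close>
      have inner: "(\<integral>\<^sup>+ y. indicator A (x(n := y)) \<partial>\<mu>) = emeasure noise {\<omega>'\<in>Omega. x(n := \<rho> (h (\<omega>' 0))) \<in> A}"
        if x: "x \<in> points (Xn n)" for x
      proof -
        have secI: "?sec x \<in> induced_sets X"
        proof (rule induced_setsI)
          fix g assume g: "g \<in> rvs X"
          have ge: "(\<lambda>\<omega>\<in>Omega. g \<omega>) \<in> rvs X" using g rvsD(2)[OF qu g] by (simp add: extensional_restrict)
          have "(\<lambda>\<omega>\<in>Omega. x(n := g \<omega>)) \<in> rvs (Xn (Suc n))"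
          proof (rule upd[OF _ _ ge])
            fix k assume "k < n"
            then show "(\<lambda>\<omega>\<in>Omega. x k) \<in> rvs X" using x by (intro rvs_const[OF qu]) (auto simp: product_qus_def)
          qed (use x in \<open>auto simp: product_qus_def PiE_iff\<close>)
          from rvs_preimage[OF this A]
          show "{\<omega>\<in>Omega. g \<omega> \<in> ?sec x} \<in> sets Omega_um"
            using rvsD(1)[OF qu g] by (auto cong: conj_cong)
        qed auto
        have "(\<integral>\<^sup>+ y. indicator A (x(n := y)) \<partial>\<mu>) = (\<integral>\<^sup>+ y. indicator (?sec x) y \<partial>\<mu>)"
          by (rule nn_integral_cong) (auto simp: \<mu> space_induced_space[OF qu] indicator_def)
        also have "\<dots> = emeasure \<mu> (?sec x)"
          by (rule nn_integral_indicator) (simp add: \<mu> sets_induced_space[OF qu] secI)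
        also have "\<dots> = emeasure noise {\<omega>'\<in>Omega. (\<lambda>\<omega>\<in>Omega. \<rho> (h (\<omega> 0))) \<omega>' \<in> ?sec x}"
          unfolding \<mu> by (rule emeasure_law[OF qu noise_in f0 secI])
        also have "{\<omega>'\<in>Omega. (\<lambda>\<omega>\<in>Omega. \<rho> (h (\<omega> 0))) \<omega>' \<in> ?sec x} = {\<omega>'\<in>Omega. x(n := \<rho> (h (\<omega>' 0))) \<in> A}"
          using \<rho>_points[OF h(2)] by auto
        finally show ?thesis .
      qed
      \<comment> \<open>Measurability in \<open>x\<close> is tested along an admissible
        \<open>\<phi>\<close>, with \<open>\<phi>\<close> reading the even coordinates and the new
        noise the odd ones.\<close>
      have gm: "(\<lambda>x. emeasure noise {\<omega>'\<in>Omega. x(n := \<rho> (h (\<omega>' 0))) \<in> A}) \<in> borel_measurable (induced_space (Xn n))"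
      proof (rule induced_measurableI[OF qu_product])
        fix \<phi> assume \<phi>: "\<phi> \<in> rvs (Xn n)"
        let ?\<psi> = "\<lambda>\<omega>\<in>Omega. (\<phi> (dfst \<omega>))(n := \<rho> (h (dsnd \<omega> 0)))"
        have dO: "dfst \<omega> \<in> Omega" if "\<omega> \<in> Omega" for \<omega>
          using measurable_space[OF dfst_measurable, of \<omega>] that by (simp add: space_Omega_borel)
        have "?\<psi> \<in> rvs (Xn (Suc n))"
        proof (rule upd)
          fix k assume k: "k < n"
          have "(\<lambda>\<omega>\<in>Omega. (\<lambda>\<omega>\<in>Omega. \<phi> \<omega> k) (dfst \<omega>)) \<in> rvs X"
            by (rule rvs_comp[OF qu _ dfst_measurable], rule product_rvsD(1)[OF \<phi>]) (use k in simp)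
          also have "(\<lambda>\<omega>\<in>Omega. (\<lambda>\<omega>\<in>Omega. \<phi> \<omega> k) (dfst \<omega>)) = (\<lambda>\<omega>\<in>Omega. \<phi> (dfst \<omega>) k)"
            using dO by auto
          finally show "(\<lambda>\<omega>\<in>Omega. \<phi> (dfst \<omega>) k) \<in> rvs X" .
        next
          show "(\<lambda>\<omega>\<in>Omega. \<rho> (h (dsnd \<omega> 0))) \<in> rvs X"
            by (rule \<rho>_rv) (use hc[OF dsnd_measurable] h in auto)
        qed (use product_rvsD(2)[OF \<phi>] dO in auto)
        from rvs_preimage[OF this A] have D: "{\<omega>\<in>Omega. ?\<psi> \<omega> \<in> A} \<in> sets Omega_um" .
        have "{\<omega>'\<in>Omega. djoin \<omega> \<omega>' \<in> {\<omega>\<in>Omega. ?\<psi> \<omega> \<in> A}} = {\<omega>'\<in>Omega. (\<phi> \<omega>)(n := \<rho> (h (\<omega>' 0))) \<in> A}"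
          if "\<omega> \<in> Omega" for \<omega>
          using djoin_in[OF that] by auto
        then show "(\<lambda>\<omega>. emeasure noise {\<omega>'\<in>Omega. (\<phi> \<omega>)(n := \<rho> (h (\<omega>' 0))) \<in> A}) \<in> borel_measurable Omega_um"
          using um_section_measurable[OF djoin_measurable noise_in D]
          by (subst measurable_cong[where g="\<lambda>\<omega>. emeasure noise {\<omega>'\<in>Omega. djoin \<omega> \<omega>' \<in> {\<omega>\<in>Omega. ?\<psi> \<omega> \<in> A}}"]) auto
      qed simp
      let ?D = "{\<omega>\<in>Omega. ?f (Suc n) \<omega> \<in> A}"
      have D: "?D \<in> sets Omega_um" by (rule rvs_preimage[OF f A])
      \<comment> \<open>\<open>comb_seq n\<close> keeps the first \<open>n\<close> coordinates of
        \<open>\<omega>\<close> and appends \<open>\<omega>'\<close>, so coordinate \<open>n\<close>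
        is \<open>\<omega>' 0\<close>; combining two independent noises in this way yields noise
        again.\<close>
      have comb: "case_prod (comb_seq n) \<in> Omega_borel \<Otimes>\<^sub>M Omega_borel \<rightarrow>\<^sub>M Omega_borel"
        using measurable_comb_seq[of n unif]
        unfolding measurable_cong_sets[OF sets_pair_measure_cong[OF sets_noise_borel sets_noise_borel] sets_noise_borel] .
      have combO: "comb_seq n \<omega> \<omega>' \<in> Omega" if "\<omega> \<in> Omega" "\<omega>' \<in> Omega" for \<omega> \<omega>'
        using measurable_space[OF comb, of "(\<omega>, \<omega>')"] that by (simp add: space_pair_measure space_Omega_borel)
      have "(\<integral>\<^sup>+ x. (\<integral>\<^sup>+ y. indicator A (x(n := y)) \<partial>\<mu>) \<partial>power_measure X \<mu> n)
          = (\<integral>\<^sup>+ x. emeasure noise {\<omega>'\<in>Omega. x(n := \<rho> (h (\<omega>' 0))) \<in> A} \<partial>power_measure X \<mu> n)"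
        unfolding Suc by (rule nn_integral_cong) (simp add: space_induced_space[OF qu_product] inner)
      also have "\<dots> = (\<integral>\<^sup>+ \<omega>. emeasure noise {\<omega>'\<in>Omega. (?f n \<omega>)(n := \<rho> (h (\<omega>' 0))) \<in> A} \<partial>noise)"
        unfolding Suc by (rule nn_integral_distr)
          (use gm in \<open>auto simp: measurable_Omega_probs[OF noise_in] rvs_measurable[OF qu_product f]\<close>)
      also have "\<dots> = (\<integral>\<^sup>+ \<omega>. emeasure noise {\<omega>'\<in>Omega. comb_seq n \<omega> \<omega>' \<in> ?D} \<partial>noise)"
      proof (rule nn_integral_cong)
        fix \<omega> assume "\<omega> \<in> space noise"
        then have w: "\<omega> \<in> Omega" using Omega_probsD(3)[OF noise_in] by simp
        have "(?f n \<omega>)(n := \<rho> (h (\<omega>' 0))) = ?f (Suc n) (comb_seq n \<omega> \<omega>')" if "\<omega>' \<in> Omega" for \<omega>'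
          using w combO[OF w that] by (auto simp: fun_eq_iff comb_seq_def)
        then have "{\<omega>'\<in>Omega. (?f n \<omega>)(n := \<rho> (h (\<omega>' 0))) \<in> A} = {\<omega>'\<in>Omega. comb_seq n \<omega> \<omega>' \<in> ?D}"
          using combO[OF w] by (auto simp del: restrict_apply)
        then show "emeasure noise {\<omega>'\<in>Omega. (?f n \<omega>)(n := \<rho> (h (\<omega>' 0))) \<in> A} = emeasure noise {\<omega>'\<in>Omega. comb_seq n \<omega> \<omega>' \<in> ?D}"
          by (rule arg_cong)
      qed
      also have "\<dots> = emeasure (um_ext (distr (borel_part noise \<Otimes>\<^sub>M borel_part noise) Omega_borel (case_prod (comb_seq n)))) ?D"
        by (rule um_section_integral[OF comb noise_in D noise_in])
      also have "distr (borel_part noise \<Otimes>\<^sub>M borel_part noise) Omega_borel (case_prod (comb_seq n)) = noise_borel"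
      proof -
        have "distr (noise_borel \<Otimes>\<^sub>M noise_borel) Omega_borel (case_prod (comb_seq n))
            = distr (noise_borel \<Otimes>\<^sub>M noise_borel) noise_borel (case_prod (comb_seq n))"
          by (rule distr_cong) (auto simp: sets_noise_borel)
        then show ?thesis using unif_seq.PiM_comb_seq[of n] unfolding borel_part_noise by simp
      qed
      also have "emeasure (um_ext noise_borel) ?D = emeasure (distr noise (induced_space (Xn (Suc n))) (?f (Suc n))) A"
        using emeasure_law[OF qu_product noise_in f A] by (simp add: noise_def)
      finally show "(\<integral>\<^sup>+ x. (\<integral>\<^sup>+ y. indicator A (x(n := y)) \<partial>\<mu>) \<partial>power_measure X \<mu> n)
          = emeasure (distr noise (induced_space (Xn (Suc n))) (?f (Suc n))) A" .
    qed
  }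
qed

section \<open>Uniqueness of laws of sequences\<close>

lemma j_cylinder_induced:
  assumes "{..<n::nat} \<subseteq> I"
  shows "{x\<in>points (product_qus I (\<lambda>_. X)). \<forall>k<n. j (x k) < t k} \<in> induced_sets (product_qus I (\<lambda>_. X))"
proof (rule induced_setsI)
  fix f assume f: "f \<in> rvs (product_qus I (\<lambda>_. X))"
  have m: "(\<lambda>\<omega>. j (f \<omega> k)) \<in> borel_measurable Omega_um" if "k < n" for k
  proof -
    have "(\<lambda>\<omega>\<in>Omega. f \<omega> k) \<in> rvs X" by (rule product_rvsD(1)[OF f]) (use that assms in auto)
    from j_rv[OF this] show ?thesis
      by (subst measurable_cong[where g="\<lambda>\<omega>. j ((\<lambda>\<omega>\<in>Omega. f \<omega> k) \<omega>)"]) auto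
  qed
  have "{\<omega>\<in>space Omega_um. j (f \<omega> k) < t k} \<in> sets Omega_um" if "k < n" for k
    using m[OF that] by measurable
  then have "{\<omega>\<in>space Omega_um. \<forall>k\<in>{..<n}. j (f \<omega> k) < t k} \<in> sets Omega_um"
    by (intro sets.sets_Collect_finite_All) auto
  also have "{\<omega>\<in>space Omega_um. \<forall>k\<in>{..<n}. j (f \<omega> k) < t k}
      = {\<omega>\<in>Omega. f \<omega> \<in> {x\<in>points (product_qus I (\<lambda>_. X)). \<forall>k<n. j (x k) < t k}}"
    using rvsD(1)[OF qu_product f] by auto
  finally show "{\<omega>\<in>Omega. f \<omega> \<in> {x\<in>points (product_qus I (\<lambda>_. X)). \<forall>k<n. j (x k) < t k}} \<in> sets Omega_um" .
qed auto

text \<open>Cylinders in \<open>j\<close> suffice because both laws arise by \<open>\<rho>\<close>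
  from \<open>Omega\<close>-valued variables; the comparison takes place on \<open>Omega\<close>,
  not on the induced sigma-algebra.\<close>

lemma seq_measure_eqI:
  assumes \<mu>: "\<mu> \<in> points (prob_qus (seq_qus X))" and \<nu>: "\<nu> \<in> points (prob_qus (seq_qus X))"
    and eq: "\<And>n t. emeasure \<mu> {x\<in>points (seq_qus X). \<forall>k<n. j (x k) < t k}
        = emeasure \<nu> {x\<in>points (seq_qus X). \<forall>k<n. j (x k) < t k}"
  shows "\<mu> = \<nu>"
proof -
  from \<mu> obtain P f where P: "P \<in> Omega_probs" "f \<in> rvs (seq_qus X)" "\<mu> = distr P (induced_space (seq_qus X)) f"
    by (rule points_probE)
  from \<nu> obtain P' f' where P': "P' \<in> Omega_probs" "f' \<in> rvs (seq_qus X)" "\<nu> = distr P' (induced_space (seq_qus X)) f'"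
    by (rule points_probE)
  have e: "emeasure (distr P (induced_space (seq_qus X)) f) {x\<in>points (seq_qus X). \<forall>k<n. j (x k) < t k}
      = emeasure P {\<omega>\<in>Omega. \<forall>k<n. j (f \<omega> k) < t k}" if "P \<in> Omega_probs" "f \<in> rvs (seq_qus X)" for P f n t
    unfolding emeasure_law[OF qu_product that j_cylinder_induced[OF subset_UNIV]]
    using rvsD(1)[OF qu_product that(2)] by (intro arg_cong[where f="emeasure P"]) auto
  have "distr P (induced_space (seq_qus X)) (\<lambda>\<omega>\<in>Omega. \<lambda>k. \<rho> (j (f \<omega> k)))
      = distr P' (induced_space (seq_qus X)) (\<lambda>\<omega>\<in>Omega. \<lambda>k. \<rho> (j (f' \<omega> k)))"
  proof (rule seq_law_eqI[OF P(1) P'(1) seq_rv_j(1)[OF P(2)] seq_rv_j(1)[OF P'(2)]])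
    show "emeasure P {\<omega>\<in>Omega. \<forall>k<n. j (f \<omega> k) < t k} = emeasure P' {\<omega>\<in>Omega. \<forall>k<n. j (f' \<omega> k) < t k}" for n t
      using eq[of n t] unfolding P(3) P'(3) e[OF P(1,2)] e[OF P'(1,2)] .
  qed
  then show ?thesis unfolding P(3) P'(3) seq_rv_j(2)[OF P(2), symmetric] seq_rv_j(2)[OF P'(2), symmetric] .
qed

lemma restrict_quasi:
  "(\<lambda>x\<in>points (seq_qus X). restrict x {..<n}) \<in> quasi_measurable (seq_qus X) (Xn n)"
  unfolding quasi_measurable_def
proof (intro CollectI conjI ballI)
  show "(\<lambda>x\<in>points (seq_qus X). restrict x {..<n}) \<in> points (seq_qus X) \<rightarrow>\<^sub>E points (Xn n)"
    by (auto simp: product_qus_def restrict_PiE_iff PiE_iff)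
  fix f assume f: "f \<in> rvs (seq_qus X)"
  have "(\<lambda>\<omega>\<in>Omega. restrict (f \<omega>) {..<n}) \<in> rvs (Xn n)"
    by (rule product_rvsI[OF _ qu]) (use product_rvsD(1)[OF f] in auto)
  also have "(\<lambda>\<omega>\<in>Omega. restrict (f \<omega>) {..<n}) = compose Omega (\<lambda>x\<in>points (seq_qus X). restrict x {..<n}) f"
    using rvsD(1)[OF qu_product f] by (auto simp: compose_def)
  finally show "compose Omega (\<lambda>x\<in>points (seq_qus X). restrict x {..<n}) f \<in> rvs (Xn n)" .
qed

lemma perm_quasi:
  "(\<lambda>x\<in>points (seq_qus X). \<lambda>n. x (\<sigma> n)) \<in> quasi_measurable (seq_qus X) (seq_qus X)"
  unfolding quasi_measurable_def
proof (intro CollectI conjI ballI)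
  show "(\<lambda>x\<in>points (seq_qus X). \<lambda>n. x (\<sigma> n)) \<in> points (seq_qus X) \<rightarrow>\<^sub>E points (seq_qus X)"
    by (auto simp: product_qus_def)
  fix f assume f: "f \<in> rvs (seq_qus X)"
  have "(\<lambda>\<omega>\<in>Omega. \<lambda>n. f \<omega> (\<sigma> n)) \<in> rvs (seq_qus X)"
    by (rule product_rvsI[OF _ qu]) (use product_rvsD(1)[OF f] in auto)
  also have "(\<lambda>\<omega>\<in>Omega. \<lambda>n. f \<omega> (\<sigma> n)) = compose Omega (\<lambda>x\<in>points (seq_qus X). \<lambda>n. x (\<sigma> n)) f"
    using rvsD(1)[OF qu_product f] by (auto simp: compose_def)
  finally show "compose Omega (\<lambda>x\<in>points (seq_qus X). \<lambda>n. x (\<sigma> n)) f \<in> rvs (seq_qus X)" .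
qed

lemma distr_restrict_points:
  assumes "quasi_universal Y" "\<mu> \<in> points (prob_qus Y)"
  shows "distr \<mu> N g = distr \<mu> N (\<lambda>x\<in>points Y. g x)"
  by (rule distr_cong) (use points_probD[OF assms] in auto)

text \<open>Supplies the uniqueness behind the definite description in \<open>iid_kernel\<close>.
  Marginals are given for at least one coordinate; the empty cylinder is settled by total
  mass.\<close>

lemma marginals_unique:
  assumes \<mu>: "\<mu> \<in> points (prob_qus (seq_qus X))" and \<nu>: "\<nu> \<in> points (prob_qus (seq_qus X))"
    and eq: "\<And>n. distr \<mu> (induced_space (Xn (Suc n))) (\<lambda>x. restrict x {..<Suc n})
        = distr \<nu> (induced_space (Xn (Suc n))) (\<lambda>x. restrict x {..<Suc n})"
  shows "\<mu> = \<nu>"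
proof (rule seq_measure_eqI[OF \<mu> \<nu>])
  fix n and t :: "nat \<Rightarrow> real"
  let ?C = "{x\<in>points (seq_qus X). \<forall>k<n. j (x k) < t k}"
  show "emeasure \<mu> ?C = emeasure \<nu> ?C"
  proof (cases n)
    case 0
    have "emeasure \<mu> (points (seq_qus X)) = 1" if "\<mu> \<in> points (prob_qus (seq_qus X))" for \<mu>
      using prob_space.emeasure_space_1[OF points_probD(1)[OF qu_product that]] points_probD(3)[OF qu_product that] by simp
    then show ?thesis using 0 \<mu> \<nu> by simp
  next
    case (Suc m)
    let ?A = "{x\<in>points (Xn (Suc m)). \<forall>k<Suc m. j (x k) < t k}"
    have A: "?A \<in> induced_sets (Xn (Suc m))" by (rule j_cylinder_induced) simp
    have *: "emeasure (distr \<mu> (induced_space (Xn (Suc m))) (\<lambda>x. restrict x {..<Suc m})) ?A = emeasure \<mu> ?C"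
      if \<mu>: "\<mu> \<in> points (prob_qus (seq_qus X))" for \<mu>
    proof -
      let ?g = "\<lambda>x\<in>points (seq_qus X). restrict x {..<Suc m}"
      have g: "?g \<in> \<mu> \<rightarrow>\<^sub>M induced_space (Xn (Suc m))"
        unfolding points_probD(4)[OF qu_product \<mu>]
        by (rule induced_measurable_quasi[OF qu_product qu_product restrict_quasi])
      have "?g -` ?A \<inter> space \<mu> = ?C"
        unfolding points_probD(3)[OF qu_product \<mu>] Suc by (auto simp: product_qus_def)
      then show ?thesis
        unfolding distr_restrict_points[OF qu_product \<mu>, of _ "\<lambda>x. restrict x {..<Suc m}"]
        using emeasure_distr[OF g, of ?A] A by (simp add: sets_induced_space[OF qu_product])
    qed
    show ?thesis using *[OF \<mu>] *[OF \<nu>] eq[of m] by simp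
  qed
qed

lemma seq_noise_rv:
  assumes h: "h \<in> borel_measurable borel" "\<And>u. h u \<in> {0..1}"
  shows "(\<lambda>\<omega>\<in>Omega. \<lambda>k. \<rho> (h (\<omega> k))) \<in> rvs (seq_qus X)"
proof (rule seq_rv, rule measurable_um_borelI)
  show "(\<lambda>\<omega>. h (\<omega> k)) \<in> borel_measurable Omega_um" for k
    by (rule measurable_compose[OF measurable_Omega_um_component h(1)])
qed (use h in \<open>auto simp: Omega_eq\<close>)

lemma noise_marginal:
  assumes h: "h \<in> borel_measurable borel" "\<And>u. h u \<in> {0..1}"
    and \<mu>: "\<mu> = distr noise (induced_space X) (\<lambda>\<omega>\<in>Omega. \<rho> (h (\<omega> 0)))"
  shows "distr (distr noise (induced_space (seq_qus X)) (\<lambda>\<omega>\<in>Omega. \<lambda>k. \<rho> (h (\<omega> k))))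
      (induced_space (Xn n)) (\<lambda>x. restrict x {..<n}) = power_measure X \<mu> n"
proof -
  let ?f = "\<lambda>\<omega>\<in>Omega. \<lambda>k. \<rho> (h (\<omega> k))"
  have f: "?f \<in> rvs (seq_qus X)" by (rule seq_noise_rv[OF h])
  have "distr (distr noise (induced_space (seq_qus X)) ?f) (induced_space (Xn n)) (\<lambda>x. restrict x {..<n})
      = distr noise (induced_space (Xn n)) (compose Omega (\<lambda>x\<in>points (seq_qus X). restrict x {..<n}) ?f)"
    unfolding distr_restrict_points[OF qu_product law_in[OF noise_in f], of _ "\<lambda>x. restrict x {..<n}"]
    by (rule law_map[OF qu_product qu_product restrict_quasi noise_in f])
  also have "\<dots> = distr noise (induced_space (Xn n)) (\<lambda>\<omega>\<in>Omega. \<lambda>k\<in>{..<n}. \<rho> (h (\<omega> k)))"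
    by (rule law_cong[OF noise_in]) (use rvsD(1)[OF qu_product f] in \<open>auto simp: compose_def\<close>)
  finally show ?thesis unfolding power_measure_law[OF h \<mu>] .
qed

lemma quant_unit: "quant F u \<in> {0..1}"
  using quant_bounds by auto

lemma iid_law_in: "iid_law \<mu> \<in> points (prob_qus (seq_qus X))"
  unfolding iid_law_def by (intro law_in noise_in seq_noise_rv quant_u_measurable quant_unit)

lemma iid_law_marginal:
  assumes "\<mu> \<in> points (prob_qus X)"
  shows "distr (iid_law \<mu>) (induced_space (Xn n)) (\<lambda>x. restrict x {..<n}) = power_measure X \<mu> n"
  unfolding iid_law_def
  by (rule noise_marginal[OF quant_u_measurable quant_unit quant_law[OF assms, symmetric]])

text \<open>The finite marginals are power measures of \<open>\<mu>\<close> whichever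
  \<open>h\<close> represents \<open>\<mu>\<close>, and they determine the law of the sequence. So
  the i.i.d. law may be computed with any representing transformation.\<close>

lemma iid_law_eq:
  assumes h: "h \<in> borel_measurable borel" "\<And>u. h u \<in> {0..1}"
    and \<mu>: "\<mu> = distr noise (induced_space X) (\<lambda>\<omega>\<in>Omega. \<rho> (h (\<omega> 0)))"
  shows "iid_law \<mu> = distr noise (induced_space (seq_qus X)) (\<lambda>\<omega>\<in>Omega. \<lambda>k. \<rho> (h (\<omega> k)))"
proof (rule marginals_unique[OF iid_law_in law_in[OF noise_in seq_noise_rv[OF h]]])
  have "(\<lambda>\<omega>\<in>Omega. \<rho> (h (\<omega> 0))) \<in> rvs X"
    by (rule \<rho>_rv) (use h in \<open>auto intro: measurable_compose[OF measurable_Omega_um_component]\<close>)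
  then have "\<mu> \<in> points (prob_qus X)" unfolding \<mu> by (rule law_in[OF noise_in])
  then show "distr (iid_law \<mu>) (induced_space (Xn (Suc n))) (\<lambda>x. restrict x {..<Suc n})
      = distr (distr noise (induced_space (seq_qus X)) (\<lambda>\<omega>\<in>Omega. \<lambda>k. \<rho> (h (\<omega> k))))
      (induced_space (Xn (Suc n))) (\<lambda>x. restrict x {..<Suc n})" for n
    by (simp only: iid_law_marginal noise_marginal[OF h \<mu>])
qed

text \<open>Parameter and noise enter one jointly measurable function, so the dependence on the
  parameter sits in the function while the noise law stays fixed, as \<open>prob_qus\<close>
  demands.\<close>

lemma quant_double_rvs:
  assumes "\<And>a q. a \<in> Omega_um \<rightarrow>\<^sub>M Omega_borel \<Longrightarrow> (\<lambda>\<omega>. F (a \<omega>) q) \<in> borel_measurable Omega_um"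
  shows "(\<lambda>\<omega>\<in>Omega. \<lambda>\<omega>'\<in>Omega. \<lambda>k. \<rho> (quant (F \<omega>) (\<omega>' k))) \<in> double_rvs (seq_qus X)"
    and "(\<lambda>\<omega>\<in>Omega. \<lambda>\<omega>'\<in>Omega. \<rho> (quant (F \<omega>) (\<omega>' 0))) \<in> double_rvs X"
proof -
  have m: "(\<lambda>\<omega>. quant (F (a \<omega>)) (b \<omega> k)) \<in> borel_measurable Omega_um"
    if "a \<in> Omega_um \<rightarrow>\<^sub>M Omega_borel" "b \<in> Omega_um \<rightarrow>\<^sub>M Omega_borel" for a b k
    by (rule quant_measurable[OF assms[OF that(1)] measurable_compose[OF that(2) measurable_Omega_borel_component]])
  have bO: "b \<omega> \<in> Omega" if "b \<in> Omega_um \<rightarrow>\<^sub>M Omega_borel" "\<omega> \<in> Omega" for b \<omega>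
    using measurable_space[OF that(1), of \<omega>] that(2) by (simp add: space_Omega_borel)
  show "(\<lambda>\<omega>\<in>Omega. \<lambda>\<omega>'\<in>Omega. \<lambda>k. \<rho> (quant (F \<omega>) (\<omega>' k))) \<in> double_rvs (seq_qus X)"
  proof (rule double_rvsI[OF _ qu_product])
    show "(\<lambda>\<omega>'\<in>Omega. \<lambda>k. \<rho> (quant (F \<omega>) (\<omega>' k))) \<in> rvs (seq_qus X)" for \<omega>
      by (intro seq_noise_rv quant_u_measurable quant_unit)
    fix a b assume ab: "a \<in> Omega_um \<rightarrow>\<^sub>M Omega_borel" "b \<in> Omega_um \<rightarrow>\<^sub>M Omega_borel"
    have "(\<lambda>\<omega>\<in>Omega. \<lambda>k. \<rho> (quant (F (a \<omega>)) (b \<omega> k))) \<in> rvs (seq_qus X)"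
      by (rule seq_rv, rule measurable_um_borelI) (use m[OF ab] quant_unit in \<open>auto simp: Omega_eq\<close>)
    also have "(\<lambda>\<omega>\<in>Omega. \<lambda>k. \<rho> (quant (F (a \<omega>)) (b \<omega> k))) = (\<lambda>\<omega>\<in>Omega. (\<lambda>\<omega>'\<in>Omega. \<lambda>k. \<rho> (quant (F (a \<omega>)) (\<omega>' k))) (b \<omega>))"
      using bO[OF ab(2)] by auto
    finally show "(\<lambda>\<omega>\<in>Omega. (\<lambda>\<omega>'\<in>Omega. \<lambda>k. \<rho> (quant (F (a \<omega>)) (\<omega>' k))) (b \<omega>)) \<in> rvs (seq_qus X)" .
  qed
  show "(\<lambda>\<omega>\<in>Omega. \<lambda>\<omega>'\<in>Omega. \<rho> (quant (F \<omega>) (\<omega>' 0))) \<in> double_rvs X"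
  proof (rule double_rvsI[OF _ qu])
    show "(\<lambda>\<omega>'\<in>Omega. \<rho> (quant (F \<omega>) (\<omega>' 0))) \<in> rvs X" for \<omega>
      by (rule \<rho>_rv[OF measurable_compose[OF measurable_Omega_um_component quant_u_measurable] quant_unit])
    fix a b assume ab: "a \<in> Omega_um \<rightarrow>\<^sub>M Omega_borel" "b \<in> Omega_um \<rightarrow>\<^sub>M Omega_borel"
    have "(\<lambda>\<omega>\<in>Omega. \<rho> (quant (F (a \<omega>)) (b \<omega> 0))) \<in> rvs X"
      by (rule \<rho>_rv[OF m[OF ab] quant_unit])
    also have "(\<lambda>\<omega>\<in>Omega. \<rho> (quant (F (a \<omega>)) (b \<omega> 0))) = (\<lambda>\<omega>\<in>Omega. (\<lambda>\<omega>'\<in>Omega. \<rho> (quant (F (a \<omega>)) (\<omega>' 0))) (b \<omega>))"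
      using bO[OF ab(2)] by auto
    finally show "(\<lambda>\<omega>\<in>Omega. (\<lambda>\<omega>'\<in>Omega. \<rho> (quant (F (a \<omega>)) (\<omega>' 0))) (b \<omega>)) \<in> rvs X" .
  qed
qed

lemma iid_law_rv:
  assumes h: "h \<in> rvs (prob_qus X)"
  shows "(\<lambda>\<omega>\<in>Omega. \<lambda>\<omega>'\<in>Omega. \<lambda>k. \<rho> (quant (cdf (h \<omega>)) (\<omega>' k))) \<in> double_rvs (seq_qus X)"
    and "(\<lambda>\<omega>\<in>Omega. iid_law (h \<omega>)) \<in> rvs (prob_qus (seq_qus X))"
proof -
  let ?F = "\<lambda>\<omega>\<in>Omega. \<lambda>\<omega>'\<in>Omega. \<lambda>k. \<rho> (quant (cdf (h \<omega>)) (\<omega>' k))"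
  show F: "?F \<in> double_rvs (seq_qus X)"
    by (rule quant_double_rvs(1)[of "\<lambda>\<omega>. cdf (h \<omega>)"])
      (rule measurable_compose[OF measurable_um_um cdf_measurable[OF h]])
  have "(\<lambda>\<omega>\<in>Omega. iid_law (h \<omega>)) = (\<lambda>\<omega>\<in>Omega. distr noise (induced_space (seq_qus X)) (?F \<omega>))"
    by (auto simp: iid_law_def)
  then show "(\<lambda>\<omega>\<in>Omega. iid_law (h \<omega>)) \<in> rvs (prob_qus (seq_qus X))"
    using prob_rvsI[OF noise_in F] by simp
qed

lemma iid_law_kernel:
  assumes "quasi_universal S" and K: "K \<in> markov_kernels S X"
  shows "(\<lambda>s\<in>points S. iid_law (K s)) \<in> markov_kernels S (seq_qus X)"
  unfolding markov_kernels_def quasi_measurable_def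
proof (intro CollectI conjI ballI)
  show "(\<lambda>s\<in>points S. iid_law (K s)) \<in> points S \<rightarrow>\<^sub>E points (prob_qus (seq_qus X))"
    using iid_law_in by auto
  fix f assume f: "f \<in> rvs S"
  then have "compose Omega K f \<in> rvs (prob_qus X)" using K by (auto simp: markov_kernels_def quasi_measurable_def)
  from iid_law_rv(2)[OF this]
  have "(\<lambda>\<omega>\<in>Omega. iid_law (compose Omega K f \<omega>)) \<in> rvs (prob_qus (seq_qus X))" .
  also have "(\<lambda>\<omega>\<in>Omega. iid_law (compose Omega K f \<omega>)) = compose Omega (\<lambda>s\<in>points S. iid_law (K s)) f"
    using rvsD(1)[OF assms(1) f] by (auto simp: compose_def)
  finally show "compose Omega (\<lambda>s\<in>points S. iid_law (K s)) f \<in> rvs (prob_qus (seq_qus X))" .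
qed

text \<open>Existence is \<open>iid_law_kernel\<close> with its marginals. A competitor has the same
  marginals at each \<open>s\<close> and, being extensional, takes the value
  \<open>undefined\<close> off \<open>points S\<close>.\<close>

lemma iid_kernel_eq:
  assumes S: "quasi_universal S" and K: "K \<in> markov_kernels S X"
  shows "iid_kernel S X K = (\<lambda>s\<in>points S. iid_law (K s))"
  unfolding iid_kernel_def
proof (rule the_equality)
  have KX: "K s \<in> points (prob_qus X)" if "s \<in> points S" for s
    using K that by (auto simp: markov_kernels_def quasi_measurable_def)
  show "(\<lambda>s\<in>points S. iid_law (K s)) \<in> markov_kernels S (seq_qus X) \<and>
      (\<forall>n. \<forall>s\<in>points S. distr ((\<lambda>s\<in>points S. iid_law (K s)) s) (induced_space (Xn (Suc n))) (\<lambda>x. restrict x {..<Suc n})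
        = power_measure X (K s) (Suc n))"
  proof (intro conjI allI ballI)
    fix n s assume s: "s \<in> points S"
    show "distr ((\<lambda>s\<in>points S. iid_law (K s)) s) (induced_space (Xn (Suc n))) (\<lambda>x. restrict x {..<Suc n})
        = power_measure X (K s) (Suc n)"
      unfolding restrict_apply'[OF s] by (rule iid_law_marginal[OF KX[OF s]])
  qed (rule iid_law_kernel[OF S K])
  fix L assume L: "L \<in> markov_kernels S (seq_qus X) \<and>
      (\<forall>n. \<forall>s\<in>points S. distr (L s) (induced_space (Xn (Suc n))) (\<lambda>x. restrict x {..<Suc n})
        = power_measure X (K s) (Suc n))"
  have L1: "L \<in> points S \<rightarrow>\<^sub>E points (prob_qus (seq_qus X))"
    using conjunct1[OF L] unfolding markov_kernels_def quasi_measurable_def by blast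
  have L2: "distr (L s) (induced_space (Xn (Suc n))) (\<lambda>x. restrict x {..<Suc n}) = power_measure X (K s) (Suc n)"
    if "s \<in> points S" for s n
    using conjunct2[OF L] that by blast
  show "L = (\<lambda>s\<in>points S. iid_law (K s))"
  proof
    fix s
    show "L s = (\<lambda>s\<in>points S. iid_law (K s)) s"
    proof (cases "s \<in> points S")
      case True
      have "L s \<in> points (prob_qus (seq_qus X))" using PiE_mem[OF L1 True] .
      then have "L s = iid_law (K s)"
      proof (rule marginals_unique[OF _ iid_law_in])
        show "distr (L s) (induced_space (Xn (Suc n))) (\<lambda>x. restrict x {..<Suc n})
          = distr (iid_law (K s)) (induced_space (Xn (Suc n))) (\<lambda>x. restrict x {..<Suc n})" for n
          unfolding L2[OF True] iid_law_marginal[OF KX[OF True]] ..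
      qed
      then show ?thesis using True by simp
    next
      case False
      then show ?thesis using PiE_arb[OF L1 False] by simp
    qed
  qed
qed

lemma iid_law_exchangeable:
  assumes "bij \<sigma>"
  shows "distr (iid_law \<mu>) (induced_space (seq_qus X)) (\<lambda>x n. x (\<sigma> n)) = iid_law \<mu>"
proof -
  let ?h = "quant (cdf \<mu>)"
  let ?f = "\<lambda>\<omega>\<in>Omega. \<lambda>k. \<rho> (?h (\<omega> k))"
  have f: "?f \<in> rvs (seq_qus X)" by (intro seq_noise_rv quant_u_measurable quant_unit)
  have sO: "(\<lambda>k. \<omega> (\<sigma> k)) \<in> Omega" if "\<omega> \<in> Omega" for \<omega> using that by (auto simp: Omega_eq)
  have s: "(\<lambda>\<omega> k. \<omega> (\<sigma> k)) \<in> Omega_um \<rightarrow>\<^sub>M Omega_um"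
    by (rule measurable_um_um, rule measurable_um_borelI) (auto simp: sO intro: measurable_Omega_um_component)
  have "distr (iid_law \<mu>) (induced_space (seq_qus X)) (\<lambda>x n. x (\<sigma> n))
      = distr noise (induced_space (seq_qus X)) (compose Omega (\<lambda>x\<in>points (seq_qus X). \<lambda>n. x (\<sigma> n)) ?f)"
    unfolding distr_restrict_points[OF qu_product iid_law_in[of \<mu>], of _ "\<lambda>x n. x (\<sigma> n)"] unfolding iid_law_def
    by (rule law_map[OF qu_product qu_product perm_quasi noise_in f])
  also have "\<dots> = distr noise (induced_space (seq_qus X)) (?f \<circ> (\<lambda>\<omega> k. \<omega> (\<sigma> k)))"
    by (rule law_cong[OF noise_in]) (use rvsD(1)[OF qu_product f] sO in \<open>auto simp: compose_def\<close>)
  also have "\<dots> = distr (distr noise Omega_um (\<lambda>\<omega> k. \<omega> (\<sigma> k))) (induced_space (seq_qus X)) ?f"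
    by (rule distr_distr[symmetric]) (use s rvs_measurable[OF qu_product f] in \<open>auto simp: measurable_Omega_probs[OF noise_in]\<close>)
  also have "\<dots> = iid_law \<mu>"
    unfolding noise_reindex[OF bij_is_inj[OF assms]] iid_law_def ..
  finally show ?thesis .
qed

end

section \<open>Exchangeable kernels\<close>

text \<open>\<^const>\<open>measure_of\<close> yields the null measure when its argument is not countably additive, which
  is excluded for a probability measure.\<close>

lemma emeasure_measure_of_prob:
  assumes "sigma_algebra \<Omega> M" "prob_space (measure_of \<Omega> M \<phi>)" "A \<in> M"
  shows "emeasure (measure_of \<Omega> M \<phi>) A = \<phi> A"
proof -
  interpret M: sigma_algebra \<Omega> M by fact
  have "measure_space \<Omega> (sigma_sets \<Omega> M) \<phi>"
  proof (rule ccontr)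
    assume "\<not> measure_space \<Omega> (sigma_sets \<Omega> M) \<phi>"
    then have "emeasure (measure_of \<Omega> M \<phi>) (space (measure_of \<Omega> M \<phi>)) = 0"
      by (simp add: emeasure_measure_of_conv)
    then show False using prob_space.emeasure_space_1[OF assms(2)] by simp
  qed
  then show ?thesis using assms(3) by (simp add: emeasure_measure_of_conv M.sigma_sets_eq)
qed

section \<open>Exchangeability of mixtures\<close>

context unit_retract
begin

text \<open>Each \<open>iid_law (K s)\<close> is invariant by itself, so the invariance passes
  through the integral over any mixing law.\<close>

lemma iid_mixture_exchangeable:
  assumes Z: "quasi_universal Z" and Q: "Q \<in> markov_kernels Z (seq_qus X)"
    and S: "quasi_universal S" and K: "K \<in> markov_kernels S X" and P: "P \<in> markov_kernels Z S"
    and Q_eq: "Q = kernel_comp Z (seq_qus X) (iid_kernel S X K) P"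
  shows "exchangeable Z X Q"
  unfolding exchangeable_def
proof (intro allI impI ballI, elim conjE)
  fix \<sigma> :: "nat \<Rightarrow> nat" and z assume \<sigma>: "bij \<sigma>" and z: "z \<in> points Z"
  let ?Y = "seq_qus X"
  have Qz: "Q z \<in> points (prob_qus ?Y)" using Q z by (auto simp: markov_kernels_def quasi_measurable_def)
  have Pz: "P z \<in> points (prob_qus S)" using P z by (auto simp: markov_kernels_def quasi_measurable_def)
  have Qz_eq: "Q z = measure_of (points ?Y) (induced_sets ?Y) (\<lambda>A. \<integral>\<^sup>+ s. emeasure (iid_kernel S X K s) A \<partial>P z)"
    using z unfolding Q_eq kernel_comp_def by simp
  \<comment> \<open>\<open>Q z\<close> is a probability measure, so \<open>measure_of\<close> has
    not collapsed and its values are the mixture integrals.\<close>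
  have em: "emeasure (Q z) A = (\<integral>\<^sup>+ s. emeasure (iid_law (K s)) A \<partial>P z)" if "A \<in> induced_sets ?Y" for A
  proof -
    have "emeasure (Q z) A = (\<integral>\<^sup>+ s. emeasure (iid_kernel S X K s) A \<partial>P z)"
      using emeasure_measure_of_prob[OF sigma_algebra_induced_sets[OF qu_product] _ that]
        points_probD(1)[OF qu_product Qz] unfolding Qz_eq by blast
    also have "\<dots> = (\<integral>\<^sup>+ s. emeasure (iid_law (K s)) A \<partial>P z)"
      by (rule nn_integral_cong) (simp add: iid_kernel_eq[OF S K] points_probD(3)[OF S Pz])
    finally show ?thesis .
  qed
  let ?p = "\<lambda>x\<in>points ?Y. \<lambda>n. x (\<sigma> n)"
  have p: "?p \<in> induced_space ?Y \<rightarrow>\<^sub>M induced_space ?Y"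
    by (rule induced_measurable_quasi[OF qu_product qu_product perm_quasi])
  show "distr (Q z) (induced_space ?Y) (\<lambda>x n. x (\<sigma> n)) = Q z"
  proof (rule measure_eqI)
    show "sets (distr (Q z) (induced_space ?Y) (\<lambda>x n. x (\<sigma> n))) = sets (Q z)"
      by (simp add: sets_induced_space[OF qu_product] points_probD(2)[OF qu_product Qz])
    fix A assume "A \<in> sets (distr (Q z) (induced_space ?Y) (\<lambda>x n. x (\<sigma> n)))"
    then have A: "A \<in> induced_sets ?Y" by (simp add: sets_induced_space[OF qu_product])
    have pre: "emeasure (distr \<mu> (induced_space ?Y) (\<lambda>x n. x (\<sigma> n))) A = emeasure \<mu> (?p -` A \<inter> points ?Y)"
      if \<mu>: "\<mu> \<in> points (prob_qus ?Y)" for \<mu>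
    proof -
      have p\<mu>: "?p \<in> \<mu> \<rightarrow>\<^sub>M induced_space ?Y"
        unfolding points_probD(4)[OF qu_product \<mu>] by (rule p)
      have As: "A \<in> sets (induced_space ?Y)" using A by (simp add: sets_induced_space[OF qu_product])
      show ?thesis
        unfolding distr_restrict_points[OF qu_product \<mu>, of _ "\<lambda>x n. x (\<sigma> n)"]
          emeasure_distr[OF p\<mu> As] points_probD(3)[OF qu_product \<mu>] ..
    qed
    have B: "?p -` A \<inter> points ?Y \<in> induced_sets ?Y"
      using measurable_sets[OF p, of A] A by (simp add: sets_induced_space[OF qu_product] space_induced_space[OF qu_product])
    have "emeasure (distr (Q z) (induced_space ?Y) (\<lambda>x n. x (\<sigma> n))) A
        = (\<integral>\<^sup>+ s. emeasure (iid_law (K s)) (?p -` A \<inter> points ?Y) \<partial>P z)"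
      unfolding pre[OF Qz] em[OF B] ..
    also have "\<dots> = (\<integral>\<^sup>+ s. emeasure (iid_law (K s)) A \<partial>P z)"
      unfolding pre[OF iid_law_in, symmetric] iid_law_exchangeable[OF \<sigma>] ..
    also have "\<dots> = emeasure (Q z) A" by (rule em[OF A, symmetric])
    finally show "emeasure (distr (Q z) (induced_space ?Y) (\<lambda>x n. x (\<sigma> n))) A = emeasure (Q z) A" .
  qed
qed

text \<open>The directing measure of de Finetti. Going through \<open>quant\<close> yields a genuine
  law for every \<open>x\<close>, including sequences whose frequencies diverge or whose
  \<open>lim_cdf\<close> is not right-continuous, so the map is total.\<close>

definition directing :: "(nat \<Rightarrow> 'x) \<Rightarrow> 'x measure" where
  "directing = (\<lambda>x\<in>points (seq_qus X). distr noise (induced_space X)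
     (\<lambda>\<omega>\<in>Omega. \<rho> (quant (lim_cdf (\<lambda>k. j (x k))) (\<omega> 0))))"

lemma lim_cdf_seq_measurable:
  assumes f: "f \<in> rvs (seq_qus X)" and a: "a \<in> Omega_um \<rightarrow>\<^sub>M Omega_borel"
  shows "(\<lambda>\<omega>. lim_cdf (\<lambda>k. j (f (a \<omega>) k)) q) \<in> borel_measurable Omega_um"
proof (rule lim_cdf_measurable)
  show "(\<lambda>\<omega>. j (f (a \<omega>) k)) \<in> borel_measurable Omega_um" for k
    using measurable_compose[OF measurable_um_um[OF a]
        measurable_compose[OF seq_rv_j(1)[OF f] measurable_Omega_borel_component[of k]]] .
qed

lemma directing_quasi: "directing \<in> quasi_measurable (seq_qus X) (prob_qus X)"
  unfolding quasi_measurable_def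
proof (intro CollectI conjI ballI)
  show "directing \<in> points (seq_qus X) \<rightarrow>\<^sub>E points (prob_qus X)"
    unfolding directing_def
    by (intro restrict_PiE_iff[THEN iffD2] ballI law_in noise_in \<rho>_rv quant_unit
        measurable_compose[OF measurable_Omega_um_component quant_u_measurable])
  fix f assume f: "f \<in> rvs (seq_qus X)"
  let ?F = "\<lambda>\<omega>\<in>Omega. \<lambda>\<omega>'\<in>Omega. \<rho> (quant (lim_cdf (\<lambda>k. j (f \<omega> k))) (\<omega>' 0))"
  have "?F \<in> double_rvs X"
    by (rule quant_double_rvs(2)[of "\<lambda>\<omega>. lim_cdf (\<lambda>k. j (f \<omega> k))"]) (rule lim_cdf_seq_measurable[OF f])
  from prob_rvsI[OF noise_in this]
  have "(\<lambda>\<omega>\<in>Omega. distr noise (induced_space X) (?F \<omega>)) \<in> rvs (prob_qus X)" .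
  also have "(\<lambda>\<omega>\<in>Omega. distr noise (induced_space X) (?F \<omega>)) = compose Omega directing f"
    using rvsD(1)[OF qu_product f] by (auto simp: compose_def directing_def)
  finally show "compose Omega directing f \<in> rvs (prob_qus X)" .
qed

text \<open>\<open>cdf (directing x)\<close> can differ from \<open>lim_cdf\<close>, which may fail
  right-continuity, and quantiles may miss the range of \<open>j\<close>. \<open>iid_law_eq\<close>
  still allows the i.i.d. law to be computed with \<open>lim_cdf\<close>.\<close>

lemma iid_law_directing:
  assumes "x \<in> points (seq_qus X)"
  shows "iid_law (directing x) = distr noise (induced_space (seq_qus X))
    (\<lambda>\<omega>\<in>Omega. \<lambda>k. \<rho> (quant (lim_cdf (\<lambda>k. j (x k))) (\<omega> k)))"
  by (rule iid_law_eq[OF quant_u_measurable quant_unit]) (simp add: directing_def assms)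

lemma j_seq_measurable: "(\<lambda>x k. j (x k)) \<in> induced_space (seq_qus X) \<rightarrow>\<^sub>M (borel :: (nat \<Rightarrow> real) measure)"
proof (rule induced_measurableI[OF qu_product])
  fix f assume f: "f \<in> rvs (seq_qus X)"
  show "(\<lambda>\<omega> k. j (f \<omega> k)) \<in> Omega_um \<rightarrow>\<^sub>M borel"
    by (rule measurable_coordinatewise_then_product)
      (rule measurable_compose[OF seq_rv_j(1)[OF f] measurable_Omega_borel_component])
qed simp

lemma unif_quant_measurable:
  "(\<lambda>s. emeasure unif {u\<in>{0..1}. quant (lim_cdf s) u < t}) \<in> borel_measurable (borel :: (nat \<Rightarrow> real) measure)"
proof -
  let ?M = "(borel :: (nat \<Rightarrow> real) measure) \<Otimes>\<^sub>M unif"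
  have c: "(\<lambda>s::nat \<Rightarrow> real. s k) \<in> borel_measurable borel" for k
    by (rule borel_measurable_continuous_onI) simp
  have m: "(\<lambda>p. quant (lim_cdf (fst p)) (snd p)) \<in> borel_measurable ?M"
  proof (rule quant_measurable)
    show "(\<lambda>p. lim_cdf (fst p) q) \<in> borel_measurable ?M" for q
      by (rule lim_cdf_measurable) (rule measurable_compose[OF measurable_fst c])
    show "snd \<in> borel_measurable ?M"
      by (rule measurable_compose[OF measurable_snd measurable_unif_ident])
  qed
  then have "{p\<in>space ?M. quant (lim_cdf (fst p)) (snd p) < t} \<in> sets ?M"
    by measurable
  from unif.measurable_emeasure_Pair[OF this]
  have "(\<lambda>s. emeasure unif (Pair s -` {p\<in>space ?M. quant (lim_cdf (fst p)) (snd p) < t})) \<in> borel_measurable borel" .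
  also have "(\<lambda>s. Pair s -` {p\<in>space ?M. quant (lim_cdf (fst p)) (snd p) < t}) = (\<lambda>s. {u\<in>{0..1}. quant (lim_cdf s) u < t})"
    by (auto simp: space_pair_measure fun_eq_iff)
  finally show ?thesis .
qed

text \<open>Sampling \<open>\<omega>\<close> from \<open>R\<close> and then independent noise is one
  draw from \<open>pair_law R noise\<close>. Under it the transformed noise \<open>H\<close> has, by
  \<open>de_Finetti_quant\<close>, the same cylinder probabilities as the original coordinates in
  \<open>[0,1]\<close>, and \<open>seq_law_eqI\<close> passes from cylinders to every induced
  set.\<close>

lemma exchangeable_iid_mixture:
  assumes R: "R \<in> Omega_probs" and f: "f \<in> rvs (seq_qus X)"
    and exch: "\<And>\<sigma>. bij \<sigma> \<Longrightarrow> finite {n. \<sigma> n \<noteq> n} \<Longrightarrow>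
      distr (distr R (induced_space (seq_qus X)) f) (induced_space (seq_qus X)) (\<lambda>x n. x (\<sigma> n))
        = distr R (induced_space (seq_qus X)) f"
    and A: "A \<in> induced_sets (seq_qus X)"
  shows "(\<integral>\<^sup>+\<omega>. emeasure (iid_law (directing (f \<omega>))) A \<partial>R) = emeasure (distr R (induced_space (seq_qus X)) f) A"
proof -
  let ?Y = "seq_qus X" and ?q = "\<lambda>\<omega>. quant (lim_cdf (\<lambda>k. j (f \<omega> k)))"
  let ?\<mu> = "distr R (induced_space ?Y) f" and ?J = "\<lambda>x k. j (x k)"
  let ?F = "\<lambda>\<omega>\<in>Omega. \<lambda>\<omega>'\<in>Omega. \<lambda>k. \<rho> (?q \<omega> (\<omega>' k))"
  let ?T = "pair_law R noise"
  have spR: "space R = Omega" by (rule Omega_probsD(3)[OF R])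
  have fY: "f \<omega> \<in> points ?Y" if "\<omega> \<in> Omega" for \<omega> by (rule rvsD(1)[OF qu_product f that])
  have \<mu>: "?\<mu> \<in> points (prob_qus ?Y)" by (rule law_in[OF R f])
  have fm: "f \<in> R \<rightarrow>\<^sub>M induced_space ?Y"
    by (simp add: measurable_Omega_probs[OF R] rvs_measurable[OF qu_product f])
  define N where "N = distr R borel (\<lambda>\<omega>. ?J (f \<omega>))"
  have Jm: "(\<lambda>\<omega>. ?J (f \<omega>)) \<in> R \<rightarrow>\<^sub>M borel" by (rule measurable_compose[OF fm j_seq_measurable])
  have N_eq: "N = distr ?\<mu> borel ?J"
    unfolding N_def by (subst distr_distr[OF j_seq_measurable fm]) (simp add: comp_def)
  have sN: "sets N = sets borel" by (simp add: N_def)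
  interpret R: prob_space R by (rule Omega_probsD(1)[OF R])
  interpret N: prob_space N unfolding N_def by (rule R.prob_space_distr[OF Jm])
  \<comment> \<open>Exchangeability transfers to real sequences because permuting commutes with
    applying \<open>j\<close> coordinatewise.\<close>
  interpret N: exch_seq N
  proof
    show "sets N = sets borel" by (rule sN)
    fix \<sigma> :: "nat \<Rightarrow> nat" assume \<sigma>: "bij \<sigma>" "finite {n. \<sigma> n \<noteq> n}"
    let ?p = "\<lambda>x\<in>points ?Y. \<lambda>n. x (\<sigma> n)"
    have p: "?p \<in> ?\<mu> \<rightarrow>\<^sub>M induced_space ?Y"
      using induced_measurable_quasi[OF qu_product qu_product perm_quasi] by simp
    have pb: "(\<lambda>s k. s (\<sigma> k)) \<in> (borel :: (nat \<Rightarrow> real) measure) \<rightarrow>\<^sub>M borel"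
      by (rule measurable_coordinatewise_then_product) (rule borel_measurable_continuous_onI, simp)
    have J\<mu>: "?J \<in> ?\<mu> \<rightarrow>\<^sub>M borel" using j_seq_measurable by simp
    have "distr N N (\<lambda>s k. s (\<sigma> k)) = distr N borel (\<lambda>s k. s (\<sigma> k))"
      by (rule distr_cong) (simp_all add: sN)
    also have "\<dots> = distr ?\<mu> borel ((\<lambda>s k. s (\<sigma> k)) \<circ> ?J)"
      unfolding N_eq by (rule distr_distr[OF pb J\<mu>])
    also have "\<dots> = distr ?\<mu> borel (?J \<circ> ?p)"
      by (rule distr_cong) (auto simp: space_induced_space[OF qu_product])
    also have "\<dots> = distr (distr ?\<mu> (induced_space ?Y) ?p) borel ?J"
      by (rule distr_distr[OF j_seq_measurable p, symmetric])
    also have "\<dots> = N"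
      unfolding distr_restrict_points[OF qu_product \<mu>, of _ "\<lambda>x n. x (\<sigma> n)", symmetric] exch[OF \<sigma>] N_eq ..
    finally show "distr N N (\<lambda>s k. s (\<sigma> k)) = N" .
  qed
  have OmB: "{s. s \<in> Omega} \<in> sets (borel :: (nat \<Rightarrow> real) measure)"
  proof -
    have [measurable]: "(\<lambda>s::nat \<Rightarrow> real. s k) \<in> borel_measurable borel" for k
      by (rule borel_measurable_continuous_onI) simp
    have "{s\<in>space (borel :: (nat \<Rightarrow> real) measure). \<forall>k. 0 \<le> s k \<and> s k \<le> 1} \<in> sets borel" by measurable
    also have "{s\<in>space (borel :: (nat \<Rightarrow> real) measure). \<forall>k. 0 \<le> s k \<and> s k \<le> 1} = {s. s \<in> Omega}"
      by (auto simp: Omega_eq Pi_iff)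
    finally show ?thesis .
  qed
  have Om: "AE s in N. s \<in> Omega"
  proof -
    have "?J (f \<omega>) \<in> Omega" if "\<omega> \<in> Omega" for \<omega>
      using j_bounds seq_rv_j(3)[OF f that] by (auto simp: Omega_eq)
    then have "AE \<omega> in R. ?J (f \<omega>) \<in> Omega" by (intro AE_I2) (simp add: spR)
    then show ?thesis unfolding N_def by (subst AE_distr_iff[OF Jm]) (use OmB in simp_all)
  qed
  have F: "?F \<in> double_rvs ?Y"
    by (rule quant_double_rvs(1)[of "\<lambda>\<omega>. lim_cdf (\<lambda>k. j (f \<omega> k))"]) (rule lim_cdf_seq_measurable[OF f])
  \<comment> \<open>Even coordinates select the sample point whose empirical limit is used, odd
    coordinates supply the uniform noise.\<close>
  define H where "H \<omega> k = ?q (dfst \<omega>) (dsnd \<omega> k)" for \<omega> k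
  have Hm: "H \<in> Omega_um \<rightarrow>\<^sub>M Omega_borel"
  proof (rule measurable_um_borelI)
    show "(\<lambda>\<omega>. H \<omega> k) \<in> borel_measurable Omega_um" for k
      unfolding H_def by (rule quant_measurable[OF lim_cdf_seq_measurable[OF f dfst_measurable]
            measurable_compose[OF dsnd_measurable measurable_Omega_borel_component]])
  qed (use quant_unit in \<open>auto simp: Omega_eq H_def\<close>)
  have HO: "H \<omega> \<in> Omega" if "\<omega> \<in> Omega" for \<omega>
    using measurable_space[OF Hm, of \<omega>] that by (simp add: space_Omega_borel)
  have dO: "dfst \<omega> \<in> Omega" "dsnd \<omega> \<in> Omega" if "\<omega> \<in> Omega" for \<omega>
    using measurable_space[OF dfst_measurable, of \<omega>] measurable_space[OF dsnd_measurable, of \<omega>] that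
    by (simp_all add: space_Omega_borel)
  have cyl: "emeasure ?T {\<omega>\<in>Omega. \<forall>k<n. H \<omega> k < t k} = emeasure R {\<omega>\<in>Omega. \<forall>k<n. ?J (f \<omega>) k < t k}"
    for n and t :: "nat \<Rightarrow> real"
  proof -
    let ?D = "{\<omega>\<in>Omega. \<forall>k<n. H \<omega> k < t k}"
    have Deq: "H -` {\<omega>\<in>Omega. \<forall>k<n. \<omega> k < t k} \<inter> space Omega_um = ?D"
      unfolding space_Omega_um using HO by blast
    have D: "?D \<in> sets Omega_um"
      unfolding Deq[symmetric] by (rule measurable_sets[OF Hm sets_cylinder])
    have "emeasure ?T ?D = (\<integral>\<^sup>+\<omega>. emeasure noise {\<omega>'\<in>Omega. djoin \<omega> \<omega>' \<in> ?D} \<partial>R)"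
      unfolding pair_law_def by (rule um_section_integral[OF djoin_measurable noise_in D R, symmetric])
    also have "\<dots> = (\<integral>\<^sup>+\<omega>. (\<Prod>k<n. emeasure unif {u\<in>{0..1}. ?q \<omega> u < t k}) \<partial>R)"
    proof (rule nn_integral_cong)
      fix \<omega> assume "\<omega> \<in> space R"
      then have w: "\<omega> \<in> Omega" by (simp add: spR)
      have "{\<omega>'\<in>Omega. djoin \<omega> \<omega>' \<in> ?D} = {\<omega>'\<in>Omega. \<forall>k<n. ?q \<omega> (\<omega>' k) < t k}"
        by (intro Collect_cong conj_cong refl)
          (simp only: mem_Collect_eq dfst_djoin dsnd_djoin djoin_in[OF w] simp_thms H_def)
      then show "emeasure noise {\<omega>'\<in>Omega. djoin \<omega> \<omega>' \<in> ?D} = (\<Prod>k<n. emeasure unif {u\<in>{0..1}. ?q \<omega> u < t k})"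
        by (simp only: emeasure_noise_product[OF quant_u_measurable])
    qed
    also have "\<dots> = (\<integral>\<^sup>+s. (\<Prod>k<n. emeasure unif {u\<in>{0..1}. quant (lim_cdf s) u < t k}) \<partial>N)"
    proof -
      have "(\<lambda>s. \<Prod>k<n. emeasure unif {u\<in>{0..1}. quant (lim_cdf s) u < t k})
          \<in> borel_measurable (borel :: (nat \<Rightarrow> real) measure)"
        by (rule borel_measurable_prod_ennreal) (rule unif_quant_measurable)
      then show ?thesis unfolding N_def
        by (intro nn_integral_distr[OF Jm, symmetric]) (simp only: measurable_distr_eq1)
    qed
    also have "\<dots> = emeasure N {s. \<forall>k<n. s k < t k}"
      by (rule N.de_Finetti_quant[OF Om, symmetric])
    also have "\<dots> = emeasure R {\<omega>\<in>Omega. \<forall>k<n. ?J (f \<omega>) k < t k}"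
    proof -
      have [measurable]: "(\<lambda>s::nat \<Rightarrow> real. s k) \<in> borel_measurable borel" for k
        by (rule borel_measurable_continuous_onI) simp
      have "{s\<in>space (borel :: (nat \<Rightarrow> real) measure). \<forall>k<n. s k < t k} \<in> sets borel" by measurable
      then have B: "{s. \<forall>k<n. s k < t k} \<in> sets (borel :: (nat \<Rightarrow> real) measure)" by simp
      have "(\<lambda>\<omega>. ?J (f \<omega>)) -` {s. \<forall>k<n. s k < t k} \<inter> space R = {\<omega>\<in>Omega. \<forall>k<n. ?J (f \<omega>) k < t k}"
        unfolding spR by blast
      then show ?thesis unfolding N_def using emeasure_distr[OF Jm B] by simp
    qed
    finally show ?thesis .
  qed
  have "(\<integral>\<^sup>+\<omega>. emeasure (iid_law (directing (f \<omega>))) A \<partial>R) = (\<integral>\<^sup>+\<omega>. emeasure (distr noise (induced_space ?Y) (?F \<omega>)) A \<partial>R)"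
    by (rule nn_integral_cong) (simp add: spR iid_law_directing[OF fY])
  also have "\<dots> = emeasure (distr ?T (induced_space ?Y) (\<lambda>\<omega>\<in>Omega. ?F (dfst \<omega>) (dsnd \<omega>))) A"
    by (rule double_law_integral[OF qu_product noise_in F A R])
  also have "distr ?T (induced_space ?Y) (\<lambda>\<omega>\<in>Omega. ?F (dfst \<omega>) (dsnd \<omega>))
      = distr ?T (induced_space ?Y) (\<lambda>\<omega>\<in>Omega. \<lambda>k. \<rho> (H \<omega> k))"
    by (rule law_cong[OF pair_law_in[OF R noise_in]]) (simp add: dO H_def)
  also have "\<dots> = distr R (induced_space ?Y) (\<lambda>\<omega>\<in>Omega. \<lambda>k. \<rho> (?J (f \<omega>) k))"
    by (rule seq_law_eqI[OF pair_law_in[OF R noise_in] R Hm seq_rv_j(1)[OF f] cyl])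
  also have "\<dots> = ?\<mu>" unfolding seq_rv_j(2)[OF f, symmetric] ..
  finally show ?thesis .
qed

section \<open>Mixing over the space of laws\<close>

lemma id_kernel: "(\<lambda>\<mu>\<in>points (prob_qus X). \<mu>) \<in> markov_kernels (prob_qus X) X"
  unfolding markov_kernels_def quasi_measurable_def
proof (intro CollectI conjI ballI)
  fix f assume f: "f \<in> rvs (prob_qus X)"
  note fP = rvsD[OF quasi_universal_prob[OF qu] f]
  have "compose Omega (\<lambda>\<mu>\<in>points (prob_qus X). \<mu>) f = f"
    using fP(1) extensional_arb[OF fP(2)] by (auto simp: compose_def fun_eq_iff)
  then show "compose Omega (\<lambda>\<mu>\<in>points (prob_qus X). \<mu>) f \<in> rvs (prob_qus X)" using f by simp
qed auto

text \<open>\<open>prob_map\<close> already makes the push-forward along \<open>directing\<close> a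
  kernel. The presentation of \<open>Q z\<close> by \<open>R\<close> and \<open>f\<close> may
  therefore be chosen afresh for each \<open>z\<close>, as it only serves to check an identity of
  measures.\<close>

lemma exchangeable_representation:
  assumes Z: "quasi_universal Z" and Q: "Q \<in> markov_kernels Z (seq_qus X)" and exch: "exchangeable Z X Q"
  shows "\<exists>P\<in>markov_kernels Z (prob_qus X). Q = kernel_comp Z (seq_qus X)
    (iid_kernel (prob_qus X) X (\<lambda>\<mu>\<in>points (prob_qus X). \<mu>)) P"
proof
  let ?Y = "seq_qus X" and ?PX = "prob_qus X"
  let ?P = "\<lambda>z\<in>points Z. distr (Q z) (induced_space ?PX) directing"
  let ?L = "iid_kernel ?PX X (\<lambda>\<mu>\<in>points ?PX. \<mu>)"
  have PX: "quasi_universal ?PX" by (rule quasi_universal_prob[OF qu])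
  show "?P \<in> markov_kernels Z ?PX" by (rule prob_map[OF qu_product PX Z directing_quasi Q])
  have QE: "Q \<in> points Z \<rightarrow>\<^sub>E points (prob_qus ?Y)"
    using Q unfolding markov_kernels_def quasi_measurable_def by blast
  have L: "?L \<mu> = iid_law \<mu>" if "\<mu> \<in> points ?PX" for \<mu>
    using that by (simp add: iid_kernel_eq[OF PX id_kernel])
  show "Q = kernel_comp Z ?Y ?L ?P"
  proof
    fix z
    show "Q z = kernel_comp Z ?Y ?L ?P z"
    proof (cases "z \<in> points Z")
      case False
      then show ?thesis using PiE_arb[OF QE False] by (simp add: kernel_comp_def)
    next
      case True
      have Qz: "Q z \<in> points (prob_qus ?Y)" using PiE_mem[OF QE True] .
      then obtain R f where R: "R \<in> Omega_probs" and f: "f \<in> rvs ?Y" and Qz_eq: "Q z = distr R (induced_space ?Y) f"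
        by (rule points_probE)
      have df: "compose Omega directing f \<in> rvs ?PX" using directing_quasi f by (auto simp: quasi_measurable_def)
      have Pz: "?P z = distr R (induced_space ?PX) (compose Omega directing f)"
        using True law_map[OF qu_product PX directing_quasi R f] by (simp add: Qz_eq)
      have ex: "distr (distr R (induced_space ?Y) f) (induced_space ?Y) (\<lambda>x n. x (\<sigma> n)) = distr R (induced_space ?Y) f"
        if "bij \<sigma>" "finite {n. \<sigma> n \<noteq> n}" for \<sigma>
        using exch that True unfolding exchangeable_def Qz_eq[symmetric] by blast
      have "measure_of (points ?Y) (induced_sets ?Y) (\<lambda>A. \<integral>\<^sup>+ \<mu>. emeasure (?L \<mu>) A \<partial>?P z) = Q z"
      proof (rule measure_of_eqI[OF qu_product points_probD(2)[OF qu_product Qz]])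
        fix A assume A: "A \<in> induced_sets ?Y"
        \<comment> \<open>Measurability of the i.i.d. law in its parameter law is tested along
          admissible variables of \<open>prob_qus X\<close>; it licenses the change of variables
          from laws back to sample points.\<close>
        have g: "(\<lambda>\<mu>. emeasure (?L \<mu>) A) \<in> borel_measurable (induced_space ?PX)"
        proof (rule induced_measurableI[OF PX])
          fix h assume h: "h \<in> rvs ?PX"
          show "(\<lambda>\<omega>. emeasure (?L (h \<omega>)) A) \<in> borel_measurable Omega_um"
            using prob_rv_measurable[OF qu_product iid_law_rv(2)[OF h] A]
            by (rule measurable_cong[THEN iffD1, rotated]) (simp add: L rvsD(1)[OF PX h])
        qed simp
        have "(\<integral>\<^sup>+ \<mu>. emeasure (?L \<mu>) A \<partial>?P z) = (\<integral>\<^sup>+\<omega>. emeasure (?L (compose Omega directing f \<omega>)) A \<partial>R)"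
          unfolding Pz by (rule nn_integral_distr)
            (use g in \<open>simp_all add: measurable_Omega_probs[OF R] rvs_measurable[OF PX df]\<close>)
        also have "\<dots> = (\<integral>\<^sup>+\<omega>. emeasure (iid_law (directing (f \<omega>))) A \<partial>R)"
        proof (rule nn_integral_cong)
          fix \<omega> assume "\<omega> \<in> space R"
          then have w: "\<omega> \<in> Omega" by (simp add: Omega_probsD(3)[OF R])
          have "?L (compose Omega directing f \<omega>) = iid_law (compose Omega directing f \<omega>)"
            by (rule L) (rule rvsD(1)[OF PX df w])
          then show "emeasure (?L (compose Omega directing f \<omega>)) A = emeasure (iid_law (directing (f \<omega>))) A"
            using w by (simp add: compose_def)
        qed
        also have "\<dots> = emeasure (Q z) A"
          unfolding Qz_eq by (rule exchangeable_iid_mixture[OF R f ex A])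
        finally show "(\<integral>\<^sup>+ \<mu>. emeasure (?L \<mu>) A \<partial>?P z) = emeasure (Q z) A" .
      qed
      then show ?thesis unfolding kernel_comp_def restrict_apply'[OF True] by simp
    qed
  qed
qed

end

section \<open>The empty space and the final equivalence\<close>

lemma no_rvs:
  assumes "quasi_universal X" "points X = {}" shows "rvs X = {}"
proof (rule equals0I)
  fix f assume "f \<in> rvs X"
  from rvsD(1)[OF assms(1) this Omega_nonempty] show False using assms(2) by simp
qed

theorem corollary7p37:
  fixes X :: "'x qus" and Z :: "'z qus" and Q :: "'z \<Rightarrow> (nat \<Rightarrow> 'x) measure"
  assumes "quasi_universal X" and "standard X" and "quasi_universal Z"
    and "Q \<in> markov_kernels Z (seq_qus X)"
  shows "(exchangeable Z X Q \<longleftrightarrow>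
            (\<exists>S :: 'x measure qus. quasi_universal S \<and>
               (\<exists>K \<in> markov_kernels S X. \<exists>P \<in> markov_kernels Z S.
                  Q = kernel_comp Z (seq_qus X) (iid_kernel S X K) P))) \<and>
         (\<forall>S :: 's qus. quasi_universal S \<and>
            (\<exists>K \<in> markov_kernels S X. \<exists>P \<in> markov_kernels Z S.
               Q = kernel_comp Z (seq_qus X) (iid_kernel S X K) P) \<longrightarrow>
            exchangeable Z X Q) \<and>
         (exchangeable Z X Q \<longrightarrow>
            (\<lambda>\<mu>\<in>points (prob_qus X). \<mu>) \<in> markov_kernels (prob_qus X) X \<and>
            (\<exists>P \<in> markov_kernels Z (prob_qus X).
               Q = kernel_comp Z (seq_qus X)
                     (iid_kernel (prob_qus X) X (\<lambda>\<mu>\<in>points (prob_qus X). \<mu>)) P))"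
proof -
  have PX: "quasi_universal (prob_qus X)" by (rule quasi_universal_prob[OF assms(1)])
  let ?id = "\<lambda>\<mu>\<in>points (prob_qus X). \<mu>"
  let ?mix = "\<lambda>S K P. Q = kernel_comp Z (seq_qus X) (iid_kernel S X K) P"
  have "(\<forall>S :: 'x measure qus. \<forall>K \<in> markov_kernels S X. \<forall>P \<in> markov_kernels Z S.
            quasi_universal S \<longrightarrow> ?mix S K P \<longrightarrow> exchangeable Z X Q) \<and>
      (\<forall>S :: 's qus. \<forall>K \<in> markov_kernels S X. \<forall>P \<in> markov_kernels Z S.
            quasi_universal S \<longrightarrow> Q = kernel_comp Z (seq_qus X) (iid_kernel S X K) P \<longrightarrow> exchangeable Z X Q) \<and>
      (exchangeable Z X Q \<longrightarrow> ?id \<in> markov_kernels (prob_qus X) X \<and>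
            (\<exists>P \<in> markov_kernels Z (prob_qus X). ?mix (prob_qus X) ?id P))"
  proof (cases "points X = {}")
    case False
    then obtain j \<rho> where "unit_retract X j \<rho>" using ex_unit_retract[OF assms(1,2)] by blast
    then interpret unit_retract X j \<rho> .
    show ?thesis
      by (intro conjI allI ballI impI)
        (rule exchangeable_representation[OF assms(3,4)] id_kernel iid_mixture_exchangeable[OF assms(3,4)];
          assumption)+
  next
    \<comment> \<open>With \<open>X\<close> empty there are no laws on sequences, so the kernel
      \<open>Q\<close> forces \<open>Z\<close> to be empty, and every claim reduces to kernels with
      empty domain.\<close>
    case True
    have qY: "quasi_universal (seq_qus X)" by (rule quasi_universal_product) (rule assms(1))
    have no_prob: "points (prob_qus X) = {}"
      using no_rvs[OF assms(1) True] by (simp add: prob_qus_def)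
    have "points (seq_qus X) = {}" using True by (auto simp: product_qus_def)
    then have no_seq: "points (prob_qus (seq_qus X)) = {}"
      using no_rvs[OF qY] by (simp add: prob_qus_def)
    have QE: "Q \<in> points Z \<rightarrow>\<^sub>E points (prob_qus (seq_qus X))"
      using assms(4) unfolding markov_kernels_def quasi_measurable_def by blast
    then have Z0: "points Z = {}" unfolding no_seq by (auto simp: PiE_iff)
    have rZ: "rvs Z = {}" by (rule no_rvs[OF assms(3) Z0])
    have rPX: "rvs (prob_qus X) = {}" by (rule no_rvs[OF PX no_prob])
    have "exchangeable Z X Q" by (simp add: exchangeable_def Z0)
    moreover have "(\<lambda>\<mu>\<in>points (prob_qus X). \<mu>) \<in> markov_kernels (prob_qus X) X"
      by (simp add: markov_kernels_def quasi_measurable_def no_prob rPX restrict_def)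
    moreover have "(\<lambda>_. undefined) \<in> markov_kernels Z (prob_qus X)"
      by (simp add: markov_kernels_def quasi_measurable_def Z0 rZ)
    moreover have "Q = kernel_comp Z (seq_qus X) L (\<lambda>_. undefined)" for L :: "'x measure \<Rightarrow> (nat \<Rightarrow> 'x) measure"
      using QE by (auto simp: kernel_comp_def Z0 fun_eq_iff)
    ultimately show ?thesis by blast
  qed
  \<comment> \<open>The forward direction instantiates \<open>S\<close> by
    \<open>prob_qus X\<close>, whose points have type \<open>'x measure\<close>.\<close>
  then show ?thesis using PX by blast
qed

end
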